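(* Let $k$ be a field, let $G$ be a finite group-scheme over $k$ and let $H\subset G$ be a subgroup-scheme. Then the core $\mathrm{Core}_G(H)$ is the biggest normal subgroup-scheme of $G$ contained in $H$.
   Context: Write $G=\mathrm{Spec}(A)$ with $A$ a finite-dimensional Hopf algebra over $k$ and $H=\mathrm{Spec}(A/I)$ with $I$ a Hopf ideal. Let $\tau:A\to A\otimes_k A/I$ be the comodule structure obtained from the comultiplication of $A$ by projecting to $A/I$ (i.e. from restricting the multiplication $G\times_k G\to G$ to $H$ on one coordinate, giving the right action of $H$ on $G$), and let $A^H=\{a\in A:\tau(a)=a\otimes\bar 1\}$. The quotient $G/H$ is $\mathrm{Spec}(A^H)$ (its functor of points is the fppf sheafification of $R\mapsto G(R)/H(R)$), and it carries a left $G$-action $G\times_k G/H\to G/H$ induced by left multiplication. This action defines a comodule coaction of $A$ on $A^H$, equivalently a morphism of group-schemes $\mu:G\to \mathrm{GL}(A^H)$. The core of $H$ in $G$ is $\mathrm{Core}_G(H):=\ker(\mu)$. *)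

theory Defs
  imports "HOL-Algebra.QuotRing" "HOL-Algebra.Module" "HOL-Algebra.Bij" "HOL-Algebra.Coset"
    "HOL-Library.Equipollence"
begin

section \<open>Linear maps, commutative algebras\<close>

definition linear_maps ::
    "('k, 'x) ring_scheme \<Rightarrow> ('k, 'm, 'y) module_scheme \<Rightarrow> ('k, 'n, 'z) module_scheme \<Rightarrow> ('m \<Rightarrow> 'n) set"
  where "linear_maps K M N = {f \<in> carrier M \<rightarrow> carrier N.
    (\<forall>x\<in>carrier M. \<forall>y\<in>carrier M. f (x \<oplus>\<^bsub>M\<^esub> y) = f x \<oplus>\<^bsub>N\<^esub> f y) \<and>
    (\<forall>r\<in>carrier K. \<forall>x\<in>carrier M. f (r \<odot>\<^bsub>M\<^esub> x) = r \<odot>\<^bsub>N\<^esub> f x)}"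

definition algebra_homs ::
    "('k, 'x) ring_scheme \<Rightarrow> ('k, 'm, 'y) module_scheme \<Rightarrow> ('k, 'n, 'z) module_scheme \<Rightarrow> ('m \<Rightarrow> 'n) set"
  where "algebra_homs K M N = ring_hom M N \<inter> linear_maps K M N"

definition finite_dimensional ::
    "('k, 'x) ring_scheme \<Rightarrow> ('k, 'm, 'y) module_scheme \<Rightarrow> bool"
  where "finite_dimensional K M \<longleftrightarrow> (\<exists>B. finite B \<and> B \<subseteq> carrier M \<and>
    (\<forall>v\<in>carrier M. \<exists>c\<in>B \<rightarrow> carrier K. v = (\<Oplus>\<^bsub>M\<^esub>b\<in>B. c b \<odot>\<^bsub>M\<^esub> b)))"

definition scalars :: "'k ring \<Rightarrow> ('k, 'k) module"
  where "scalars K = \<lparr>carrier = carrier K, monoid.mult = monoid.mult K, one = one K,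
    ring.zero = ring.zero K, add = add K, smult = monoid.mult K\<rparr>"

definition quotient_algebra :: "('k, 'a, 'y) module_scheme \<Rightarrow> 'a set \<Rightarrow> ('k, 'a set) module"
  where "quotient_algebra A I = \<lparr>carrier = carrier (A Quot I), monoid.mult = monoid.mult (A Quot I),
    one = one (A Quot I), ring.zero = ring.zero (A Quot I), add = add (A Quot I),
    smult = (\<lambda>r U. \<Union>x\<in>U. I +>\<^bsub>A\<^esub> (r \<odot>\<^bsub>A\<^esub> x))\<rparr>"


section \<open>Tensor products\<close>

text \<open>A list \<open>[(m\<^sub>1, n\<^sub>1), \<dots>, (m\<^sub>r, n\<^sub>r)]\<close> stands for the formal sum of the symbols
  \<open>m\<^sub>i \<otimes> n\<^sub>i\<close>. The relation below is the congruence on formal sums generated by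
  commutativity and bilinearity; additive inverses need no separate generators since
  \<open>-m \<otimes> n\<close> is inverse to \<open>m \<otimes> n\<close>. Its classes form the tensor product over \<open>K\<close>.\<close>

inductive tensor_eq ::
    "('k, 'x) ring_scheme \<Rightarrow> ('k, 'm, 'y) module_scheme \<Rightarrow> ('k, 'n, 'z) module_scheme
      \<Rightarrow> ('m \<times> 'n) list \<Rightarrow> ('m \<times> 'n) list \<Rightarrow> bool"
  for K M N where
  refl: "set xs \<subseteq> carrier M \<times> carrier N \<Longrightarrow> tensor_eq K M N xs xs"
| sym: "tensor_eq K M N xs ys \<Longrightarrow> tensor_eq K M N ys xs"
| trans: "tensor_eq K M N xs ys \<Longrightarrow> tensor_eq K M N ys zs \<Longrightarrow> tensor_eq K M N xs zs"
| append: "tensor_eq K M N xs xs' \<Longrightarrow> tensor_eq K M N ys ys' \<Longrightarrow>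
    tensor_eq K M N (xs @ ys) (xs' @ ys')"
| commute: "set xs \<subseteq> carrier M \<times> carrier N \<Longrightarrow> set ys \<subseteq> carrier M \<times> carrier N \<Longrightarrow>
    tensor_eq K M N (xs @ ys) (ys @ xs)"
| add_left: "m \<in> carrier M \<Longrightarrow> m' \<in> carrier M \<Longrightarrow> n \<in> carrier N \<Longrightarrow>
    tensor_eq K M N [(m \<oplus>\<^bsub>M\<^esub> m', n)] [(m, n), (m', n)]"
| add_right: "m \<in> carrier M \<Longrightarrow> n \<in> carrier N \<Longrightarrow> n' \<in> carrier N \<Longrightarrow>
    tensor_eq K M N [(m, n \<oplus>\<^bsub>N\<^esub> n')] [(m, n), (m, n')]"
| scalar: "r \<in> carrier K \<Longrightarrow> m \<in> carrier M \<Longrightarrow> n \<in> carrier N \<Longrightarrow>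
    tensor_eq K M N [(r \<odot>\<^bsub>M\<^esub> m, n)] [(m, r \<odot>\<^bsub>N\<^esub> n)]"
| zero: "n \<in> carrier N \<Longrightarrow> tensor_eq K M N [(\<zero>\<^bsub>M\<^esub>, n)] []"

definition tensor_class ::
    "('k, 'x) ring_scheme \<Rightarrow> ('k, 'm, 'y) module_scheme \<Rightarrow> ('k, 'n, 'z) module_scheme
      \<Rightarrow> ('m \<times> 'n) list \<Rightarrow> ('m \<times> 'n) list set"
  where "tensor_class K M N xs = {ys. tensor_eq K M N xs ys}"

definition pure_tensor ::
    "('k, 'x) ring_scheme \<Rightarrow> ('k, 'm, 'y) module_scheme \<Rightarrow> ('k, 'n, 'z) module_scheme
      \<Rightarrow> 'm \<Rightarrow> 'n \<Rightarrow> ('m \<times> 'n) list set"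
  where "pure_tensor K M N m n = tensor_class K M N [(m, n)]"

text \<open>The tensor product with its algebra structure; the fields \<open>mult\<close> and \<open>one\<close>
  are meaningful only if both factors are algebras.\<close>

definition tensor ::
    "('k, 'x) ring_scheme \<Rightarrow> ('k, 'm, 'y) module_scheme \<Rightarrow> ('k, 'n, 'z) module_scheme
      \<Rightarrow> ('k, ('m \<times> 'n) list set) module"
  where "tensor K M N =
    \<lparr>carrier = tensor_class K M N ` lists (carrier M \<times> carrier N),
     monoid.mult = (\<lambda>U U'. \<Union>xs\<in>U. \<Union>ys\<in>U'. tensor_class K M N
        [(m \<otimes>\<^bsub>M\<^esub> m', n \<otimes>\<^bsub>N\<^esub> n'). (m, n) \<leftarrow> xs, (m', n') \<leftarrow> ys]),
     one = pure_tensor K M N \<one>\<^bsub>M\<^esub> \<one>\<^bsub>N\<^esub>,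
     ring.zero = tensor_class K M N [],
     add = (\<lambda>U U'. \<Union>xs\<in>U. \<Union>ys\<in>U'. tensor_class K M N (xs @ ys)),
     smult = (\<lambda>r U. \<Union>xs\<in>U. tensor_class K M N (map (\<lambda>(m, n). (r \<odot>\<^bsub>M\<^esub> m, n)) xs))\<rparr>"

text \<open>The linear map out of a tensor product with \<open>m \<otimes> n \<mapsto> \<beta> m n\<close>. It is independent of the
  chosen representative as soon as \<open>\<beta>\<close> is \<open>K\<close>-bilinear, which is the case in all uses below.\<close>

definition tensor_lift ::
    "('p, 'x) ring_scheme \<Rightarrow> ('m \<Rightarrow> 'n \<Rightarrow> 'p) \<Rightarrow> ('m \<times> 'n) list set \<Rightarrow> 'p"
  where "tensor_lift P \<beta> U =
    foldr (\<lambda>(m, n) p. \<beta> m n \<oplus>\<^bsub>P\<^esub> p) (SOME xs. xs \<in> U) \<zero>\<^bsub>P\<^esub>"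

text \<open>\<open>f \<otimes> g\<close> with values in \<open>M' \<otimes> N'\<close>.\<close>

definition tensor_map ::
    "('k, 'x) ring_scheme \<Rightarrow> ('k, 'm2, 'y) module_scheme \<Rightarrow> ('k, 'n2, 'z) module_scheme
      \<Rightarrow> ('m \<Rightarrow> 'm2) \<Rightarrow> ('n \<Rightarrow> 'n2) \<Rightarrow> ('m \<times> 'n) list set \<Rightarrow> ('m2 \<times> 'n2) list set"
  where "tensor_map K M' N' f g =
    tensor_lift (tensor K M' N') (\<lambda>m n. pure_tensor K M' N' (f m) (g n))"

definition tensor_assoc ::
    "('k, 'x) ring_scheme \<Rightarrow> ('k, 'm, 'y) module_scheme \<Rightarrow> ('k, 'n, 'z) module_scheme
      \<Rightarrow> ('k, 'p, 'w) module_scheme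
      \<Rightarrow> (('m \<times> 'n) list set \<times> 'p) list set \<Rightarrow> ('m \<times> ('n \<times> 'p) list set) list set"
  where "tensor_assoc K M N P =
    (let T = tensor K M (tensor K N P) in
      tensor_lift T (\<lambda>U p. tensor_lift T
        (\<lambda>m n. pure_tensor K M (tensor K N P) m (pure_tensor K N P n p)) U))"


section \<open>Finite group-schemes as commutative Hopf algebras\<close>

record ('k, 'a) hopf_algebra = "('k, 'a) module" +
  comult :: "'a \<Rightarrow> ('a \<times> 'a) list set"
  counit :: "'a \<Rightarrow> 'k"
  antipode :: "'a \<Rightarrow> 'a"

text \<open>\<open>G = Spec A\<close> for a finite-dimensional commutative Hopf algebra \<open>A\<close> over the field \<open>K\<close>
  (commutativity is part of the locale \<^locale>\<open>algebra\<close>).\<close>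

locale finite_group_scheme =
  fixes K :: "'k ring" and A :: "('k, 'a) hopf_algebra"
  assumes field: "field K"
    and algebra: "algebra K A"
    and finite_dim: "finite_dimensional K A"
    and comult: "comult A \<in> algebra_homs K A (tensor K A A)"
    and counit: "counit A \<in> algebra_homs K A (scalars K)"
    and antipode: "antipode A \<in> linear_maps K A A"
    and coassoc: "a \<in> carrier A \<Longrightarrow>
      tensor_assoc K A A A (tensor_map K (tensor K A A) A (comult A) id (comult A a)) =
      tensor_map K A (tensor K A A) id (comult A) (comult A a)"
    and counit_left: "a \<in> carrier A \<Longrightarrow>
      tensor_lift A (\<lambda>x y. counit A x \<odot>\<^bsub>A\<^esub> y) (comult A a) = a"
    and counit_right: "a \<in> carrier A \<Longrightarrow>
      tensor_lift A (\<lambda>x y. counit A y \<odot>\<^bsub>A\<^esub> x) (comult A a) = a"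
    and antipode_left: "a \<in> carrier A \<Longrightarrow>
      tensor_lift A (\<lambda>x y. antipode A x \<otimes>\<^bsub>A\<^esub> y) (comult A a) = counit A a \<odot>\<^bsub>A\<^esub> \<one>\<^bsub>A\<^esub>"
    and antipode_right: "a \<in> carrier A \<Longrightarrow>
      tensor_lift A (\<lambda>x y. x \<otimes>\<^bsub>A\<^esub> antipode A y) (comult A a) = counit A a \<odot>\<^bsub>A\<^esub> \<one>\<^bsub>A\<^esub>"

text \<open>The condition on \<open>comult\<close> is \<open>\<Delta>(I) \<subseteq> I \<otimes> A + A \<otimes> I\<close>. An ideal of the algebra \<open>A\<close> is
  automatically a subspace.\<close>

definition hopf_ideal :: "'k ring \<Rightarrow> ('k, 'a) hopf_algebra \<Rightarrow> 'a set \<Rightarrow> bool"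
  where "hopf_ideal K A I \<longleftrightarrow> ideal I A \<and>
    (\<forall>a\<in>I. \<exists>xs\<in>lists (I \<times> carrier A \<union> carrier A \<times> I). comult A a = tensor_class K A A xs) \<and>
    (\<forall>a\<in>I. counit A a = \<zero>\<^bsub>K\<^esub>) \<and>
    (\<forall>a\<in>I. antipode A a \<in> I)"


section \<open>Functors of points\<close>

text \<open>\<open>G(R)\<close> with the convolution product. Points are extensional so that equality of points is
  equality on \<open>carrier A\<close>.\<close>

definition points :: "'k ring \<Rightarrow> ('k, 'a) hopf_algebra \<Rightarrow> ('k, 'r) module \<Rightarrow> ('a \<Rightarrow> 'r) monoid"
  where "points K A R =
    \<lparr>carrier = algebra_homs K A R \<inter> extensional (carrier A),
     monoid.mult = (\<lambda>g h. \<lambda>a\<in>carrier A. tensor_lift R (\<lambda>x y. g x \<otimes>\<^bsub>R\<^esub> h y) (comult A a)),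
     one = (\<lambda>a\<in>carrier A. counit A a \<odot>\<^bsub>R\<^esub> \<one>\<^bsub>R\<^esub>)\<rparr>"

text \<open>Subfunctors of \<open>G\<close>, on the commutative \<open>K\<close>-algebras with carrier in a type \<open>'r\<close>, which
  serves as the universe of test algebras.\<close>

type_synonym ('k, 'a, 'r) subfunctor = "('k, 'r) module \<Rightarrow> ('a \<Rightarrow> 'r) set"

definition closed_subscheme ::
    "'k ring \<Rightarrow> ('k, 'a) hopf_algebra \<Rightarrow> 'a set \<Rightarrow> ('k, 'a, 'r) subfunctor"
  where "closed_subscheme K A I R = {g \<in> carrier (points K A R). \<forall>a\<in>I. g a = \<zero>\<^bsub>R\<^esub>}"

definition contained_in ::
    "'k ring \<Rightarrow> ('k, 'a, 'r) subfunctor \<Rightarrow> ('k, 'a, 'r) subfunctor \<Rightarrow> bool"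
  where "contained_in K F F' \<longleftrightarrow> (\<forall>R. algebra K R \<longrightarrow> F R \<subseteq> F' R)"

text \<open>Subgroup-schemes of a finite group-scheme over a field are closed, i.e. given by Hopf
  ideals.\<close>

definition subgroup_scheme ::
    "'k ring \<Rightarrow> ('k, 'a) hopf_algebra \<Rightarrow> ('k, 'a, 'r) subfunctor \<Rightarrow> bool"
  where "subgroup_scheme K A F \<longleftrightarrow>
    (\<exists>J. hopf_ideal K A J \<and> (\<forall>R. algebra K R \<longrightarrow> F R = closed_subscheme K A J R))"

definition normal_subgroup_scheme ::
    "'k ring \<Rightarrow> ('k, 'a) hopf_algebra \<Rightarrow> ('k, 'a, 'r) subfunctor \<Rightarrow> bool"
  where "normal_subgroup_scheme K A F \<longleftrightarrow>
    subgroup_scheme K A F \<and> (\<forall>R. algebra K R \<longrightarrow> F R \<lhd> points K A R)"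


section \<open>The quotient and the core\<close>

text \<open>\<open>\<tau> : A \<rightarrow> A \<otimes> A/I\<close>\<close>

definition right_coaction ::
    "'k ring \<Rightarrow> ('k, 'a) hopf_algebra \<Rightarrow> 'a set \<Rightarrow> 'a \<Rightarrow> ('a \<times> 'a set) list set"
  where "right_coaction K A I a =
    tensor_map K A (quotient_algebra A I) id (\<lambda>x. I +>\<^bsub>A\<^esub> x) (comult A a)"

text \<open>The algebra \<open>A\<^sup>H\<close>, so that \<open>G/H = Spec A\<^sup>H\<close>. It is the record \<open>A\<close> with a smaller
  carrier; only its algebra structure is used.\<close>

definition coinvariants :: "'k ring \<Rightarrow> ('k, 'a) hopf_algebra \<Rightarrow> 'a set \<Rightarrow> ('k, 'a) hopf_algebra"
  where "coinvariants K A I = A\<lparr>carrier := {a \<in> carrier A.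
    right_coaction K A I a = pure_tensor K A (quotient_algebra A I) a (I +>\<^bsub>A\<^esub> \<one>\<^bsub>A\<^esub>)}\<rparr>"

text \<open>The comorphism \<open>A\<^sup>H \<rightarrow> A \<otimes> A\<^sup>H\<close> of the action \<open>G \<times> G/H \<rightarrow> G/H\<close>: the factorisation of
  \<open>\<Delta>\<close> restricted to \<open>A\<^sup>H\<close> through the injection \<open>A \<otimes> A\<^sup>H \<rightarrow> A \<otimes> A\<close>.\<close>

definition left_coaction ::
    "'k ring \<Rightarrow> ('k, 'a) hopf_algebra \<Rightarrow> 'a set \<Rightarrow> 'a \<Rightarrow> ('a \<times> 'a) list set"
  where "left_coaction K A I v =
    (THE U. U \<in> carrier (tensor K A (coinvariants K A I)) \<and> tensor_map K A A id id U = comult A v)"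

text \<open>\<open>R \<otimes>\<^sub>K V\<close> as an \<open>R\<close>-module.\<close>

definition base_change ::
    "('k, 'x) ring_scheme \<Rightarrow> ('k, 'r, 'y) module_scheme \<Rightarrow> ('k, 'v, 'z) module_scheme
      \<Rightarrow> ('r, ('r \<times> 'v) list set) module"
  where "base_change K R V =
    \<lparr>carrier = carrier (tensor K R V), monoid.mult = monoid.mult (tensor K R V), one = one (tensor K R V),
     ring.zero = ring.zero (tensor K R V), add = add (tensor K R V),
     smult = (\<lambda>r U. \<Union>xs\<in>U. tensor_class K R V (map (\<lambda>(s, v). (r \<otimes>\<^bsub>R\<^esub> s, v)) xs))\<rparr>"

text \<open>\<open>GL(V)(R)\<close>, the group of \<open>R\<close>-linear automorphisms of \<open>R \<otimes>\<^sub>K V\<close>.\<close>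

definition general_linear ::
    "('k, 'x) ring_scheme \<Rightarrow> ('k, 'v, 'z) module_scheme \<Rightarrow> ('k, 'r) module
      \<Rightarrow> (('r \<times> 'v) list set \<Rightarrow> ('r \<times> 'v) list set) monoid"
  where "general_linear K V R =
    (let W = base_change K R V in
      (BijGroup (carrier W))\<lparr>carrier := Bij (carrier W) \<inter> linear_maps R W W\<rparr>)"

text \<open>For \<open>g \<in> G(R)\<close>, the \<open>R\<close>-linear endomorphism of \<open>R \<otimes> A\<^sup>H\<close> induced by the coaction, that is
  \<open>f \<mapsto> (x \<mapsto> f (g x))\<close> on functions on \<open>G/H\<close>.\<close>

definition translate ::
    "'k ring \<Rightarrow> ('k, 'a) hopf_algebra \<Rightarrow> 'a set \<Rightarrow> ('k, 'r) module \<Rightarrow> ('a \<Rightarrow> 'r)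
      \<Rightarrow> ('r \<times> 'a) list set \<Rightarrow> ('r \<times> 'a) list set"
  where "translate K A I R g =
    (let V = coinvariants K A I; W = base_change K R V in
      (\<lambda>U\<in>carrier W. tensor_lift W (\<lambda>r v. tensor_lift W
        (\<lambda>a w. pure_tensor K R V (r \<otimes>\<^bsub>R\<^esub> g a) w) (left_coaction K A I v)) U))"

text \<open>\<open>\<mu> : G \<rightarrow> GL(A\<^sup>H)\<close> on \<open>R\<close>-points. The inverse turns the right action by
  translations into a left one, so that \<open>\<mu>\<close> is a homomorphism: \<open>\<mu> g f = (x \<mapsto> f (g\<^sup>-\<^sup>1 x))\<close>.\<close>

definition mu ::
    "'k ring \<Rightarrow> ('k, 'a) hopf_algebra \<Rightarrow> 'a set \<Rightarrow> ('k, 'r) module \<Rightarrow> ('a \<Rightarrow> 'r)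
      \<Rightarrow> ('r \<times> 'a) list set \<Rightarrow> ('r \<times> 'a) list set"
  where "mu K A I R g = translate K A I R (inv\<^bsub>points K A R\<^esub> g)"

definition core :: "'k ring \<Rightarrow> ('k, 'a) hopf_algebra \<Rightarrow> 'a set \<Rightarrow> ('k, 'a, 'r) subfunctor"
  where "core K A I R =
    kernel (points K A R) (general_linear K (coinvariants K A I) R) (mu K A I R)"

text \<open>The universe of test algebras has to contain a copy of every algebra that is finitely
  generated as a module over \<open>A\<close>, in particular of \<open>A \<otimes> A\<close> and its quotients.\<close>

definition large_universe :: "('k, 'a) hopf_algebra \<Rightarrow> 'r itself \<Rightarrow> bool"
  where "large_universe A _ \<longleftrightarrow>
    infinite (UNIV :: 'r set) \<and> carrier A \<lesssim> (UNIV :: 'r set)"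

end

theory Submission
  imports Defs
begin

text \<open>Let \<open>V = A\<^sup>H\<close>. By coassociativity \<open>\<Delta>(V) \<subseteq> A \<otimes> V\<close>, and a point \<open>g\<close> acts trivially on \<open>V\<close> iff it
  kills the ideal \<open>J\<close> generated by the matrix coefficients \<open>\<Sigma> \<phi>(v\<^sub>2) v\<^sub>1 - \<phi>(v)\<close>; this is a Hopf
  ideal, so the core is the closed subgroup-scheme defined by \<open>J\<close>. Equivalently, convolution with \<open>g\<close>
  fixes the restrictions to \<open>V\<close> of all linear maps, which makes normality evident.

  That the core lies in \<open>H\<close> amounts to \<open>I\<close> being generated by the elements of \<open>V\<close> on which the counit
  vanishes. With a dual basis \<open>(b\<^sub>j, \<phi>\<^sub>j)\<close> of \<open>A/I\<close>, the traces \<open>t\<^sub>j(c)\<close> of the operators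
  \<open>x \<mapsto> (cx)\<^sub>1 \<phi>\<^sub>j((cx)\<^sub>2)\<close> are integrals on \<open>A/I\<close> with \<open>\<Sigma> t\<^sub>j(c S(b\<^sub>j)) = \<epsilon>(c)\<close>. Hence every
  \<open>a\<close> is the sum over \<open>j\<close> of \<open>S(h\<^sub>1) w(h\<^sub>2 a)\<close> with \<open>h = S(b\<^sub>j)\<close> and \<open>w(z) = z\<^sub>1 t\<^sub>j(z\<^sub>2) \<in> V\<close>;
  if \<open>a \<in> I\<close>, the counit of each \<open>w(h\<^sub>2 a)\<close> is \<open>t\<^sub>j(h\<^sub>2 a) = 0\<close>.

  A normal \<open>N \<subseteq> H\<close> acts trivially on \<open>V\<close>, because \<open>v(n x) = v(x (x\<^sup>-\<^sup>1 n x)) = v(x)\<close> for the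
  generic point \<open>x\<close> of \<open>G\<close>.\<close>

section \<open>Sums over lists of pairs and linear maps\<close>

text \<open>The delicate half is containment in \<open>H\<close>. Averaging over \<open>H\<close>
  would call for an integral \<open>t\<close> on \<open>A/I\<close> with \<open>t(1) = 1\<close>,
  and there is none unless \<open>H\<close> is linearly reductive; the infinitesimal group
  \<alpha>_p has none. The traces get round this: for \<open>c = 1\<close> their identity reads
  \<open>\<Sum> t_j(S(b_j)) = 1\<close>, so the normalisation is spread over a whole dual system
  instead of resting on one integral. Their invariance is linear algebra: the Galois map
  \<open>a \<otimes> x \<mapsto> a x\<^sub>1 \<otimes> x\<^sub>2\<close> of \<open>A/I\<close> is
  invertible by means of the antipode, and conjugation preserves traces.

  The other obstacle is one of types. A subfunctor is known only on algebras carried by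
  \<open>'r\<close>, whereas the generic point of \<open>G\<close> lives over
  \<open>R \<otimes> A\<close>, whose elements are classes of lists. Finitely many coordinates in
  \<open>R\<close> determine such an element, so this algebra embeds in an infinite
  \<open>'r\<close> and is moved there. By contrast \<open>acts_trivially\<close> makes sense for
  algebras on every type; this is why it can be evaluated directly at the projection
  \<open>A \<rightarrow> A/J\<close> when \<open>J\<close> is shown to be a Hopf ideal.\<close>

definition tsum :: "('p, 'x) ring_scheme \<Rightarrow> ('m \<Rightarrow> 'n \<Rightarrow> 'p) \<Rightarrow> ('m \<times> 'n) list \<Rightarrow> 'p"
  where "tsum P \<beta> xs = foldr (\<lambda>(m, n) p. \<beta> m n \<oplus>\<^bsub>P\<^esub> p) xs \<zero>\<^bsub>P\<^esub>"

lemma tsum_Nil [simp]: "tsum P \<beta> [] = \<zero>\<^bsub>P\<^esub>"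
  and tsum_Cons [simp]: "tsum P \<beta> ((x, y) # xs) = \<beta> x y \<oplus>\<^bsub>P\<^esub> tsum P \<beta> xs"
  by (simp_all add: tsum_def)

lemma tensor_lift_tsum: "tensor_lift P \<beta> U = tsum P \<beta> (SOME xs. xs \<in> U)"
  by (simp add: tensor_lift_def tsum_def)

lemma tsum_cong:
  assumes "\<And>x y. (x, y) \<in> set xs \<Longrightarrow> \<beta> x y = \<beta>' x y"
  shows "tsum P \<beta> xs = tsum P \<beta>' xs"
  using assms by (induction xs) auto

lemma tsum_map: "tsum P \<beta> (map (\<lambda>(x, y). (f x y, g x y)) xs) = tsum P (\<lambda>x y. \<beta> (f x y) (g x y)) xs"
  by (induction xs) auto

context abelian_monoid
begin

lemma tsum_closed:
  assumes "\<And>x y. (x, y) \<in> set xs \<Longrightarrow> \<beta> x y \<in> carrier G"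
  shows "tsum G \<beta> xs \<in> carrier G"
  using assms by (induction xs) auto

lemma tsum_append:
  assumes "\<And>x y. (x, y) \<in> set (xs @ ys) \<Longrightarrow> \<beta> x y \<in> carrier G"
  shows "tsum G \<beta> (xs @ ys) = tsum G \<beta> xs \<oplus> tsum G \<beta> ys"
  using assms by (induction xs) (auto simp: tsum_closed a_assoc)

lemma tsum_add:
  assumes "\<And>x y. (x, y) \<in> set xs \<Longrightarrow> \<beta> x y \<in> carrier G"
    and "\<And>x y. (x, y) \<in> set xs \<Longrightarrow> \<gamma> x y \<in> carrier G"
  shows "tsum G (\<lambda>x y. \<beta> x y \<oplus> \<gamma> x y) xs = tsum G \<beta> xs \<oplus> tsum G \<gamma> xs"
  using assms by (induction xs) (auto simp: tsum_closed a_ac)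

lemma tsum_zero: "tsum G (\<lambda>x y. \<zero>) xs = \<zero>"
  by (induction xs) auto

lemma tsum_swap:
  assumes "\<And>x y u v. (x, y) \<in> set xs \<Longrightarrow> (u, v) \<in> set ys \<Longrightarrow> \<gamma> x y u v \<in> carrier G"
  shows "tsum G (\<lambda>x y. tsum G (\<lambda>u v. \<gamma> x y u v) ys) xs = tsum G (\<lambda>u v. tsum G (\<lambda>x y. \<gamma> x y u v) xs) ys"
  using assms
proof (induction xs)
  case Nil
  then show ?case by (simp add: tsum_zero)
next
  case (Cons p xs)
  obtain x y where [simp]: "p = (x, y)" by force
  have "tsum G (\<lambda>u v. \<gamma> x y u v \<oplus> tsum G (\<lambda>x y. \<gamma> x y u v) xs) ys =
      tsum G (\<lambda>u v. \<gamma> x y u v) ys \<oplus> tsum G (\<lambda>u v. tsum G (\<lambda>x y. \<gamma> x y u v) xs) ys"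
    using Cons.prems by (intro tsum_add tsum_closed) auto
  then show ?case using Cons by simp
qed

end

section \<open>Linear and bilinear maps\<close>

lemma linear_mapsI:
  assumes "\<And>x. x \<in> carrier M \<Longrightarrow> f x \<in> carrier N"
    and "\<And>x y. x \<in> carrier M \<Longrightarrow> y \<in> carrier M \<Longrightarrow> f (x \<oplus>\<^bsub>M\<^esub> y) = f x \<oplus>\<^bsub>N\<^esub> f y"
    and "\<And>r x. r \<in> carrier K \<Longrightarrow> x \<in> carrier M \<Longrightarrow> f (r \<odot>\<^bsub>M\<^esub> x) = r \<odot>\<^bsub>N\<^esub> f x"
  shows "f \<in> linear_maps K M N"
  using assms by (auto simp: linear_maps_def)

lemma lin_closed: "f \<in> linear_maps K M N \<Longrightarrow> x \<in> carrier M \<Longrightarrow> f x \<in> carrier N"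
  and lin_add: "f \<in> linear_maps K M N \<Longrightarrow> x \<in> carrier M \<Longrightarrow> y \<in> carrier M \<Longrightarrow> f (x \<oplus>\<^bsub>M\<^esub> y) = f x \<oplus>\<^bsub>N\<^esub> f y"
  and lin_smult: "f \<in> linear_maps K M N \<Longrightarrow> r \<in> carrier K \<Longrightarrow> x \<in> carrier M \<Longrightarrow> f (r \<odot>\<^bsub>M\<^esub> x) = r \<odot>\<^bsub>N\<^esub> f x"
  by (auto simp: linear_maps_def)

text \<open>\<open>linear_maps\<close> constrains a function on the carrier only, so a linear map
  may be replaced by its restriction. This keeps the extensional points linear.\<close>

lemma lin_cong:
  assumes "f \<in> linear_maps K M N" "\<And>x. x \<in> carrier M \<Longrightarrow> f x = g x" "module K M"
  shows "g \<in> linear_maps K M N"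
proof -
  interpret M: module K M by fact
  show ?thesis
    by (rule linear_mapsI)
      (simp_all add: assms(2)[symmetric] lin_closed[OF assms(1)] lin_add[OF assms(1)] lin_smult[OF assms(1)])
qed

lemma lin_zero:
  assumes "f \<in> linear_maps K M N" "module K M" "module K N"
  shows "f \<zero>\<^bsub>M\<^esub> = \<zero>\<^bsub>N\<^esub>"
proof -
  interpret M: module K M by fact
  interpret N: module K N by fact
  have "f \<zero>\<^bsub>M\<^esub> = f (\<zero>\<^bsub>K\<^esub> \<odot>\<^bsub>M\<^esub> \<zero>\<^bsub>M\<^esub>)" by simp
  also have "\<dots> = \<zero>\<^bsub>K\<^esub> \<odot>\<^bsub>N\<^esub> f \<zero>\<^bsub>M\<^esub>" using assms(1) by (intro lin_smult) auto
  finally show ?thesis using lin_closed[OF assms(1)] by simp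
qed

lemma lin_minus:
  assumes "f \<in> linear_maps K M N" "module K M" "module K N" "x \<in> carrier M" "y \<in> carrier M"
  shows "f (x \<ominus>\<^bsub>M\<^esub> y) = f x \<ominus>\<^bsub>N\<^esub> f y"
proof -
  interpret M: module K M by fact
  interpret N: module K N by fact
  have "f (x \<ominus>\<^bsub>M\<^esub> y) \<oplus>\<^bsub>N\<^esub> f y = f x"
    using assms by (subst lin_add[OF assms(1), symmetric])
      (auto simp: M.minus_eq M.a_assoc M.l_neg)
  then show ?thesis
    using assms lin_closed[OF assms(1)] by (simp add: N.minus_eq N.add.inv_solve_right)
qed

lemma lin_tsum:
  assumes "f \<in> linear_maps K M N" "module K M" "module K N"
    and "\<And>x y. (x, y) \<in> set xs \<Longrightarrow> \<beta> x y \<in> carrier M"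
  shows "f (tsum M \<beta> xs) = tsum N (\<lambda>x y. f (\<beta> x y)) xs"
proof -
  interpret M: module K M by fact
  show ?thesis
    using assms(4)
    by (induction xs)
      (auto simp: lin_zero[OF assms(1-3)] lin_add[OF assms(1)] M.tsum_closed)
qed

lemma lin_id: "(\<lambda>x. x) \<in> linear_maps K M M"
  and lin_id': "id \<in> linear_maps K M M"
  by (auto simp: linear_maps_def)

lemma lin_comp:
  assumes "f \<in> linear_maps K M N" "g \<in> linear_maps K N P"
  shows "(\<lambda>x. g (f x)) \<in> linear_maps K M P"
  using assms by (auto simp: linear_maps_def Pi_iff)

lemma lin_add_fun:
  assumes "module K P" "f \<in> linear_maps K M P" "g \<in> linear_maps K M P"
  shows "(\<lambda>x. f x \<oplus>\<^bsub>P\<^esub> g x) \<in> linear_maps K M P"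
proof -
  interpret P: module K P by fact
  show ?thesis
    by (rule linear_mapsI)
      (use assms in \<open>auto simp: lin_closed lin_add lin_smult P.smult_r_distr P.a_ac\<close>)
qed

lemma lin_zero_fun: "module K P \<Longrightarrow> (\<lambda>x. \<zero>\<^bsub>P\<^esub>) \<in> linear_maps K M P"
proof -
  assume "module K P"
  then interpret P: module K P .
  show ?thesis by (rule linear_mapsI) auto
qed

lemma lin_smult_const:
  assumes "module K P" "f \<in> linear_maps K M P" "c \<in> carrier K"
  shows "(\<lambda>x. c \<odot>\<^bsub>P\<^esub> f x) \<in> linear_maps K M P"
proof -
  interpret P: module K P by fact
  show ?thesis
    by (rule linear_mapsI)
      (use assms in \<open>auto simp: lin_closed lin_add lin_smult P.smult_r_distr
        P.smult_assoc1[symmetric] P.R.m_comm\<close>)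
qed

lemma scalars_simps [simp]:
  "carrier (scalars K) = carrier K" "monoid.mult (scalars K) = monoid.mult K"
  "one (scalars K) = one K" "ring.zero (scalars K) = ring.zero K"
  "add (scalars K) = add K" "smult (scalars K) = monoid.mult K"
  by (simp_all add: scalars_def)

lemma algebra_scalars:
  assumes "cring K"
  shows "algebra K (scalars K)"
proof -
  interpret cring K by fact
  have "cring (scalars K)"
    by (intro cringI abelian_groupI comm_monoidI)
      (auto simp: a_ac m_ac l_distr r_distr intro: add.l_inv_ex)
  then show ?thesis
    by (intro algebraI) (auto simp: l_distr r_distr m_ac is_cring)
qed

lemma lin_smult_fun:
  assumes "module K P" "f \<in> linear_maps K M (scalars K)" "p \<in> carrier P"
  shows "(\<lambda>x. f x \<odot>\<^bsub>P\<^esub> p) \<in> linear_maps K M P"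
proof -
  interpret P: module K P by fact
  have "\<And>x. x \<in> carrier M \<Longrightarrow> f x \<in> carrier K"
    using lin_closed[OF assms(2)] by simp
  then show ?thesis
    by (intro linear_mapsI)
      (use assms in \<open>auto simp: lin_add lin_smult P.smult_l_distr P.smult_assoc1\<close>)
qed

lemma (in algebra) smult_assoc2_right:
  assumes "a \<in> carrier R" "x \<in> carrier M" "y \<in> carrier M"
  shows "x \<otimes>\<^bsub>M\<^esub> (a \<odot>\<^bsub>M\<^esub> y) = a \<odot>\<^bsub>M\<^esub> (x \<otimes>\<^bsub>M\<^esub> y)"
  using assms by (metis smult_assoc2 smult_closed m_comm)

lemma lin_mult_left:
  assumes "algebra K P" "f \<in> linear_maps K M P" "p \<in> carrier P"
  shows "(\<lambda>x. p \<otimes>\<^bsub>P\<^esub> f x) \<in> linear_maps K M P"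
proof -
  interpret P: algebra K P by fact
  show ?thesis
    by (rule linear_mapsI)
      (use assms in \<open>auto simp: lin_closed lin_add lin_smult P.r_distr P.smult_assoc2_right\<close>)
qed

lemma lin_mult_right:
  assumes "algebra K P" "f \<in> linear_maps K M P" "p \<in> carrier P"
  shows "(\<lambda>x. f x \<otimes>\<^bsub>P\<^esub> p) \<in> linear_maps K M P"
proof -
  interpret P: algebra K P by fact
  show ?thesis
    by (rule linear_mapsI)
      (use assms in \<open>auto simp: lin_closed lin_add lin_smult P.l_distr P.smult_assoc2\<close>)
qed

lemma lin_tsum_fun:
  assumes "module K P" "\<And>x y. (x, y) \<in> set xs \<Longrightarrow> (\<lambda>z. \<gamma> z x y) \<in> linear_maps K M P"
  shows "(\<lambda>z. tsum P (\<gamma> z) xs) \<in> linear_maps K M P"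
  using assms(2)
proof (induction xs)
  case Nil
  then show ?case by (simp add: lin_zero_fun assms(1))
next
  case (Cons p xs)
  then show ?case by (cases p) (auto intro!: lin_add_fun[OF assms(1)])
qed

definition bilinear ::
    "('k, 'x) ring_scheme \<Rightarrow> ('k, 'm, 'y) module_scheme \<Rightarrow> ('k, 'n, 'z) module_scheme
      \<Rightarrow> ('k, 'p, 'w) module_scheme \<Rightarrow> ('m \<Rightarrow> 'n \<Rightarrow> 'p) \<Rightarrow> bool"
  where "bilinear K M N P \<beta> \<longleftrightarrow> (\<forall>m\<in>carrier M. \<beta> m \<in> linear_maps K N P) \<and>
    (\<forall>n\<in>carrier N. (\<lambda>m. \<beta> m n) \<in> linear_maps K M P)"

lemma bilinearI:
  assumes "\<And>m. m \<in> carrier M \<Longrightarrow> (\<lambda>n. \<beta> m n) \<in> linear_maps K N P"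
    and "\<And>n. n \<in> carrier N \<Longrightarrow> (\<lambda>m. \<beta> m n) \<in> linear_maps K M P"
  shows "bilinear K M N P \<beta>"
  using assms by (auto simp: bilinear_def)

lemma bilinear_left: "bilinear K M N P \<beta> \<Longrightarrow> n \<in> carrier N \<Longrightarrow> (\<lambda>m. \<beta> m n) \<in> linear_maps K M P"
  and bilinear_right: "bilinear K M N P \<beta> \<Longrightarrow> m \<in> carrier M \<Longrightarrow> (\<lambda>n. \<beta> m n) \<in> linear_maps K N P"
  by (auto simp: bilinear_def)

lemma bilinear_closed:
  "bilinear K M N P \<beta> \<Longrightarrow> m \<in> carrier M \<Longrightarrow> n \<in> carrier N \<Longrightarrow> \<beta> m n \<in> carrier P"
  using bilinear_left lin_closed by fastforce

section \<open>Tensor products of modules\<close>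

locale two_modules = M: module K M + N: module K N
  for K :: "'k ring" and M :: "('k, 'm, 'y) module_scheme"
    and N :: "('k, 'n, 'z) module_scheme"
begin

definition "tlists = lists (carrier M \<times> carrier N)"

lemma tlists_simps [simp]:
  "[] \<in> tlists" "(x, y) # xs \<in> tlists \<longleftrightarrow> x \<in> carrier M \<and> y \<in> carrier N \<and> xs \<in> tlists"
  "xs @ ys \<in> tlists \<longleftrightarrow> xs \<in> tlists \<and> ys \<in> tlists"
  by (auto simp: tlists_def)

lemma tlistsD: "xs \<in> tlists \<Longrightarrow> (x, y) \<in> set xs \<Longrightarrow> x \<in> carrier M \<and> y \<in> carrier N"
  by (auto simp: tlists_def)

lemma tlistsD1 [dest]: "xs \<in> tlists \<Longrightarrow> (x, y) \<in> set xs \<Longrightarrow> x \<in> carrier M"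
  and tlistsD2 [dest]: "xs \<in> tlists \<Longrightarrow> (x, y) \<in> set xs \<Longrightarrow> y \<in> carrier N"
  by (auto simp: tlists_def)

lemma tlists_iff: "xs \<in> tlists \<longleftrightarrow> set xs \<subseteq> carrier M \<times> carrier N"
  by (auto simp: tlists_def)

abbreviation "T \<equiv> tensor K M N"
abbreviation "cls \<equiv> tensor_class K M N"
abbreviation "pure \<equiv> pure_tensor K M N"

lemma tensor_eq_lists: "tensor_eq K M N xs ys \<Longrightarrow> xs \<in> tlists \<and> ys \<in> tlists"
  by (induction rule: tensor_eq.induct) (auto simp: tlists_iff)

lemma tensor_eq_refl: "xs \<in> tlists \<Longrightarrow> tensor_eq K M N xs xs"
  by (rule tensor_eq.refl) (simp add: tlists_iff)

text \<open>The existence half of the universal property, on formal sums: each generator of the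
  congruence is one instance of bilinearity or of the laws of an abelian group.\<close>

lemma tensor_eq_tsum:
  assumes "tensor_eq K M N xs ys" "bilinear K M N P \<beta>" "module K P"
  shows "tsum P \<beta> xs = tsum P \<beta> ys"
proof -
  interpret P: module K P by fact
  note cl = bilinear_closed[OF assms(2)]
  have app: "tsum P \<beta> (xs @ ys) = tsum P \<beta> xs \<oplus>\<^bsub>P\<^esub> tsum P \<beta> ys"
    if "xs \<in> tlists" "ys \<in> tlists" for xs ys
    by (rule P.tsum_append) (use that cl tlistsD in fastforce)
  have cls: "tsum P \<beta> xs \<in> carrier P" if "xs \<in> tlists" for xs
    by (rule P.tsum_closed) (use that cl tlistsD in fastforce)
  note L = bilinear_left[OF assms(2)] and R = bilinear_right[OF assms(2)]
  show ?thesis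
    using assms(1)
  proof (induction rule: tensor_eq.induct)
    case (append xs xs' ys ys')
    then show ?case
      using tensor_eq_lists[OF append(1)] tensor_eq_lists[OF append(2)]
      by (simp add: app)
  next
    case (commute xs ys)
    then show ?case
      by (simp add: app cls P.a_comm flip: tlists_iff)
  next
    case (add_left m m' n)
    then show ?case using lin_add[OF L] by (auto simp: cl P.a_assoc)
  next
    case (add_right m n n')
    then show ?case using lin_add[OF R] by (auto simp: cl P.a_assoc)
  next
    case (scalar r m n)
    then show ?case using lin_smult[OF R] lin_smult[OF L] by (auto simp: cl)
  next
    case (zero n)
    then show ?case using lin_zero[OF L] M.module_axioms P.module_axioms by (auto simp: cl)
  qed auto
qed

text \<open>The hypothesis is one-sided because an ill-formed list has the empty class, while
  \<open>xs\<close> belongs to its own.\<close>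

lemma cls_eq_iff: "xs \<in> tlists \<Longrightarrow> cls xs = cls ys \<longleftrightarrow> tensor_eq K M N xs ys"
proof
  assume xs: "xs \<in> tlists" and "cls xs = cls ys"
  then have "ys \<in> tlists \<Longrightarrow> tensor_eq K M N xs ys"
    using tensor_eq_refl[of ys] by (auto simp: tensor_class_def)
  moreover have "tensor_eq K M N ys xs"
    using xs \<open>cls xs = cls ys\<close> tensor_eq_refl[of xs] by (auto simp: tensor_class_def)
  ultimately show "tensor_eq K M N xs ys" by (blast intro: tensor_eq.sym)
next
  assume "tensor_eq K M N xs ys"
  then show "cls xs = cls ys"
    unfolding tensor_class_def by (blast intro: tensor_eq.sym tensor_eq.trans)
qed

lemma cls_eqI: "tensor_eq K M N xs ys \<Longrightarrow> cls xs = cls ys"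
  using cls_eq_iff tensor_eq_lists by blast

lemma cls_self: "xs \<in> tlists \<Longrightarrow> xs \<in> cls xs"
  by (simp add: tensor_class_def tensor_eq_refl)

lemma cls_mem: "ys \<in> cls xs \<Longrightarrow> cls ys = cls xs \<and> ys \<in> tlists \<and> tensor_eq K M N xs ys"
  using tensor_eq_lists[of xs ys] cls_eqI[of ys xs] by (simp add: tensor_class_def tensor_eq.sym)

lemma carrier_tensor: "carrier T = cls ` tlists"
  by (simp add: tensor_def tlists_def)

lemma tensor_rep_lists: "U \<in> carrier T \<Longrightarrow> (SOME xs. xs \<in> U) \<in> tlists"
  and tensor_rep: "U \<in> carrier T \<Longrightarrow> U = cls (SOME xs. xs \<in> U)"
proof -
  assume "U \<in> carrier T"
  then obtain xs where xs: "xs \<in> tlists" "U = cls xs" by (auto simp: carrier_tensor)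
  then have "xs \<in> U" using cls_self by simp
  then have "(SOME xs. xs \<in> U) \<in> U" by (rule someI)
  then have "(SOME xs. xs \<in> U) \<in> cls xs" using xs(2) by simp
  from cls_mem[OF this] show "(SOME xs. xs \<in> U) \<in> tlists" "U = cls (SOME xs. xs \<in> U)"
    using xs(2) by simp_all
qed

lemma lift_cls:
  assumes "xs \<in> tlists" "bilinear K M N P \<beta>" "module K P"
  shows "tensor_lift P \<beta> (cls xs) = tsum P \<beta> xs"
proof -
  have "(SOME ys. ys \<in> cls xs) \<in> cls xs" using cls_self[OF assms(1)] by (rule someI)
  then show ?thesis
    unfolding tensor_lift_tsum
    using tensor_eq_tsum[OF _ assms(2,3), of xs "SOME ys. ys \<in> cls xs"] cls_mem by simp
qed

text \<open>Addition, scaling and multiplication in \<open>tensor\<close> are unions over all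
  representatives; such a union collapses once the classes are known to agree.\<close>

lemma Union_const: "x \<in> U \<Longrightarrow> (\<And>y. y \<in> U \<Longrightarrow> f y = C) \<Longrightarrow> (\<Union>y\<in>U. f y) = C"
  by auto

lemma tensor_add:
  assumes "xs \<in> tlists" "ys \<in> tlists"
  shows "cls xs \<oplus>\<^bsub>T\<^esub> cls ys = cls (xs @ ys)"
proof -
  have "cls (xs' @ ys') = cls (xs @ ys)" if "xs' \<in> cls xs" "ys' \<in> cls ys" for xs' ys'
    using cls_mem[OF that(1)] cls_mem[OF that(2)]
    by (intro cls_eqI tensor_eq.append) (auto intro: tensor_eq.sym)
  then have "(\<Union>xs'\<in>cls xs. \<Union>ys'\<in>cls ys. cls (xs' @ ys')) = cls (xs @ ys)"
    by (intro Union_const[OF cls_self[OF assms(1)]] Union_const[OF cls_self[OF assms(2)]])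
  then show ?thesis by (simp add: tensor_def)
qed

lemma tensor_eq_smult:
  assumes "tensor_eq K M N xs ys" "r \<in> carrier K"
  shows "tensor_eq K M N (map (\<lambda>(m, n). (r \<odot>\<^bsub>M\<^esub> m, n)) xs) (map (\<lambda>(m, n). (r \<odot>\<^bsub>M\<^esub> m, n)) ys)"
  using assms(1)
proof (induction rule: tensor_eq.induct)
  case (refl xs)
  then show ?case using assms(2) by (intro tensor_eq_refl) (auto simp: tlists_iff)
next
  case (sym xs ys)
  show ?case by (rule tensor_eq.sym) (rule sym.IH)
next
  case (trans xs ys zs)
  show ?case by (rule tensor_eq.trans[OF trans.IH])
next
  case (append xs xs' ys ys')
  then show ?case by (simp add: tensor_eq.append)
next
  case (commute xs ys)
  then show ?case using assms(2) by (simp, intro tensor_eq.commute) auto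
next
  case (add_left m m' n)
  then show ?case using assms(2) by (simp add: M.smult_r_distr tensor_eq.add_left)
next
  case (add_right m n n')
  then show ?case using assms(2) by (simp add: tensor_eq.add_right)
next
  case (scalar s m n)
  then have "r \<odot>\<^bsub>M\<^esub> (s \<odot>\<^bsub>M\<^esub> m) = s \<odot>\<^bsub>M\<^esub> (r \<odot>\<^bsub>M\<^esub> m)"
    using assms(2) by (metis M.smult_assoc1 M.R.m_comm)
  then show ?case using scalar assms(2) by (simp add: tensor_eq.scalar)
next
  case (zero n)
  then show ?case using assms(2) by (simp add: tensor_eq.zero)
qed

lemma tensor_smult:
  assumes "xs \<in> tlists" "r \<in> carrier K"
  shows "r \<odot>\<^bsub>T\<^esub> cls xs = cls (map (\<lambda>(m, n). (r \<odot>\<^bsub>M\<^esub> m, n)) xs)"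
proof -
  have "cls (map (\<lambda>(m, n). (r \<odot>\<^bsub>M\<^esub> m, n)) xs') = cls (map (\<lambda>(m, n). (r \<odot>\<^bsub>M\<^esub> m, n)) xs)"
    if "xs' \<in> cls xs" for xs'
    using cls_mem[OF that] tensor_eq_smult[OF _ assms(2)] by (intro cls_eqI tensor_eq.sym[OF tensor_eq_smult[OF _ assms(2)]]) simp
  then have "(\<Union>xs'\<in>cls xs. cls (map (\<lambda>(m, n). (r \<odot>\<^bsub>M\<^esub> m, n)) xs')) = cls (map (\<lambda>(m, n). (r \<odot>\<^bsub>M\<^esub> m, n)) xs)"
    by (intro Union_const[OF cls_self[OF assms(1)]])
  then show ?thesis by (simp add: tensor_def)
qed

lemma tensor_zero: "\<zero>\<^bsub>T\<^esub> = cls []"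
  by (simp add: tensor_def)

lemma map_smult_tlists:
  "xs \<in> tlists \<Longrightarrow> r \<in> carrier K \<Longrightarrow> map (\<lambda>(m, n). (r \<odot>\<^bsub>M\<^esub> m, n)) xs \<in> tlists"
  by (auto simp: tlists_iff)

lemma tensor_eq_swap_middle:
  assumes "xs \<in> tlists" "ys \<in> tlists" "zs \<in> tlists" "ws \<in> tlists"
  shows "tensor_eq K M N (xs @ ys @ zs @ ws) (xs @ zs @ ys @ ws)"
proof -
  have "tensor_eq K M N (xs @ (ys @ zs) @ ws) (xs @ (zs @ ys) @ ws)"
    using assms by (intro tensor_eq.append[OF tensor_eq_refl tensor_eq.append[OF tensor_eq.commute tensor_eq_refl]])
      (auto simp: tlists_iff)
  then show ?thesis by simp
qed

lemma tensor_eq_inverse: "xs \<in> tlists \<Longrightarrow> \<exists>ys\<in>tlists. tensor_eq K M N (ys @ xs) []"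
proof (induction xs)
  case Nil
  then show ?case by (intro bexI[of _ "[]"]) (auto intro: tensor_eq_refl)
next
  case (Cons p xs)
  obtain m n where p: "p = (m, n)" "m \<in> carrier M" "n \<in> carrier N" using Cons.prems by (cases p) auto
  have "xs \<in> tlists" using Cons.prems p by simp
  then obtain ys where ys: "ys \<in> tlists" "tensor_eq K M N (ys @ xs) []" using Cons.IH by blast
  \<comment> \<open>The new inverse pair stands in front of \<open>ys\<close>, so \<open>ys\<close>
    has to move past \<open>(m, n)\<close> before the two pairs can cancel.\<close>
  have 1: "tensor_eq K M N ([(\<ominus>\<^bsub>M\<^esub> m, n)] @ ys @ [(m, n)] @ xs) ([(\<ominus>\<^bsub>M\<^esub> m, n)] @ [(m, n)] @ ys @ xs)"
    using p ys Cons.prems by (intro tensor_eq_swap_middle) auto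
  have "tensor_eq K M N [(\<ominus>\<^bsub>M\<^esub> m \<oplus>\<^bsub>M\<^esub> m, n)] [(\<ominus>\<^bsub>M\<^esub> m, n), (m, n)]"
    using p by (intro tensor_eq.add_left) auto
  then have "tensor_eq K M N [(\<ominus>\<^bsub>M\<^esub> m, n), (m, n)] [(\<zero>\<^bsub>M\<^esub>, n)]"
    using p by (simp add: M.l_neg tensor_eq.sym)
  then have "tensor_eq K M N [(\<ominus>\<^bsub>M\<^esub> m, n), (m, n)] []"
    by (rule tensor_eq.trans) (rule tensor_eq.zero[OF p(3)])
  from tensor_eq.append[OF this ys(2)]
  have "tensor_eq K M N ([(\<ominus>\<^bsub>M\<^esub> m, n)] @ [(m, n)] @ ys @ xs) []" by simp
  with 1 have "tensor_eq K M N (((\<ominus>\<^bsub>M\<^esub> m, n) # ys) @ p # xs) []"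
    unfolding p by simp (rule tensor_eq.trans)
  then show ?case using p ys by (intro bexI[of _ "(\<ominus>\<^bsub>M\<^esub> m, n) # ys"]) auto
qed

lemma module_tensor: "module K T"
proof (rule moduleI)
  show "cring K" by (rule M.R.is_cring)
  show "abelian_group T"
  proof (rule abelian_groupI)
    fix U assume "U \<in> carrier T"
    then obtain xs where xs: "xs \<in> tlists" "U = cls xs" unfolding carrier_tensor by blast
    then obtain ys where "ys \<in> tlists" "tensor_eq K M N (ys @ xs) []" using tensor_eq_inverse by blast
    then show "\<exists>W\<in>carrier T. W \<oplus>\<^bsub>T\<^esub> U = \<zero>\<^bsub>T\<^esub>"
      using xs by (intro bexI[of _ "cls ys"]) (auto simp: tensor_add tensor_zero carrier_tensor cls_eqI)
  next
    fix U W assume UW: "U \<in> carrier T" "W \<in> carrier T"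
    show "U \<oplus>\<^bsub>T\<^esub> W = W \<oplus>\<^bsub>T\<^esub> U"
    proof -
      obtain xs ys where "xs \<in> tlists" "U = cls xs" "ys \<in> tlists" "W = cls ys"
        using UW unfolding carrier_tensor by blast
      then show ?thesis
        by (simp add: tensor_add) (rule cls_eqI, rule tensor_eq.commute, auto simp: tlists_iff)
    qed
  qed (auto simp: carrier_tensor tensor_add tensor_zero)
  {
    fix U assume "U \<in> carrier T"
    then obtain xs where xs: "xs \<in> tlists" "U = cls xs" unfolding carrier_tensor by blast
    have "map (\<lambda>(m, n). (\<one>\<^bsub>K\<^esub> \<odot>\<^bsub>M\<^esub> m, n)) xs = xs"
      using xs(1) by (induction xs) auto
    then show "\<one>\<^bsub>K\<^esub> \<odot>\<^bsub>T\<^esub> U = U" using xs by (simp add: tensor_smult)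
  }
  fix r s U W
  assume *: "r \<in> carrier K" "U \<in> carrier T"
  then obtain xs where xs: "xs \<in> tlists" "U = cls xs" by (auto simp: carrier_tensor)
  show "r \<odot>\<^bsub>T\<^esub> U \<in> carrier T"
    using xs * map_smult_tlists[OF xs(1) *(1)] by (auto simp: tensor_smult carrier_tensor)
  {
    assume "W \<in> carrier T"
    then obtain ys where ys: "ys \<in> tlists" "W = cls ys" by (auto simp: carrier_tensor)
    then show "r \<odot>\<^bsub>T\<^esub> (U \<oplus>\<^bsub>T\<^esub> W) = r \<odot>\<^bsub>T\<^esub> U \<oplus>\<^bsub>T\<^esub> r \<odot>\<^bsub>T\<^esub> W"
      using xs * map_smult_tlists[OF xs(1) *(1)] map_smult_tlists[OF ys(1) *(1)]
      by (simp add: tensor_add tensor_smult)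
  }
  assume s: "s \<in> carrier K"
  show "(r \<otimes>\<^bsub>K\<^esub> s) \<odot>\<^bsub>T\<^esub> U = r \<odot>\<^bsub>T\<^esub> (s \<odot>\<^bsub>T\<^esub> U)"
  proof -
    have "map (\<lambda>(m, n). ((r \<otimes>\<^bsub>K\<^esub> s) \<odot>\<^bsub>M\<^esub> m, n)) xs =
      map (\<lambda>(m, n). (r \<odot>\<^bsub>M\<^esub> m, n)) (map (\<lambda>(m, n). (s \<odot>\<^bsub>M\<^esub> m, n)) xs)"
      using xs(1) * s by (induction xs) (auto simp: M.smult_assoc1)
    then show ?thesis
      using xs * s map_smult_tlists[OF xs(1) s] by (simp add: tensor_smult del: map_map map_eq_conv)
  qed
  \<comment> \<open>The other laws for scalars are equalities of lists. This one holds only up to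
    the congruence: every pair is split in two, and the halves must be sorted into two
    blocks.\<close>
  have "tensor_eq K M N (map (\<lambda>(m, n). ((r \<oplus>\<^bsub>K\<^esub> s) \<odot>\<^bsub>M\<^esub> m, n)) xs)
      (map (\<lambda>(m, n). (r \<odot>\<^bsub>M\<^esub> m, n)) xs @ map (\<lambda>(m, n). (s \<odot>\<^bsub>M\<^esub> m, n)) xs)"
    using xs(1)
  proof (induction xs)
    case Nil
    then show ?case by (auto intro: tensor_eq_refl)
  next
    case (Cons p xs)
    obtain m n where p: "p = (m, n)" "m \<in> carrier M" "n \<in> carrier N" using Cons by (cases p) auto
    let ?R = "map (\<lambda>(m, n). (r \<odot>\<^bsub>M\<^esub> m, n)) xs" and ?S = "map (\<lambda>(m, n). (s \<odot>\<^bsub>M\<^esub> m, n)) xs"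
    have xs: "xs \<in> tlists" using Cons.prems p by simp
    have RS: "?R \<in> tlists" "?S \<in> tlists" using xs * s by (intro map_smult_tlists; simp)+
    have "tensor_eq K M N [((r \<oplus>\<^bsub>K\<^esub> s) \<odot>\<^bsub>M\<^esub> m, n)] [(r \<odot>\<^bsub>M\<^esub> m, n), (s \<odot>\<^bsub>M\<^esub> m, n)]"
      using p * s by (simp add: M.smult_l_distr tensor_eq.add_left)
    from tensor_eq.append[OF this Cons.IH[OF xs]]
    have "tensor_eq K M N (map (\<lambda>(m, n). ((r \<oplus>\<^bsub>K\<^esub> s) \<odot>\<^bsub>M\<^esub> m, n)) (p # xs))
        ([(r \<odot>\<^bsub>M\<^esub> m, n)] @ [(s \<odot>\<^bsub>M\<^esub> m, n)] @ ?R @ ?S)"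
      using Cons.prems p by simp
    moreover have "tensor_eq K M N ([(r \<odot>\<^bsub>M\<^esub> m, n)] @ [(s \<odot>\<^bsub>M\<^esub> m, n)] @ ?R @ ?S)
        ([(r \<odot>\<^bsub>M\<^esub> m, n)] @ ?R @ [(s \<odot>\<^bsub>M\<^esub> m, n)] @ ?S)"
      using p * s RS by (intro tensor_eq_swap_middle) auto
    ultimately show ?case unfolding p by simp (rule tensor_eq.trans)
  qed
  then show "(r \<oplus>\<^bsub>K\<^esub> s) \<odot>\<^bsub>T\<^esub> U = r \<odot>\<^bsub>T\<^esub> U \<oplus>\<^bsub>T\<^esub> s \<odot>\<^bsub>T\<^esub> U"
    using xs * s map_smult_tlists[OF xs(1) *(1)] map_smult_tlists[OF xs(1) s]
    by (simp add: tensor_smult tensor_add cls_eqI)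
qed

sublocale T: module K T
  by (rule module_tensor)

lemma pure_closed: "m \<in> carrier M \<Longrightarrow> n \<in> carrier N \<Longrightarrow> pure m n \<in> carrier T"
  by (auto simp: carrier_tensor pure_tensor_def)

lemma bilinear_pure: "bilinear K M N T pure"
proof (intro bilinearI linear_mapsI)
  fix m n r assume *: "m \<in> carrier M" "n \<in> carrier N" "r \<in> carrier K"
  have L: "pure (r \<odot>\<^bsub>M\<^esub> m) n = r \<odot>\<^bsub>T\<^esub> pure m n"
    using * by (simp add: pure_tensor_def tensor_smult)
  then show "pure (r \<odot>\<^bsub>M\<^esub> m) n = r \<odot>\<^bsub>T\<^esub> pure m n" .
  have "pure (r \<odot>\<^bsub>M\<^esub> m) n = pure m (r \<odot>\<^bsub>N\<^esub> n)"
    using * by (auto simp: pure_tensor_def intro!: cls_eqI tensor_eq.scalar)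
  then show "pure m (r \<odot>\<^bsub>N\<^esub> n) = r \<odot>\<^bsub>T\<^esub> pure m n" using L by simp
qed (auto simp: pure_tensor_def tensor_add carrier_tensor intro!: cls_eqI tensor_eq.add_left tensor_eq.add_right)

lemma cls_tsum: "xs \<in> tlists \<Longrightarrow> cls xs = tsum T pure xs"
proof (induction xs)
  case Nil
  then show ?case by (simp add: tensor_zero)
next
  case (Cons p xs)
  obtain m n where p: "p = (m, n)" by force
  then have "cls (p # xs) = pure m n \<oplus>\<^bsub>T\<^esub> cls xs"
    using Cons.prems by (simp add: pure_tensor_def tensor_add)
  then show ?case using Cons p by simp
qed

lemma lift_closed:
  assumes "bilinear K M N P \<beta>" "module K P" "U \<in> carrier T"
  shows "tensor_lift P \<beta> U \<in> carrier P"
proof -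
  interpret P: module K P by fact
  have "(SOME xs. xs \<in> U) \<in> tlists" by (rule tensor_rep_lists[OF assms(3)])
  then show ?thesis unfolding tensor_lift_tsum
    by (auto intro!: P.tsum_closed bilinear_closed[OF assms(1)])
qed

lemma lift_linear:
  assumes "bilinear K M N P \<beta>" "module K P"
  shows "tensor_lift P \<beta> \<in> linear_maps K T P"
proof (rule linear_mapsI)
  interpret P: module K P by fact
  note cl = bilinear_closed[OF assms(1)]
  show "\<And>U. U \<in> carrier T \<Longrightarrow> tensor_lift P \<beta> U \<in> carrier P"
    using lift_closed[OF assms] .
  fix U assume "U \<in> carrier T"
  then obtain xs where xs: "xs \<in> tlists" "U = cls xs" by (auto simp: carrier_tensor)
  show "tensor_lift P \<beta> (U \<oplus>\<^bsub>T\<^esub> W) = tensor_lift P \<beta> U \<oplus>\<^bsub>P\<^esub> tensor_lift P \<beta> W" if W: "W \<in> carrier T" for W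
  proof -
    obtain ys where ys: "ys \<in> tlists" "W = cls ys" using W unfolding carrier_tensor by blast
    show ?thesis
      using xs ys by (auto simp: tensor_add lift_cls[OF _ assms] intro!: P.tsum_append cl)
  qed
  show "tensor_lift P \<beta> (r \<odot>\<^bsub>T\<^esub> U) = r \<odot>\<^bsub>P\<^esub> tensor_lift P \<beta> U" if r: "r \<in> carrier K" for r
  proof -
    have "tsum P \<beta> (map (\<lambda>(m, n). (r \<odot>\<^bsub>M\<^esub> m, n)) xs) = r \<odot>\<^bsub>P\<^esub> tsum P \<beta> xs"
      unfolding tsum_map using xs r
      by (subst lin_tsum[OF lin_smult_const[OF assms(2) lin_id r] assms(2,2)])
        (auto intro!: tsum_cong cl lin_smult[OF bilinear_left[OF assms(1)]])
    then show ?thesis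
      using xs r map_smult_tlists[OF xs(1) r] by (simp add: tensor_smult lift_cls[OF _ assms])
  qed
qed

lemma lift_pure:
  assumes "bilinear K M N P \<beta>" "module K P" "m \<in> carrier M" "n \<in> carrier N"
  shows "tensor_lift P \<beta> (pure m n) = \<beta> m n"
proof -
  interpret P: module K P by fact
  show ?thesis
    using assms bilinear_closed[OF assms(1)] by (simp add: pure_tensor_def lift_cls)
qed

text \<open>\<open>tensor_lift\<close> sums over one chosen representative, and both sides choose
  the same one. Hence this rule, \<open>lift_comp\<close> and \<open>lin_lift_fun\<close> hold
  termwise for functions \<beta> of any kind, and the Sweedler sums inherit this freedom.\<close>

lemma lift_cong:
  assumes "\<And>m n. m \<in> carrier M \<Longrightarrow> n \<in> carrier N \<Longrightarrow> \<beta> m n = \<beta>' m n" "U \<in> carrier T"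
  shows "tensor_lift P \<beta> U = tensor_lift P \<beta>' U"
  unfolding tensor_lift_tsum using tensor_rep_lists[OF assms(2)] assms(1)
  by (auto intro!: tsum_cong)

lemma lift_comp:
  assumes "f \<in> linear_maps K P Q" "module K P" "module K Q"
    "\<And>m n. m \<in> carrier M \<Longrightarrow> n \<in> carrier N \<Longrightarrow> \<beta> m n \<in> carrier P" "U \<in> carrier T"
  shows "f (tensor_lift P \<beta> U) = tensor_lift Q (\<lambda>m n. f (\<beta> m n)) U"
  unfolding tensor_lift_tsum using tensor_rep_lists[OF assms(5)] assms(4)
  by (auto intro!: lin_tsum[OF assms(1-3)])

lemma lift_pure_id: "U \<in> carrier T \<Longrightarrow> tensor_lift T pure U = U"
  unfolding tensor_lift_tsum using tensor_rep[symmetric] cls_tsum[OF tensor_rep_lists] by simp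

text \<open>The uniqueness half of the universal property: a tensor is the lift of
  \<open>pure\<close> over itself, and linear maps pass through the lift.\<close>

lemma tensor_linear_ext:
  assumes "f \<in> linear_maps K T P" "g \<in> linear_maps K T P" "module K P" "U \<in> carrier T"
    and "\<And>m n. m \<in> carrier M \<Longrightarrow> n \<in> carrier N \<Longrightarrow> f (pure m n) = g (pure m n)"
  shows "f U = g U"
proof -
  have "f (tensor_lift T pure U) = tensor_lift P (\<lambda>m n. f (pure m n)) U"
    using assms(4) pure_closed by (intro lift_comp[OF assms(1) module_tensor assms(3)])
  also have "\<dots> = tensor_lift P (\<lambda>m n. g (pure m n)) U"
    using assms(4,5) by (intro lift_cong)
  also have "\<dots> = g (tensor_lift T pure U)"
    using assms(4) pure_closed by (intro lift_comp[OF assms(2) module_tensor assms(3), symmetric])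
  finally show ?thesis using assms(4) by (simp add: lift_pure_id)
qed

lemma lin_lift_fun:
  assumes "module K P" "U \<in> carrier T"
    and "\<And>m n. m \<in> carrier M \<Longrightarrow> n \<in> carrier N \<Longrightarrow> (\<lambda>z. \<gamma> z m n) \<in> linear_maps K Q P"
  shows "(\<lambda>z. tensor_lift P (\<gamma> z) U) \<in> linear_maps K Q P"
  unfolding tensor_lift_tsum using tensor_rep_lists[OF assms(2)] assms(3)
  by (auto intro!: lin_tsum_fun[OF assms(1)])

end

lemma two_modulesI: "module K M \<Longrightarrow> module K N \<Longrightarrow> two_modules K M N"
  by (simp add: two_modules_def)

section \<open>Tensor products of algebras\<close>

locale two_algebras = M: algebra K M + N: algebra K N
  for K :: "'k ring" and M :: "('k, 'm, 'y) module_scheme"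
    and N :: "('k, 'n, 'z) module_scheme"

sublocale two_algebras \<subseteq> two_modules K M N
  by unfold_locales

context two_algebras
begin

text \<open>The product of \<open>tensor\<close> as two nested lifts. In this form it is visibly
  bilinear, so the ring laws can be checked on pure tensors.\<close>

definition tmul :: "('m \<times> 'n) list set \<Rightarrow> ('m \<times> 'n) list set \<Rightarrow> ('m \<times> 'n) list set"
  where "tmul U U' =
    tensor_lift T (\<lambda>m n. tensor_lift T (\<lambda>m' n'. pure (m \<otimes>\<^bsub>M\<^esub> m') (n \<otimes>\<^bsub>N\<^esub> n')) U') U"

lemma bilinear_pure_mult:
  assumes "m \<in> carrier M" "n \<in> carrier N"
  shows "bilinear K M N T (\<lambda>m' n'. pure (m \<otimes>\<^bsub>M\<^esub> m') (n \<otimes>\<^bsub>N\<^esub> n'))"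
proof (rule bilinearI)
  fix m' assume "m' \<in> carrier M"
  then show "(\<lambda>n'. pure (m \<otimes>\<^bsub>M\<^esub> m') (n \<otimes>\<^bsub>N\<^esub> n')) \<in> linear_maps K N T"
    using assms by (intro lin_comp[OF lin_mult_left[OF N.algebra_axioms lin_id]]
        bilinear_right[OF bilinear_pure]) auto
next
  fix n' assume "n' \<in> carrier N"
  then show "(\<lambda>m'. pure (m \<otimes>\<^bsub>M\<^esub> m') (n \<otimes>\<^bsub>N\<^esub> n')) \<in> linear_maps K M T"
    using assms by (intro lin_comp[OF lin_mult_left[OF M.algebra_axioms lin_id]]
        bilinear_left[OF bilinear_pure]) auto
qed

lemma bilinear_lift_pure_mult:
  assumes "U \<in> carrier T"
  shows "bilinear K M N T (\<lambda>m n. tensor_lift T (\<lambda>m' n'. pure (m \<otimes>\<^bsub>M\<^esub> m') (n \<otimes>\<^bsub>N\<^esub> n')) U)"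
proof (rule bilinearI)
  fix m assume "m \<in> carrier M"
  then show "(\<lambda>n. tensor_lift T (\<lambda>m' n'. pure (m \<otimes>\<^bsub>M\<^esub> m') (n \<otimes>\<^bsub>N\<^esub> n')) U) \<in> linear_maps K N T"
    using assms by (intro lin_lift_fun module_tensor lin_comp[OF lin_mult_right[OF N.algebra_axioms lin_id]]
        bilinear_right[OF bilinear_pure]) auto
next
  fix n assume "n \<in> carrier N"
  then show "(\<lambda>m. tensor_lift T (\<lambda>m' n'. pure (m \<otimes>\<^bsub>M\<^esub> m') (n \<otimes>\<^bsub>N\<^esub> n')) U) \<in> linear_maps K M T"
    using assms by (intro lin_lift_fun module_tensor lin_comp[OF lin_mult_right[OF M.algebra_axioms lin_id]]
        bilinear_left[OF bilinear_pure]) auto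
qed

lemma tmul_linear_left: "U' \<in> carrier T \<Longrightarrow> (\<lambda>U. tmul U U') \<in> linear_maps K T T"
  unfolding tmul_def by (rule lift_linear[OF bilinear_lift_pure_mult module_tensor])

lemma tmul_linear_right: "U \<in> carrier T \<Longrightarrow> (\<lambda>U'. tmul U U') \<in> linear_maps K T T"
  unfolding tmul_def
  by (rule lin_lift_fun[OF module_tensor]) (auto intro: lift_linear[OF bilinear_pure_mult module_tensor])

lemma tmul_pure:
  assumes "m \<in> carrier M" "n \<in> carrier N" "m' \<in> carrier M" "n' \<in> carrier N"
  shows "tmul (pure m n) (pure m' n') = pure (m \<otimes>\<^bsub>M\<^esub> m') (n \<otimes>\<^bsub>N\<^esub> n')"
  unfolding tmul_def using assms
  by (simp add: lift_pure[OF bilinear_lift_pure_mult module_tensor]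
      lift_pure[OF bilinear_pure_mult module_tensor] pure_closed)

lemma cls_product:
  assumes "xs \<in> tlists" "ys \<in> tlists"
  shows "cls [(m \<otimes>\<^bsub>M\<^esub> m', n \<otimes>\<^bsub>N\<^esub> n'). (m, n) \<leftarrow> xs, (m', n') \<leftarrow> ys] = tmul (cls xs) (cls ys)"
proof -
  have pr: "[(m \<otimes>\<^bsub>M\<^esub> m', n \<otimes>\<^bsub>N\<^esub> n'). (m, n) \<leftarrow> xs, (m', n') \<leftarrow> ys] \<in> tlists" if "xs \<in> tlists" for xs
    using that assms(2) by (auto simp: tlists_iff)
  have ysC: "cls ys \<in> carrier T" using assms by (auto simp: carrier_tensor)
  have "cls [(m \<otimes>\<^bsub>M\<^esub> m', n \<otimes>\<^bsub>N\<^esub> n'). (m, n) \<leftarrow> xs, (m', n') \<leftarrow> ys] =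
      tsum T (\<lambda>m n. tsum T (\<lambda>m' n'. pure (m \<otimes>\<^bsub>M\<^esub> m') (n \<otimes>\<^bsub>N\<^esub> n')) ys) xs"
    using assms(1)
  proof (induction xs)
    case Nil
    then show ?case by (simp add: tensor_zero)
  next
    case (Cons p xs)
    obtain m n where p: "p = (m, n)" "m \<in> carrier M" "n \<in> carrier N" "xs \<in> tlists"
      using Cons.prems by (cases p) auto
    have L: "map (\<lambda>(m', n'). (m \<otimes>\<^bsub>M\<^esub> m', n \<otimes>\<^bsub>N\<^esub> n')) ys \<in> tlists"
      using assms(2) p by (auto simp: tlists_iff)
    have "cls (map (\<lambda>(m', n'). (m \<otimes>\<^bsub>M\<^esub> m', n \<otimes>\<^bsub>N\<^esub> n')) ys) =
        tsum T (\<lambda>m' n'. pure (m \<otimes>\<^bsub>M\<^esub> m') (n \<otimes>\<^bsub>N\<^esub> n')) ys"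
      using cls_tsum[OF L] by (simp add: tsum_map)
    then show ?case
      using Cons.IH[OF p(4)] tensor_add[OF L pr[OF p(4)]] by (simp add: p)
  qed
  also have "\<dots> = tsum T (\<lambda>m n. tensor_lift T (\<lambda>m' n'. pure (m \<otimes>\<^bsub>M\<^esub> m') (n \<otimes>\<^bsub>N\<^esub> n')) (cls ys)) xs"
    using assms by (intro tsum_cong) (auto simp: lift_cls[OF _ bilinear_pure_mult module_tensor] dest: tlistsD)
  also have "\<dots> = tmul (cls xs) (cls ys)"
    unfolding tmul_def using assms(1) by (simp add: lift_cls[OF _ bilinear_lift_pure_mult[OF ysC] module_tensor])
  finally show ?thesis .
qed

lemma tensor_mult:
  assumes "U \<in> carrier T" "U' \<in> carrier T"
  shows "U \<otimes>\<^bsub>T\<^esub> U' = tmul U U'"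
proof -
  obtain xs ys where *: "xs \<in> tlists" "U = cls xs" "ys \<in> tlists" "U' = cls ys"
    using assms unfolding carrier_tensor by blast
  have "cls [(m \<otimes>\<^bsub>M\<^esub> m', n \<otimes>\<^bsub>N\<^esub> n'). (m, n) \<leftarrow> xs', (m', n') \<leftarrow> ys'] = tmul U U'"
    if "xs' \<in> U" "ys' \<in> U'" for xs' ys'
    using that * cls_product[of xs' ys'] cls_mem[of xs' xs] cls_mem[of ys' ys] by simp
  then have "(\<Union>xs'\<in>U. \<Union>ys'\<in>U'. cls [(m \<otimes>\<^bsub>M\<^esub> m', n \<otimes>\<^bsub>N\<^esub> n'). (m, n) \<leftarrow> xs', (m', n') \<leftarrow> ys']) = tmul U U'"
    using * by (intro Union_const[of xs] Union_const[of ys]) (auto simp: cls_self)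
  then show ?thesis by (simp add: tensor_def)
qed

lemma one_tensor: "\<one>\<^bsub>T\<^esub> = pure \<one>\<^bsub>M\<^esub> \<one>\<^bsub>N\<^esub>"
  by (simp add: tensor_def)

lemma tmul_comm:
  assumes "U \<in> carrier T" "W \<in> carrier T"
  shows "tmul U W = tmul W U"
proof -
  have 1: "tmul (pure m n) W = tmul W (pure m n)" if "m \<in> carrier M" "n \<in> carrier N" for m n
    by (rule tensor_linear_ext[OF tmul_linear_right tmul_linear_left module_tensor assms(2)])
      (use that in \<open>auto simp: tmul_pure pure_closed M.m_comm N.m_comm\<close>)
  show ?thesis
    by (rule tensor_linear_ext[OF tmul_linear_left tmul_linear_right module_tensor assms(1)])
      (use assms 1 in auto)
qed

lemma tmul_closed: "U \<in> carrier T \<Longrightarrow> W \<in> carrier T \<Longrightarrow> tmul U W \<in> carrier T"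
  using lin_closed[OF tmul_linear_left] by blast

text \<open>The arguments are reduced to pure tensors one at a time by linearity, the last one
  first.\<close>

lemma tmul_assoc:
  assumes "U \<in> carrier T" "W \<in> carrier T" "X \<in> carrier T"
  shows "tmul (tmul U W) X = tmul U (tmul W X)"
proof -
  have 1: "tmul (tmul (pure m n) (pure m' n')) X = tmul (pure m n) (tmul (pure m' n') X)"
    if "m \<in> carrier M" "n \<in> carrier N" "m' \<in> carrier M" "n' \<in> carrier N" for m n m' n'
    by (rule tensor_linear_ext[OF tmul_linear_right
          lin_comp[OF tmul_linear_right tmul_linear_right] module_tensor assms(3)])
      (use that in \<open>auto simp: tmul_pure pure_closed M.m_assoc N.m_assoc\<close>)
  have 2: "tmul (tmul (pure m n) W) X = tmul (pure m n) (tmul W X)"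
    if "m \<in> carrier M" "n \<in> carrier N" for m n
    by (rule tensor_linear_ext[OF lin_comp[OF tmul_linear_right tmul_linear_left]
          lin_comp[OF tmul_linear_left tmul_linear_right] module_tensor assms(2)])
      (use that assms 1 in \<open>auto simp: pure_closed\<close>)
  show ?thesis
    by (rule tensor_linear_ext[OF lin_comp[OF tmul_linear_left tmul_linear_left]
          tmul_linear_left module_tensor assms(1)])
      (use assms 2 in \<open>auto simp: tmul_closed\<close>)
qed

lemma algebra_tensor: "algebra K T"
proof (rule algebraI)
  show "cring T"
  proof (rule cringI)
    show "abelian_group T" by (rule T.abelian_group_axioms)
    show "comm_monoid T"
    proof (rule comm_monoidI)
      show one: "\<one>\<^bsub>T\<^esub> \<in> carrier T" by (simp add: one_tensor pure_closed)
      fix U assume U: "U \<in> carrier T"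
      have "tmul (pure \<one>\<^bsub>M\<^esub> \<one>\<^bsub>N\<^esub>) U = U"
        by (rule tensor_linear_ext[OF tmul_linear_right lin_id module_tensor U])
          (auto simp: tmul_pure pure_closed)
      then show "\<one>\<^bsub>T\<^esub> \<otimes>\<^bsub>T\<^esub> U = U" using one U by (simp add: tensor_mult one_tensor)
      fix W assume W: "W \<in> carrier T"
      show "U \<otimes>\<^bsub>T\<^esub> W = W \<otimes>\<^bsub>T\<^esub> U" using U W by (simp only: tensor_mult tmul_comm[OF U W])
    qed (simp_all add: tensor_mult tmul_closed tmul_assoc)
  qed (auto simp: tensor_mult lin_add[OF tmul_linear_left])
qed (auto simp: tensor_mult lin_smult[OF tmul_linear_left] T.smult_l_distr T.smult_r_distr
    T.smult_assoc1 M.R.is_cring)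

sublocale T: algebra K T
  by (rule algebra_tensor)

lemma pure_mult:
  assumes "m \<in> carrier M" "n \<in> carrier N" "m' \<in> carrier M" "n' \<in> carrier N"
  shows "pure m n \<otimes>\<^bsub>T\<^esub> pure m' n' = pure (m \<otimes>\<^bsub>M\<^esub> m') (n \<otimes>\<^bsub>N\<^esub> n')"
  using assms by (simp add: tensor_mult tmul_pure pure_closed)

text \<open>This map and the next are the coprojections of the coproduct of commutative algebras.
  Later they produce the generic point of \<open>G\<close> over \<open>R \<otimes> A\<close> and the
  base change of a point of \<open>G(R)\<close>.\<close>

lemma pure_one_left: "(\<lambda>n. pure \<one>\<^bsub>M\<^esub> n) \<in> algebra_homs K N T"
  unfolding algebra_homs_def
  using bilinear_right[OF bilinear_pure M.one_closed] lin_add[OF bilinear_right[OF bilinear_pure M.one_closed]]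
  by (auto intro!: ring_hom_memI simp: pure_mult one_tensor pure_closed)

lemma pure_one_right: "(\<lambda>m. pure m \<one>\<^bsub>N\<^esub>) \<in> algebra_homs K M T"
  unfolding algebra_homs_def
  using bilinear_left[OF bilinear_pure N.one_closed] lin_add[OF bilinear_left[OF bilinear_pure N.one_closed]]
  by (auto intro!: ring_hom_memI simp: pure_mult one_tensor pure_closed)

end

section \<open>Dual systems\<close>

text \<open>No linear independence is required, so filtering the list restricts a dual system adapted to
  \<open>W\<close> to \<open>W\<close>, or turns it into one of the quotient by \<open>W\<close>.\<close>

definition dual_system ::
    "'k ring \<Rightarrow> ('k, 'm, 'y) module_scheme \<Rightarrow> 'm set \<Rightarrow> ('m \<times> ('m \<Rightarrow> 'k)) list \<Rightarrow> bool"
  where "dual_system K M W D \<longleftrightarrow>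
    (\<forall>(b, \<phi>)\<in>set D. b \<in> carrier M \<and> \<phi> \<in> linear_maps K M (scalars K) \<and> (b \<in> W \<or> (\<forall>w\<in>W. \<phi> w = \<zero>\<^bsub>K\<^esub>))) \<and>
    (\<forall>a\<in>carrier M. tsum M (\<lambda>b \<phi>. \<phi> a \<odot>\<^bsub>M\<^esub> b) D = a)"

lemma dual_systemD:
  assumes "dual_system K M W D" "(b, \<phi>) \<in> set D"
  shows "b \<in> carrier M" "\<phi> \<in> linear_maps K M (scalars K)"
    and "b \<notin> W \<Longrightarrow> w \<in> W \<Longrightarrow> \<phi> w = \<zero>\<^bsub>K\<^esub>" "a \<in> carrier M \<Longrightarrow> \<phi> a \<in> carrier K"
  using assms lin_closed[of \<phi> K M "scalars K" a] by (auto simp: dual_system_def)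

lemma dual_system_sum: "dual_system K M W D \<Longrightarrow> a \<in> carrier M \<Longrightarrow> tsum M (\<lambda>b \<phi>. \<phi> a \<odot>\<^bsub>M\<^esub> b) D = a"
  by (auto simp: dual_system_def)

section \<open>Submodules and spans of finite lists\<close>

context module
begin

lemma submoduleD:
  assumes "submodule W R M"
  shows "W \<subseteq> carrier M" "\<zero>\<^bsub>M\<^esub> \<in> W" "x \<in> W \<Longrightarrow> y \<in> W \<Longrightarrow> x \<oplus>\<^bsub>M\<^esub> y \<in> W"
    "a \<in> carrier R \<Longrightarrow> x \<in> W \<Longrightarrow> a \<odot>\<^bsub>M\<^esub> x \<in> W" "x \<in> W \<Longrightarrow> y \<in> W \<Longrightarrow> x \<ominus>\<^bsub>M\<^esub> y \<in> W"
  using submoduleE[OF assms] subgroup.one_closed[OF submodule.axioms(1)[OF assms]]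
  by (auto simp: M.minus_eq)

lemma submoduleI':
  assumes "W \<subseteq> carrier M" "\<zero>\<^bsub>M\<^esub> \<in> W" "\<And>x y. x \<in> W \<Longrightarrow> y \<in> W \<Longrightarrow> x \<oplus>\<^bsub>M\<^esub> y \<in> W"
    and smult: "\<And>a x. a \<in> carrier R \<Longrightarrow> x \<in> W \<Longrightarrow> a \<odot>\<^bsub>M\<^esub> x \<in> W"
  shows "submodule W R M"
proof (rule submoduleI)
  fix x assume "x \<in> W"
  then have "\<ominus>\<^bsub>M\<^esub> x = (\<ominus> \<one>) \<odot>\<^bsub>M\<^esub> x" using assms(1) by (subst smult_l_minus) auto
  then show "\<ominus>\<^bsub>M\<^esub> x \<in> W" using smult[of "\<ominus> \<one>" x] \<open>x \<in> W\<close> by simp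
qed (use assms in auto)

text \<open>The recursion makes the spans of the tails of a list into a flag, each member enlarging
  the next by at most one dimension. The adapted dual system is built along this flag.\<close>

fun list_span :: "'c list \<Rightarrow> 'c set" where
  "list_span [] = {\<zero>\<^bsub>M\<^esub>}"
| "list_span (b # bs) = {a \<odot>\<^bsub>M\<^esub> b \<oplus>\<^bsub>M\<^esub> x | a x. a \<in> carrier R \<and> x \<in> list_span bs}"

lemma submodule_list_span:
  assumes "set bs \<subseteq> carrier M"
  shows "submodule (list_span bs) R M"
  using assms
proof (induction bs)
  case Nil
  show ?case by (rule submoduleI') auto
next
  case (Cons b bs)
  then have b: "b \<in> carrier M" and IH: "submodule (list_span bs) R M" by auto
  note S = submoduleD[OF IH]
  show ?case
  proof (rule submoduleI')
    show "list_span (b # bs) \<subseteq> carrier M" using S(1) b by auto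
    have "\<zero>\<^bsub>M\<^esub> = \<zero> \<odot>\<^bsub>M\<^esub> b \<oplus>\<^bsub>M\<^esub> \<zero>\<^bsub>M\<^esub>" using b by simp
    then show "\<zero>\<^bsub>M\<^esub> \<in> list_span (b # bs)" using S(2) R.zero_closed by (simp only: list_span.simps) blast
  next
    fix x y assume "x \<in> list_span (b # bs)" "y \<in> list_span (b # bs)"
    then obtain a u c v where *: "a \<in> carrier R" "u \<in> list_span bs" "x = a \<odot>\<^bsub>M\<^esub> b \<oplus>\<^bsub>M\<^esub> u"
      "c \<in> carrier R" "v \<in> list_span bs" "y = c \<odot>\<^bsub>M\<^esub> b \<oplus>\<^bsub>M\<^esub> v" by auto
    have "x \<oplus>\<^bsub>M\<^esub> y = (a \<oplus> c) \<odot>\<^bsub>M\<^esub> b \<oplus>\<^bsub>M\<^esub> (u \<oplus>\<^bsub>M\<^esub> v)"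
      using * b S(1) by (auto simp: smult_l_distr M.a_ac subset_iff)
    then show "x \<oplus>\<^bsub>M\<^esub> y \<in> list_span (b # bs)" using * S(3) R.a_closed by (simp only: list_span.simps) blast
  next
    fix c x assume c: "c \<in> carrier R" and "x \<in> list_span (b # bs)"
    then obtain a u where *: "a \<in> carrier R" "u \<in> list_span bs" "x = a \<odot>\<^bsub>M\<^esub> b \<oplus>\<^bsub>M\<^esub> u" by auto
    then have "c \<odot>\<^bsub>M\<^esub> x = (c \<otimes> a) \<odot>\<^bsub>M\<^esub> b \<oplus>\<^bsub>M\<^esub> c \<odot>\<^bsub>M\<^esub> u"
      using b S(1) c by (auto simp: smult_r_distr smult_assoc1 subset_iff)
    then show "c \<odot>\<^bsub>M\<^esub> x \<in> list_span (b # bs)" using * c S(4) R.m_closed by (simp only: list_span.simps) blast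
  qed
qed

lemma list_span_mem: "set bs \<subseteq> carrier M \<Longrightarrow> b \<in> set bs \<Longrightarrow> b \<in> list_span bs"
proof (induction bs)
  case (Cons c bs)
  note S = submoduleD[OF submodule_list_span[of bs]]
  show ?case
  proof (cases "b = c")
    case True
    then have "b = \<one> \<odot>\<^bsub>M\<^esub> c \<oplus>\<^bsub>M\<^esub> \<zero>\<^bsub>M\<^esub>" using Cons.prems by simp
    moreover have "\<zero>\<^bsub>M\<^esub> \<in> list_span bs" using S(2) Cons.prems by simp
    ultimately show ?thesis using R.one_closed by (simp only: list_span.simps) blast
  next
    case False
    then have "b = \<zero> \<odot>\<^bsub>M\<^esub> c \<oplus>\<^bsub>M\<^esub> b" "b \<in> list_span bs" using Cons by auto
    then show ?thesis using R.zero_closed by (simp only: list_span.simps) blast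
  qed
qed simp

lemma submodule_finsum:
  assumes W: "submodule W R M" and "finite B" "B \<subseteq> W" "c \<in> B \<rightarrow> carrier R"
  shows "(\<Oplus>\<^bsub>M\<^esub>b\<in>B. c b \<odot>\<^bsub>M\<^esub> b) \<in> W"
  using assms(2-4)
proof (induction B rule: finite_induct)
  case empty
  then show ?case using submoduleD(2)[OF W] by simp
next
  case (insert b B)
  have "(\<Oplus>\<^bsub>M\<^esub>b\<in>insert b B. c b \<odot>\<^bsub>M\<^esub> b) = c b \<odot>\<^bsub>M\<^esub> b \<oplus>\<^bsub>M\<^esub> (\<Oplus>\<^bsub>M\<^esub>b\<in>B. c b \<odot>\<^bsub>M\<^esub> b)"
    using insert submoduleD(1)[OF W] by (intro M.finsum_insert) (auto simp: Pi_iff subset_iff)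
  then show ?case using insert submoduleD(3,4)[OF W] by simp
qed

end

lemma finite_dimensional_list_span:
  assumes "module K M" "finite_dimensional K M"
  obtains bs where "set bs \<subseteq> carrier M" "module.list_span K M bs = carrier M"
proof -
  interpret module K M by fact
  obtain B where B: "finite B" "B \<subseteq> carrier M"
    "\<forall>v\<in>carrier M. \<exists>c\<in>B \<rightarrow> carrier K. v = (\<Oplus>\<^bsub>M\<^esub>b\<in>B. c b \<odot>\<^bsub>M\<^esub> b)"
    using assms(2) unfolding finite_dimensional_def by (elim exE conjE) (rule that)
  obtain bs where bs: "set bs = B" using finite_list[OF B(1)] by blast
  have sub: "submodule (list_span bs) K M" using bs B(2) by (intro submodule_list_span) simp
  have "B \<subseteq> list_span bs" using list_span_mem[of bs] bs B(2) by blast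
  have "v \<in> list_span bs" if v: "v \<in> carrier M" for v
  proof -
    obtain c where "c \<in> B \<rightarrow> carrier K" "v = (\<Oplus>\<^bsub>M\<^esub>b\<in>B. c b \<odot>\<^bsub>M\<^esub> b)" using bspec[OF B(3) v] by blast
    then show ?thesis using submodule_finsum[OF sub B(1) \<open>B \<subseteq> list_span bs\<close>] by simp
  qed
  then have "list_span bs = carrier M" using submoduleD(1)[OF sub] by blast
  with B(2) bs show thesis by (intro that) simp_all
qed

context abelian_group
begin

lemma minus_eq_zeroD: "x \<in> carrier G \<Longrightarrow> y \<in> carrier G \<Longrightarrow> x \<ominus> y = \<zero> \<Longrightarrow> x = y"
  by (metis a_inv_closed add.inv_equality minus_eq minus_minus)

lemma add_minus_cancel: "x \<in> carrier G \<Longrightarrow> y \<in> carrier G \<Longrightarrow> y \<oplus> (x \<ominus> y) = x"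
  using r_neg[of y] by (simp add: minus_eq a_lcomm[of y x])

lemma minus_add_cancel: "x \<in> carrier G \<Longrightarrow> y \<in> carrier G \<Longrightarrow> (y \<oplus> x) \<ominus> y = x"
  using r_neg[of y] by (simp add: minus_eq a_comm[of y x] a_assoc)

lemma minus_zero_right: "x \<in> carrier G \<Longrightarrow> x \<ominus> \<zero> = x"
  by (simp add: minus_eq)

lemma minus_self: "x \<in> carrier G \<Longrightarrow> x \<ominus> x = \<zero>"
  by (simp add: minus_eq r_neg)

lemma minus_minus_minus:
  assumes "x \<in> carrier G" "y \<in> carrier G" "z \<in> carrier G"
  shows "(x \<ominus> y) \<ominus> (x \<ominus> z) = z \<ominus> y"
proof -
  have "(x \<ominus> y) \<ominus> (x \<ominus> z) = (x \<oplus> \<ominus> x) \<oplus> (z \<ominus> y)"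
    using assms unfolding minus_eq by (simp add: minus_add a_ac del: add.r_inv)
  then show ?thesis using assms by (simp add: r_neg)
qed

lemma add_minus_add:
  "x \<in> carrier G \<Longrightarrow> y \<in> carrier G \<Longrightarrow> u \<in> carrier G \<Longrightarrow> v \<in> carrier G \<Longrightarrow>
    (x \<ominus> u) \<oplus> (y \<ominus> v) = (x \<oplus> y) \<ominus> (u \<oplus> v)"
  by (simp add: minus_eq minus_add a_ac)

end

text \<open>\<open>L\<close> is \<open>S\<close> enlarged by the line through \<open>u\<close>, and
  \<psi> is the coordinate of the quotient \<open>L/S\<close>. Two coefficients for the same
  \<open>x\<close> differ by a scalar that multiplies \<open>u\<close> into \<open>S\<close>; if it
  were nonzero it could be inverted, and \<open>u\<close> would lie in \<open>S\<close>.\<close>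

lemma line_coordinate:
  assumes K: "field K" and "module K M" and S: "submodule S K M"
    and u: "u \<in> carrier M" "u \<notin> S"
    and L: "submodule L K M" "\<And>x. x \<in> L \<longleftrightarrow> (\<exists>c\<in>carrier K. x \<ominus>\<^bsub>M\<^esub> c \<odot>\<^bsub>M\<^esub> u \<in> S \<and> x \<in> carrier M)"
  obtains \<psi> where "\<psi> \<in> linear_maps K (M\<lparr>carrier := L\<rparr>) (scalars K)"
    "\<And>x. x \<in> L \<Longrightarrow> \<psi> x \<in> carrier K \<and> x \<ominus>\<^bsub>M\<^esub> \<psi> x \<odot>\<^bsub>M\<^esub> u \<in> S"
    "\<And>x. x \<in> S \<Longrightarrow> \<psi> x = \<zero>\<^bsub>K\<^esub>" "\<psi> u = \<one>\<^bsub>K\<^esub>"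
proof -
  interpret K: field K by fact
  interpret module K M by fact
  note S' = submoduleD[OF S] and L' = submoduleD[OF L(1)]
  define \<psi> where "\<psi> x = (THE c. c \<in> carrier K \<and> x \<ominus>\<^bsub>M\<^esub> c \<odot>\<^bsub>M\<^esub> u \<in> S)" for x
  have \<psi>I: "\<psi> x = c" if "x \<in> carrier M" "c \<in> carrier K" "x \<ominus>\<^bsub>M\<^esub> c \<odot>\<^bsub>M\<^esub> u \<in> S" for x c
    unfolding \<psi>_def
  proof (rule the_equality)
    show "c \<in> carrier K \<and> x \<ominus>\<^bsub>M\<^esub> c \<odot>\<^bsub>M\<^esub> u \<in> S" using that by simp
    fix d assume d: "d \<in> carrier K \<and> x \<ominus>\<^bsub>M\<^esub> d \<odot>\<^bsub>M\<^esub> u \<in> S"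
    have "(x \<ominus>\<^bsub>M\<^esub> c \<odot>\<^bsub>M\<^esub> u) \<ominus>\<^bsub>M\<^esub> (x \<ominus>\<^bsub>M\<^esub> d \<odot>\<^bsub>M\<^esub> u) \<in> S" using d that S'(5) by blast
    also have "(x \<ominus>\<^bsub>M\<^esub> c \<odot>\<^bsub>M\<^esub> u) \<ominus>\<^bsub>M\<^esub> (x \<ominus>\<^bsub>M\<^esub> d \<odot>\<^bsub>M\<^esub> u) = d \<odot>\<^bsub>M\<^esub> u \<ominus>\<^bsub>M\<^esub> c \<odot>\<^bsub>M\<^esub> u"
      using that d u by (simp add: M.minus_minus_minus)
    also have "\<dots> = (d \<ominus>\<^bsub>K\<^esub> c) \<odot>\<^bsub>M\<^esub> u"
      using that d u by (simp add: M.minus_eq K.minus_eq smult_l_distr smult_l_minus)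
    finally have *: "(d \<ominus>\<^bsub>K\<^esub> c) \<odot>\<^bsub>M\<^esub> u \<in> S" .
    show "d = c"
    proof (rule ccontr)
      assume "d \<noteq> c"
      then have ne: "d \<ominus>\<^bsub>K\<^esub> c \<in> Units K"
        using that d K.minus_eq_zeroD[of d c] by (auto simp: K.field_Units)
      then have "inv\<^bsub>K\<^esub> (d \<ominus>\<^bsub>K\<^esub> c) \<odot>\<^bsub>M\<^esub> ((d \<ominus>\<^bsub>K\<^esub> c) \<odot>\<^bsub>M\<^esub> u) \<in> S" using S'(4) * by blast
      also have "inv\<^bsub>K\<^esub> (d \<ominus>\<^bsub>K\<^esub> c) \<odot>\<^bsub>M\<^esub> ((d \<ominus>\<^bsub>K\<^esub> c) \<odot>\<^bsub>M\<^esub> u) = u"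
        using ne u that d by (subst smult_assoc1[symmetric]) auto
      finally show False using u by blast
    qed
  qed
  have \<psi>L: "\<psi> x \<in> carrier K \<and> x \<ominus>\<^bsub>M\<^esub> \<psi> x \<odot>\<^bsub>M\<^esub> u \<in> S" if "x \<in> L" for x
    using L(2)[of x] that \<psi>I by auto
  show thesis
  proof
    show "\<psi> x \<in> carrier K \<and> x \<ominus>\<^bsub>M\<^esub> \<psi> x \<odot>\<^bsub>M\<^esub> u \<in> S" if "x \<in> L" for x
      using \<psi>L[OF that] .
    show "\<psi> x = \<zero>\<^bsub>K\<^esub>" if "x \<in> S" for x
      using that S'(1) u by (intro \<psi>I) (auto simp: M.minus_zero_right subset_iff)
    show "\<psi> u = \<one>\<^bsub>K\<^esub>" using u S'(2) by (intro \<psi>I) (auto simp: M.minus_self)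
    show "\<psi> \<in> linear_maps K (M\<lparr>carrier := L\<rparr>) (scalars K)"
    proof (rule linear_mapsI)
      fix x y assume "x \<in> carrier (M\<lparr>carrier := L\<rparr>)" "y \<in> carrier (M\<lparr>carrier := L\<rparr>)"
      then have xy: "x \<in> L" "y \<in> L" by auto
      then have xyM: "x \<in> carrier M" "y \<in> carrier M" using L'(1) by auto
      note c = \<psi>L[OF xy(1)] \<psi>L[OF xy(2)]
      have "(x \<ominus>\<^bsub>M\<^esub> \<psi> x \<odot>\<^bsub>M\<^esub> u) \<oplus>\<^bsub>M\<^esub> (y \<ominus>\<^bsub>M\<^esub> \<psi> y \<odot>\<^bsub>M\<^esub> u) \<in> S" using c S'(3) by blast
      also have "(x \<ominus>\<^bsub>M\<^esub> \<psi> x \<odot>\<^bsub>M\<^esub> u) \<oplus>\<^bsub>M\<^esub> (y \<ominus>\<^bsub>M\<^esub> \<psi> y \<odot>\<^bsub>M\<^esub> u) = (x \<oplus>\<^bsub>M\<^esub> y) \<ominus>\<^bsub>M\<^esub> (\<psi> x \<oplus>\<^bsub>K\<^esub> \<psi> y) \<odot>\<^bsub>M\<^esub> u"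
        using c xyM u by (simp add: M.add_minus_add smult_l_distr)
      finally show "\<psi> (x \<oplus>\<^bsub>M\<lparr>carrier := L\<rparr>\<^esub> y) = \<psi> x \<oplus>\<^bsub>scalars K\<^esub> \<psi> y"
        using c xyM by (simp add: \<psi>I)
    next
      fix r x assume r: "r \<in> carrier K" and "x \<in> carrier (M\<lparr>carrier := L\<rparr>)"
      then have x: "x \<in> L" by simp
      then have xM: "x \<in> carrier M" using L'(1) by auto
      note c = \<psi>L[OF x]
      have "r \<odot>\<^bsub>M\<^esub> (x \<ominus>\<^bsub>M\<^esub> \<psi> x \<odot>\<^bsub>M\<^esub> u) \<in> S" using c S'(4) r by blast
      also have "r \<odot>\<^bsub>M\<^esub> (x \<ominus>\<^bsub>M\<^esub> \<psi> x \<odot>\<^bsub>M\<^esub> u) = r \<odot>\<^bsub>M\<^esub> x \<ominus>\<^bsub>M\<^esub> (r \<otimes>\<^bsub>K\<^esub> \<psi> x) \<odot>\<^bsub>M\<^esub> u"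
        using c xM u r by (simp add: M.minus_eq smult_r_distr smult_r_minus smult_assoc1)
      finally show "\<psi> (r \<odot>\<^bsub>M\<lparr>carrier := L\<rparr>\<^esub> x) = r \<odot>\<^bsub>scalars K\<^esub> \<psi> x"
        using c xM r by (simp add: \<psi>I)
    qed (use \<psi>L in auto)
  qed
qed

text \<open>Induction along the flag. If \<open>b\<close> enlarges the span, one pair
  \<open>(u, \<psi>)\<close> is added and the old functionals are composed with the projection
  \<open>p\<close> along \<open>u\<close>. The only freedom is the choice of \<open>u\<close>, and
  it is used to adapt the system to \<open>W\<close>.\<close>

lemma dual_system_list_span:
  fixes K :: "'k ring" and M :: "('k, 'm, 'y) module_scheme"
  assumes K: "field K" and "module K M" and "set bs \<subseteq> carrier M"
    and "submodule W K M" "W \<subseteq> module.list_span K M bs"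
  shows "\<exists>D. dual_system K (M\<lparr>carrier := module.list_span K M bs\<rparr>) W D"
  using assms(3-5)
proof (induction bs arbitrary: W)
  case Nil
  interpret module K M by fact
  show ?case by (intro exI[of _ "[]"]) (auto simp: dual_system_def)
next
  case (Cons b bs)
  interpret K: field K by fact
  interpret module K M by fact
  let ?S = "list_span bs" and ?L = "list_span (b # bs)"
  have b: "b \<in> carrier M" and bs: "set bs \<subseteq> carrier M" using Cons.prems by auto
  note S = submodule_list_span[OF bs] and L = submodule_list_span[OF Cons.prems(1)]
  note S' = submoduleD[OF S] and L' = submoduleD[OF L] and W' = submoduleD[OF Cons.prems(2)]
  show ?case
  proof (cases "b \<in> ?S")
    case True
    have "?L \<subseteq> ?S" using True S'(3,4) by auto
    moreover have "x \<in> ?L" if "x \<in> ?S" for x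
    proof -
      have "x = \<zero>\<^bsub>K\<^esub> \<odot>\<^bsub>M\<^esub> b \<oplus>\<^bsub>M\<^esub> x" using that S'(1) b by auto
      then show ?thesis using that K.zero_closed by (simp only: list_span.simps) blast
    qed
    ultimately have "?L = ?S" by blast
    then show ?thesis using Cons.IH[OF bs Cons.prems(2)] Cons.prems(3) by simp
  next
    case False
    \<comment> \<open>If \<open>W\<close> lies in the smaller span, \<open>u = b\<close> will do,
      and \<psi> then kills \<open>W\<close>. Otherwise \<open>u\<close> is taken from
      \<open>W\<close>; it generates the same line modulo the smaller span, because its coefficient
      at \<open>b\<close> is invertible.\<close>
    have ex: "\<exists>u\<in>carrier M. u \<notin> ?S \<and> (u \<in> W \<or> W \<subseteq> ?S) \<and>
      (\<forall>x. x \<in> ?L \<longleftrightarrow> (\<exists>c\<in>carrier K. x \<ominus>\<^bsub>M\<^esub> c \<odot>\<^bsub>M\<^esub> u \<in> ?S \<and> x \<in> carrier M))"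
    proof (cases "W \<subseteq> ?S")
      case True
      have "x \<in> ?L \<longleftrightarrow> (\<exists>c\<in>carrier K. x \<ominus>\<^bsub>M\<^esub> c \<odot>\<^bsub>M\<^esub> b \<in> ?S \<and> x \<in> carrier M)" for x
      proof
        assume "x \<in> ?L"
        then obtain a s where *: "a \<in> carrier K" "s \<in> ?S" "x = a \<odot>\<^bsub>M\<^esub> b \<oplus>\<^bsub>M\<^esub> s" by auto
        then have "x \<ominus>\<^bsub>M\<^esub> a \<odot>\<^bsub>M\<^esub> b = s" using b S'(1)
          by (simp add: M.minus_add_cancel subset_iff)
        then show "\<exists>c\<in>carrier K. x \<ominus>\<^bsub>M\<^esub> c \<odot>\<^bsub>M\<^esub> b \<in> ?S \<and> x \<in> carrier M"
          using * b S'(1) by (intro bexI[of _ a]) auto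
      next
        assume "\<exists>c\<in>carrier K. x \<ominus>\<^bsub>M\<^esub> c \<odot>\<^bsub>M\<^esub> b \<in> ?S \<and> x \<in> carrier M"
        then obtain c where *: "c \<in> carrier K" "x \<ominus>\<^bsub>M\<^esub> c \<odot>\<^bsub>M\<^esub> b \<in> ?S" "x \<in> carrier M" by blast
        have "x = c \<odot>\<^bsub>M\<^esub> b \<oplus>\<^bsub>M\<^esub> (x \<ominus>\<^bsub>M\<^esub> c \<odot>\<^bsub>M\<^esub> b)"
          using * b by (simp add: M.add_minus_cancel)
        then show "x \<in> ?L" using * by (simp only: list_span.simps) blast
      qed
      then show ?thesis using True b False by blast
    next
      case nsub: False
      then obtain w where w: "w \<in> W" "w \<notin> ?S" by blast
      then obtain c s where cs: "c \<in> carrier K" "s \<in> ?S" "w = c \<odot>\<^bsub>M\<^esub> b \<oplus>\<^bsub>M\<^esub> s"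
        using Cons.prems(3) by auto
      have wM: "w \<in> carrier M" using w W' by blast
      have sM: "s \<in> carrier M" using cs S' by blast
      have "c \<noteq> \<zero>\<^bsub>K\<^esub>" using cs w b sM by auto
      then have cU: "c \<in> Units K" using cs K.field_Units by blast
      have "x \<in> ?L \<longleftrightarrow> (\<exists>c\<in>carrier K. x \<ominus>\<^bsub>M\<^esub> c \<odot>\<^bsub>M\<^esub> w \<in> ?S \<and> x \<in> carrier M)" for x
      proof
        assume "x \<in> ?L"
        then obtain a t where *: "a \<in> carrier K" "t \<in> ?S" "x = a \<odot>\<^bsub>M\<^esub> b \<oplus>\<^bsub>M\<^esub> t" by auto
        define d where "d = a \<otimes>\<^bsub>K\<^esub> inv\<^bsub>K\<^esub> c"
        have d: "d \<in> carrier K" "d \<otimes>\<^bsub>K\<^esub> c = a" using cU * K.Units_closed[OF cU] by (auto simp: d_def K.m_assoc)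
        have tM: "t \<in> carrier M" using * S' by blast
        have "d \<odot>\<^bsub>M\<^esub> w = a \<odot>\<^bsub>M\<^esub> b \<oplus>\<^bsub>M\<^esub> d \<odot>\<^bsub>M\<^esub> s"
          using cs b sM d by (simp add: smult_r_distr smult_assoc1[symmetric])
        then have "x \<ominus>\<^bsub>M\<^esub> d \<odot>\<^bsub>M\<^esub> w = t \<ominus>\<^bsub>M\<^esub> d \<odot>\<^bsub>M\<^esub> s"
          using * d b sM tM
          by (simp flip: M.add_minus_add add: M.minus_self)
        then have "x \<ominus>\<^bsub>M\<^esub> d \<odot>\<^bsub>M\<^esub> w \<in> ?S" using * d cs S'(4,5) by simp
        then show "\<exists>c\<in>carrier K. x \<ominus>\<^bsub>M\<^esub> c \<odot>\<^bsub>M\<^esub> w \<in> ?S \<and> x \<in> carrier M"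
          using d \<open>x \<in> ?L\<close> L'(1) by blast
      next
        assume "\<exists>c\<in>carrier K. x \<ominus>\<^bsub>M\<^esub> c \<odot>\<^bsub>M\<^esub> w \<in> ?S \<and> x \<in> carrier M"
        then obtain d where *: "d \<in> carrier K" "x \<ominus>\<^bsub>M\<^esub> d \<odot>\<^bsub>M\<^esub> w \<in> ?S" "x \<in> carrier M" by blast
        have "x \<ominus>\<^bsub>M\<^esub> d \<odot>\<^bsub>M\<^esub> w \<in> ?L"
        proof -
          have "x \<ominus>\<^bsub>M\<^esub> d \<odot>\<^bsub>M\<^esub> w = \<zero>\<^bsub>K\<^esub> \<odot>\<^bsub>M\<^esub> b \<oplus>\<^bsub>M\<^esub> (x \<ominus>\<^bsub>M\<^esub> d \<odot>\<^bsub>M\<^esub> w)"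
            using * S'(1) b wM by simp
          then show ?thesis using * K.zero_closed by (simp only: list_span.simps) blast
        qed
        then have "d \<odot>\<^bsub>M\<^esub> w \<oplus>\<^bsub>M\<^esub> (x \<ominus>\<^bsub>M\<^esub> d \<odot>\<^bsub>M\<^esub> w) \<in> ?L"
          using * w Cons.prems(3) L'(3,4) by blast
        also have "d \<odot>\<^bsub>M\<^esub> w \<oplus>\<^bsub>M\<^esub> (x \<ominus>\<^bsub>M\<^esub> d \<odot>\<^bsub>M\<^esub> w) = x"
          using * wM by (simp add: M.add_minus_cancel)
        finally show "x \<in> ?L" .
      qed
      then show ?thesis using w wM by blast
    qed
    then obtain u where u: "u \<in> carrier M" "u \<notin> ?S" "u \<in> W \<or> W \<subseteq> ?S"
      and uL: "\<And>x. x \<in> ?L \<longleftrightarrow> (\<exists>c\<in>carrier K. x \<ominus>\<^bsub>M\<^esub> c \<odot>\<^bsub>M\<^esub> u \<in> ?S \<and> x \<in> carrier M)" by blast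
    obtain \<psi> where \<psi>: "\<psi> \<in> linear_maps K (M\<lparr>carrier := ?L\<rparr>) (scalars K)"
      "\<And>x. x \<in> ?L \<Longrightarrow> \<psi> x \<in> carrier K \<and> x \<ominus>\<^bsub>M\<^esub> \<psi> x \<odot>\<^bsub>M\<^esub> u \<in> ?S"
      "\<And>x. x \<in> ?S \<Longrightarrow> \<psi> x = \<zero>\<^bsub>K\<^esub>" "\<psi> u = \<one>\<^bsub>K\<^esub>"
      using line_coordinate[OF K \<open>module K M\<close> S u(1,2) L uL] by blast
    have "submodule (W \<inter> ?S) K M"
      using W' S' by (intro submoduleI') (simp_all del: list_span.simps, blast)
    from Cons.IH[OF bs this] obtain D where D: "dual_system K (M\<lparr>carrier := ?S\<rparr>) (W \<inter> ?S) D" by auto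
    \<comment> \<open>For \<open>u\<close> in \<open>W\<close> the projection subtracts elements of
      \<open>W\<close>; otherwise \<psi> vanishes on \<open>W\<close> and \<open>p\<close> fixes it.
      Either way \<open>p\<close> sends \<open>W\<close> into \<open>W \<inter> ?S\<close>, the
      subspace to which the induction hypothesis was applied.\<close>
    define p where "p x = x \<ominus>\<^bsub>M\<^esub> \<psi> x \<odot>\<^bsub>M\<^esub> u" for x
    have uLm: "u \<in> ?L"
    proof -
      have "u \<ominus>\<^bsub>M\<^esub> \<one>\<^bsub>K\<^esub> \<odot>\<^bsub>M\<^esub> u = \<zero>\<^bsub>M\<^esub>" using u by (simp add: M.minus_self)
      then show ?thesis using uL[of u] u S'(2) K.one_closed by metis
    qed
    have SL: "?S \<subseteq> ?L"
    proof
      fix x assume x: "x \<in> ?S"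
      then have "x \<ominus>\<^bsub>M\<^esub> \<zero>\<^bsub>K\<^esub> \<odot>\<^bsub>M\<^esub> u \<in> ?S" using u S'(1) by (auto simp: M.minus_zero_right subset_iff)
      then show "x \<in> ?L" using x uL[of x] S'(1) K.zero_closed by blast
    qed
    have modL: "module K (M\<lparr>carrier := ?L\<rparr>)" by (rule submodule.submodule_is_module[OF L \<open>module K M\<close>])
    have modS: "module K (M\<lparr>carrier := ?S\<rparr>)" by (rule submodule.submodule_is_module[OF S \<open>module K M\<close>])
    have p: "p \<in> linear_maps K (M\<lparr>carrier := ?L\<rparr>) (M\<lparr>carrier := ?S\<rparr>)"
    proof (rule linear_mapsI)
      fix x y assume "x \<in> carrier (M\<lparr>carrier := ?L\<rparr>)" "y \<in> carrier (M\<lparr>carrier := ?L\<rparr>)"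
      then have xy: "x \<in> ?L" "y \<in> ?L" "x \<in> carrier M" "y \<in> carrier M" using L'(1) by auto
      then show "p (x \<oplus>\<^bsub>M\<lparr>carrier := ?L\<rparr>\<^esub> y) = p x \<oplus>\<^bsub>M\<lparr>carrier := ?S\<rparr>\<^esub> p y"
        using \<psi>(2)[OF xy(1)] \<psi>(2)[OF xy(2)] u lin_add[OF \<psi>(1), of x y]
        by (simp add: p_def M.add_minus_add smult_l_distr del: list_span.simps)
    next
      fix r x assume r: "r \<in> carrier K" and "x \<in> carrier (M\<lparr>carrier := ?L\<rparr>)"
      then have x: "x \<in> ?L" "x \<in> carrier M" using L'(1) by auto
      then show "p (r \<odot>\<^bsub>M\<lparr>carrier := ?L\<rparr>\<^esub> x) = r \<odot>\<^bsub>M\<lparr>carrier := ?S\<rparr>\<^esub> p x"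
        using \<psi>(2)[OF x(1)] u lin_smult[OF \<psi>(1) r, of x] r
        by (simp add: p_def M.minus_eq smult_r_distr smult_r_minus smult_assoc1 del: list_span.simps)
    qed (use \<psi>(2) in \<open>auto simp: p_def\<close>)
    define D' where "D' = (u, \<psi>) # map (\<lambda>(b, \<phi>). (b, \<lambda>x. \<phi> (p x))) D"
    have "dual_system K (M\<lparr>carrier := ?L\<rparr>) W D'"
      unfolding dual_system_def
    proof (intro conjI ballI)
      fix q assume "q \<in> set D'"
      then consider "q = (u, \<psi>)" | b \<phi> where "(b, \<phi>) \<in> set D" "q = (b, \<lambda>x. \<phi> (p x))"
        by (auto simp: D'_def)
      then show "case q of (b, \<phi>) \<Rightarrow> b \<in> carrier (M\<lparr>carrier := ?L\<rparr>) \<and>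
          \<phi> \<in> linear_maps K (M\<lparr>carrier := ?L\<rparr>) (scalars K) \<and> (b \<in> W \<or> (\<forall>w\<in>W. \<phi> w = \<zero>\<^bsub>K\<^esub>))"
      proof cases
        case 1
        then show ?thesis using u uLm \<psi>(1) \<psi>(3) by (auto simp del: list_span.simps)
      next
        case 2
        have "p w \<in> W \<inter> ?S" if "w \<in> W" for w
        proof -
          have wL: "w \<in> ?L" using that Cons.prems(3) by blast
          have "p w \<in> W"
          proof (cases "u \<in> W")
            case True
            then show ?thesis using that \<psi>(2)[OF wL] W'(4,5) unfolding p_def by blast
          next
            case False
            then have "\<psi> w = \<zero>\<^bsub>K\<^esub>" using u(3) \<psi>(3) that by blast
            then show ?thesis using that u W'(1) by (auto simp: p_def M.minus_zero_right subset_iff)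
          qed
          then show ?thesis using \<psi>(2)[OF wL] by (simp add: p_def)
        qed
        moreover have "\<phi> \<in> linear_maps K (M\<lparr>carrier := ?S\<rparr>) (scalars K)" "b \<in> ?S"
          using dual_systemD[OF D 2(1)] by auto
        moreover have "b \<in> W \<or> (\<forall>w\<in>W \<inter> ?S. \<phi> w = \<zero>\<^bsub>K\<^esub>)"
          using D 2(1) by (auto simp: dual_system_def)
        ultimately show ?thesis using 2 SL by (auto intro: lin_comp[OF p] simp del: list_span.simps)
      qed
    next
      fix x assume "x \<in> carrier (M\<lparr>carrier := ?L\<rparr>)"
      then have x: "x \<in> ?L" "x \<in> carrier M" using L'(1) by auto
      have "p x \<in> ?S" using \<psi>(2)[OF x(1)] by (simp add: p_def)
      then have "tsum (M\<lparr>carrier := ?S\<rparr>) (\<lambda>b \<phi>. \<phi> (p x) \<odot>\<^bsub>M\<^esub> b) D = p x"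
        using dual_system_sum[OF D, of "p x"] by simp
      then have "tsum M (\<lambda>b \<phi>. \<phi> (p x) \<odot>\<^bsub>M\<^esub> b) D = p x" by (simp add: tsum_def)
      then have "tsum M (\<lambda>b \<phi>. \<phi> x \<odot>\<^bsub>M\<^esub> b) D' = \<psi> x \<odot>\<^bsub>M\<^esub> u \<oplus>\<^bsub>M\<^esub> p x"
        unfolding D'_def using tsum_map[of M "\<lambda>b \<phi>. \<phi> x \<odot>\<^bsub>M\<^esub> b" "\<lambda>b \<phi>. b" "\<lambda>b \<phi> x. \<phi> (p x)" D] by simp
      also have "\<dots> = x"
        using x \<psi>(2)[OF x(1)] u by (simp add: p_def M.add_minus_cancel)
      finally show "tsum (M\<lparr>carrier := ?L\<rparr>) (\<lambda>b \<phi>. \<phi> x \<odot>\<^bsub>M\<lparr>carrier := ?L\<rparr>\<^esub> b) D' = x"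
        by (simp add: tsum_def)
    qed
    then show ?thesis by blast
  qed
qed

lemma dual_system_exists:
  fixes K :: "'k ring" and M :: "('k, 'm, 'y) module_scheme"
  assumes "field K" "module K M" "finite_dimensional K M" "submodule W K M"
  obtains D where "dual_system K M W D"
proof -
  interpret module K M by fact
  obtain bs where "set bs \<subseteq> carrier M" "list_span bs = carrier M"
    using finite_dimensional_list_span[OF assms(2,3)] by blast
  then obtain D where "dual_system K (M\<lparr>carrier := carrier M\<rparr>) W D"
    using dual_system_list_span[OF assms(1,2) _ assms(4), of bs] submoduleD(1)[OF assms(4)] by auto
  then show thesis using that by simp
qed

section \<open>Sweedler calculus\<close>

sublocale finite_group_scheme \<subseteq> K: field K
  by (rule field)

sublocale finite_group_scheme \<subseteq> A: algebra K A
  by (rule algebra)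

sublocale finite_group_scheme \<subseteq> AA: two_algebras K A A
  by unfold_locales

context finite_group_scheme
begin

lemma module_A: "module K A"
  by (rule A.module_axioms)

lemma module_scalars: "module K (scalars K)"
  using algebra_scalars[OF A.R_cring] by (simp add: algebra_def)

lemma comult_linear: "comult A \<in> linear_maps K A AA.T"
  and counit_linear: "counit A \<in> linear_maps K A (scalars K)"
  using comult counit by (auto simp: algebra_homs_def)

lemma comult_closed: "a \<in> carrier A \<Longrightarrow> comult A a \<in> carrier AA.T"
  and counit_closed: "a \<in> carrier A \<Longrightarrow> counit A a \<in> carrier K"
  and antipode_closed: "a \<in> carrier A \<Longrightarrow> antipode A a \<in> carrier A"
  using lin_closed[OF comult_linear] lin_closed[OF counit_linear] lin_closed[OF antipode] by auto

lemma counit_one: "counit A \<one>\<^bsub>A\<^esub> = \<one>\<^bsub>K\<^esub>"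
  and counit_mult: "a \<in> carrier A \<Longrightarrow> b \<in> carrier A \<Longrightarrow> counit A (a \<otimes>\<^bsub>A\<^esub> b) = counit A a \<otimes>\<^bsub>K\<^esub> counit A b"
  using counit by (auto simp: algebra_homs_def ring_hom_def)

text \<open>The Sweedler sum \<open>\<Sum> \<beta>(a\<^sub>1, a\<^sub>2)\<close>.\<close>

definition sw :: "('p, 'w) ring_scheme \<Rightarrow> ('a \<Rightarrow> 'a \<Rightarrow> 'p) \<Rightarrow> 'a \<Rightarrow> 'p"
  where "sw P \<beta> a = tensor_lift P \<beta> (comult A a)"

lemma sw_closed:
  assumes "module K P" "a \<in> carrier A"
    and "\<And>x y. x \<in> carrier A \<Longrightarrow> y \<in> carrier A \<Longrightarrow> \<beta> x y \<in> carrier P"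
  shows "sw P \<beta> a \<in> carrier P"
proof -
  interpret P: module K P by fact
  show ?thesis
    unfolding sw_def tensor_lift_tsum
    using AA.tensor_rep_lists[OF comult_closed[OF assms(2)]] assms(3)
    by (auto intro!: P.tsum_closed)
qed

lemma sw_cong:
  assumes "a \<in> carrier A"
    and "\<And>x y. x \<in> carrier A \<Longrightarrow> y \<in> carrier A \<Longrightarrow> \<beta> x y = \<beta>' x y"
  shows "sw P \<beta> a = sw P \<beta>' a"
  unfolding sw_def using assms by (intro AA.lift_cong comult_closed)

lemma sw_push:
  assumes "f \<in> linear_maps K P Q" "module K P" "module K Q" "a \<in> carrier A"
    "\<And>x y. x \<in> carrier A \<Longrightarrow> y \<in> carrier A \<Longrightarrow> \<beta> x y \<in> carrier P"
  shows "f (sw P \<beta> a) = sw Q (\<lambda>x y. f (\<beta> x y)) a"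
  unfolding sw_def using assms by (intro AA.lift_comp comult_closed)

lemma sw_swap:
  assumes "module K P" "a \<in> carrier A" "b \<in> carrier A"
    "\<And>x y u v. x \<in> carrier A \<Longrightarrow> y \<in> carrier A \<Longrightarrow> u \<in> carrier A \<Longrightarrow> v \<in> carrier A \<Longrightarrow> \<gamma> x y u v \<in> carrier P"
  shows "sw P (\<lambda>x y. sw P (\<lambda>u v. \<gamma> x y u v) b) a = sw P (\<lambda>u v. sw P (\<lambda>x y. \<gamma> x y u v) a) b"
proof -
  interpret P: module K P by fact
  show ?thesis
    unfolding sw_def tensor_lift_tsum
    using AA.tensor_rep_lists[OF comult_closed[OF assms(2)]]
      AA.tensor_rep_lists[OF comult_closed[OF assms(3)]] assms(4)
    by (intro P.tsum_swap) blast
qed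

lemma sw_tsum_swap:
  assumes "module K P" "a \<in> carrier A"
    "\<And>x y u v. x \<in> carrier A \<Longrightarrow> y \<in> carrier A \<Longrightarrow> (u, v) \<in> set xs \<Longrightarrow> \<gamma> x y u v \<in> carrier P"
  shows "sw P (\<lambda>x y. tsum P (\<lambda>u v. \<gamma> x y u v) xs) a = tsum P (\<lambda>u v. sw P (\<lambda>x y. \<gamma> x y u v) a) xs"
proof -
  interpret P: module K P by fact
  show ?thesis
    unfolding sw_def tensor_lift_tsum
    using AA.tensor_rep_lists[OF comult_closed[OF assms(2)]] assms(3)
    by (intro P.tsum_swap) blast
qed

lemma sw_linear:
  assumes "bilinear K A A P \<beta>" "module K P"
  shows "(\<lambda>a. sw P \<beta> a) \<in> linear_maps K A P"
  unfolding sw_def by (intro lin_comp[OF comult_linear] AA.lift_linear assms)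

lemma lin_sw:
  assumes "module K P" "bilinear K A A P \<beta>" "f \<in> linear_maps K M A"
  shows "(\<lambda>z. sw P \<beta> (f z)) \<in> linear_maps K M P"
  by (rule lin_comp[OF assms(3) sw_linear[OF assms(2,1)]])

lemma lin_sw_fun:
  assumes "module K P" "a \<in> carrier A"
    and "\<And>x y. x \<in> carrier A \<Longrightarrow> y \<in> carrier A \<Longrightarrow> (\<lambda>z. \<gamma> z x y) \<in> linear_maps K M P"
  shows "(\<lambda>z. sw P (\<gamma> z) a) \<in> linear_maps K M P"
  unfolding sw_def using assms by (intro AA.lin_lift_fun comult_closed)

text \<open>Backward chaining with these rules proves that nested Sweedler expressions are linear in
  each slot; what remains are closure conditions.\<close>

lemmas lin_rules =
  bilinearI lin_sw lin_sw_fun lin_mult_left lin_mult_right lin_smult_fun lin_smult_const lin_id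
  lin_comp[OF _ antipode] lin_comp[OF _ counit_linear] lin_tsum_fun
  module_A algebra module_scalars

text \<open>The axiom is an equation in \<open>A \<otimes> (A \<otimes> A)\<close>. The trilinear
  \<gamma> induces a linear map \<open>?F\<close> on that module, and applying \<open>?F\<close> to
  the two sides yields the two groupings of the sum. Linearity in each slot is what makes
  \<open>?F\<close> and the intermediate lifts well defined.\<close>

lemma sw_coassoc:
  assumes P: "module K P" and a: "a \<in> carrier A"
    and 1: "\<And>y z. y \<in> carrier A \<Longrightarrow> z \<in> carrier A \<Longrightarrow> (\<lambda>x. \<gamma> x y z) \<in> linear_maps K A P"
    and 2: "\<And>x z. x \<in> carrier A \<Longrightarrow> z \<in> carrier A \<Longrightarrow> (\<lambda>y. \<gamma> x y z) \<in> linear_maps K A P"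
    and 3: "\<And>x y. x \<in> carrier A \<Longrightarrow> y \<in> carrier A \<Longrightarrow> (\<lambda>z. \<gamma> x y z) \<in> linear_maps K A P"
  shows "sw P (\<lambda>x z. sw P (\<lambda>x y. \<gamma> x y z) x) a = sw P (\<lambda>x y. sw P (\<lambda>y z. \<gamma> x y z) y) a"
proof -
  interpret AT: two_modules K A AA.T by (rule two_modulesI[OF module_A AA.module_tensor])
  interpret TA: two_modules K AA.T A by (rule two_modulesI[OF AA.module_tensor module_A])
  define V where "V = tensor_map K AA.T A (comult A) id (comult A a)"
  define \<beta> where "\<beta> = (\<lambda>x U. tensor_lift P (\<gamma> x) U)"
  define ass where "ass = (\<lambda>U p. tensor_lift AT.T (\<lambda>m n. AT.pure m (AA.pure n p)) U)"
  have \<beta>: "\<beta> x U = tensor_lift P (\<gamma> x) U" for x U by (simp add: \<beta>_def)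
  have bg: "bilinear K A A P (\<gamma> x)" if "x \<in> carrier A" for x
    using that 2 3 by (intro bilinearI)
  have bg': "bilinear K A A P (\<lambda>x y. \<gamma> x y z)" if "z \<in> carrier A" for z
    using that 1 2 by (intro bilinearI)
  have b\<beta>: "bilinear K A AA.T P \<beta>"
    unfolding \<beta>_def
    by (intro bilinearI AA.lin_lift_fun AA.lift_linear bg P 1)
  have b\<gamma>: "bilinear K AA.T A P (\<lambda>U z. tensor_lift P (\<lambda>x y. \<gamma> x y z) U)"
    by (intro bilinearI AA.lin_lift_fun AA.lift_linear bg' P 3)
  have bp: "bilinear K A A AT.T (\<lambda>m n. AT.pure m (AA.pure n p))" if "p \<in> carrier A" for p
    using that
    by (intro bilinearI lin_comp[OF bilinear_left[OF AA.bilinear_pure] bilinear_right[OF AT.bilinear_pure]]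
        bilinear_left[OF AT.bilinear_pure] AA.pure_closed)
  have ba: "bilinear K AA.T A AT.T ass"
    unfolding ass_def
    by (intro bilinearI AA.lin_lift_fun AA.lift_linear bp AT.module_tensor
        lin_comp[OF bilinear_right[OF AA.bilinear_pure] bilinear_right[OF AT.bilinear_pure]])
  have bc: "bilinear K A A TA.T (\<lambda>m n. TA.pure (comult A m) (id n))"
    by (intro bilinearI lin_comp[OF lin_id' bilinear_right[OF TA.bilinear_pure]]
        lin_comp[OF comult_linear bilinear_left[OF TA.bilinear_pure]]) (auto simp: comult_closed)
  have bd: "bilinear K A A AT.T (\<lambda>m n. AT.pure (id m) (comult A n))"
    by (intro bilinearI lin_comp[OF lin_id' bilinear_left[OF AT.bilinear_pure]]
        lin_comp[OF comult_linear bilinear_right[OF AT.bilinear_pure]]) (auto simp: comult_closed)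
  let ?F = "tensor_lift P \<beta>"
  have F: "?F \<in> linear_maps K AT.T P" by (rule AT.lift_linear[OF b\<beta> P])
  have V: "V \<in> carrier TA.T"
    unfolding V_def tensor_map_def by (rule AA.lift_closed[OF bc TA.module_tensor comult_closed[OF a]])
  have assoc: "tensor_lift AT.T ass V = tensor_map K A AA.T id (comult A) (comult A a)"
    using coassoc[OF a] by (simp add: tensor_assoc_def V_def ass_def Let_def)
  have "?F (tensor_lift AT.T ass V) = tensor_lift P (\<lambda>U z. ?F (ass U z)) V"
    using bilinear_closed[OF ba] by (intro TA.lift_comp[OF F AT.module_tensor P _ V])
  also have "\<dots> = tensor_lift P (\<lambda>U z. tensor_lift P (\<lambda>x y. \<gamma> x y z) U) V"
  proof (rule TA.lift_cong[OF _ V])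
    fix U z assume *: "U \<in> carrier AA.T" "z \<in> carrier A"
    have "?F (ass U z) = tensor_lift P (\<lambda>m n. ?F (AT.pure m (AA.pure n z))) U"
      unfolding ass_def using bilinear_closed[OF bp[OF *(2)]] *
      by (intro AA.lift_comp[OF F AT.module_tensor P])
    also have "\<dots> = tensor_lift P (\<lambda>x y. \<gamma> x y z) U"
      using * by (intro AA.lift_cong)
        (auto simp: AT.lift_pure[OF b\<beta> P] AA.pure_closed \<beta> AA.lift_pure[OF bg P])
    finally show "?F (ass U z) = tensor_lift P (\<lambda>x y. \<gamma> x y z) U" .
  qed
  also have "\<dots> = sw P (\<lambda>m z. tensor_lift P (\<lambda>U z. tensor_lift P (\<lambda>x y. \<gamma> x y z) U)
      (TA.pure (comult A m) (id z))) a"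
    unfolding V_def tensor_map_def sw_def
    using bilinear_closed[OF bc]
    by (intro AA.lift_comp[OF TA.lift_linear[OF b\<gamma> P] TA.module_tensor P _ comult_closed[OF a]])
  also have "\<dots> = sw P (\<lambda>x z. sw P (\<lambda>x y. \<gamma> x y z) x) a"
    by (intro sw_cong a) (auto simp: TA.lift_pure[OF b\<gamma> P] comult_closed sw_def)
  finally have 4: "?F (tensor_lift AT.T ass V) = sw P (\<lambda>x z. sw P (\<lambda>x y. \<gamma> x y z) x) a" .
  have "?F (tensor_map K A AA.T id (comult A) (comult A a)) = sw P (\<lambda>x y. ?F (AT.pure (id x) (comult A y))) a"
    unfolding tensor_map_def sw_def
    using bilinear_closed[OF bd]
    by (intro AA.lift_comp[OF F AT.module_tensor P _ comult_closed[OF a]])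
  also have "\<dots> = sw P (\<lambda>x y. sw P (\<lambda>y z. \<gamma> x y z) y) a"
    by (intro sw_cong a) (auto simp: AT.lift_pure[OF b\<beta> P] comult_closed sw_def \<beta>)
  finally show ?thesis using 4 assoc by simp
qed

text \<open>The axiom is the case of the identity. Composing with a linear \<open>f\<close> lets the
  counit be cancelled inside larger expressions; the next three lemmas do the same for the other
  axioms.\<close>

lemma sw_counit_left:
  assumes "module K P" "a \<in> carrier A" "f \<in> linear_maps K A P"
  shows "sw P (\<lambda>x y. counit A x \<odot>\<^bsub>P\<^esub> f y) a = f a"
proof -
  have "f (sw A (\<lambda>x y. counit A x \<odot>\<^bsub>A\<^esub> y) a) = sw P (\<lambda>x y. f (counit A x \<odot>\<^bsub>A\<^esub> y)) a"
    using assms by (intro sw_push module_A) (auto simp: counit_closed)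
  also have "\<dots> = sw P (\<lambda>x y. counit A x \<odot>\<^bsub>P\<^esub> f y) a"
    using assms by (intro sw_cong) (auto simp: counit_closed lin_smult)
  finally show ?thesis using counit_left[OF assms(2)] by (simp add: sw_def)
qed

lemma sw_counit_right:
  assumes "module K P" "a \<in> carrier A" "f \<in> linear_maps K A P"
  shows "sw P (\<lambda>x y. counit A y \<odot>\<^bsub>P\<^esub> f x) a = f a"
proof -
  have "f (sw A (\<lambda>x y. counit A y \<odot>\<^bsub>A\<^esub> x) a) = sw P (\<lambda>x y. f (counit A y \<odot>\<^bsub>A\<^esub> x)) a"
    using assms by (intro sw_push module_A) (auto simp: counit_closed)
  also have "\<dots> = sw P (\<lambda>x y. counit A y \<odot>\<^bsub>P\<^esub> f x) a"
    using assms by (intro sw_cong) (auto simp: counit_closed lin_smult)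
  finally show ?thesis using counit_right[OF assms(2)] by (simp add: sw_def)
qed

lemma sw_antipode_left:
  assumes "module K P" "a \<in> carrier A" "f \<in> linear_maps K A P"
  shows "sw P (\<lambda>x y. f (antipode A x \<otimes>\<^bsub>A\<^esub> y)) a = counit A a \<odot>\<^bsub>P\<^esub> f \<one>\<^bsub>A\<^esub>"
proof -
  have "f (sw A (\<lambda>x y. antipode A x \<otimes>\<^bsub>A\<^esub> y) a) = sw P (\<lambda>x y. f (antipode A x \<otimes>\<^bsub>A\<^esub> y)) a"
    using assms by (intro sw_push module_A) (auto simp: antipode_closed)
  then show ?thesis
    using antipode_left[OF assms(2)] assms by (simp add: sw_def lin_smult counit_closed)
qed

lemma sw_antipode_right:
  assumes "module K P" "a \<in> carrier A" "f \<in> linear_maps K A P"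
  shows "sw P (\<lambda>x y. f (x \<otimes>\<^bsub>A\<^esub> antipode A y)) a = counit A a \<odot>\<^bsub>P\<^esub> f \<one>\<^bsub>A\<^esub>"
proof -
  have "f (sw A (\<lambda>x y. x \<otimes>\<^bsub>A\<^esub> antipode A y) a) = sw P (\<lambda>x y. f (x \<otimes>\<^bsub>A\<^esub> antipode A y)) a"
    using assms by (intro sw_push module_A) (auto simp: antipode_closed)
  then show ?thesis
    using antipode_right[OF assms(2)] assms by (simp add: sw_def lin_smult counit_closed)
qed

lemma sw_one:
  assumes "bilinear K A A P \<beta>" "module K P"
  shows "sw P \<beta> \<one>\<^bsub>A\<^esub> = \<beta> \<one>\<^bsub>A\<^esub> \<one>\<^bsub>A\<^esub>"
proof -
  have "comult A \<one>\<^bsub>A\<^esub> = AA.pure \<one>\<^bsub>A\<^esub> \<one>\<^bsub>A\<^esub>"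
    using comult by (simp add: algebra_homs_def ring_hom_def AA.one_tensor)
  then show ?thesis by (simp add: sw_def AA.lift_pure[OF assms])
qed

lemma lift_tmul:
  assumes "bilinear K A A P \<beta>" "module K P" "U \<in> carrier AA.T" "W \<in> carrier AA.T"
  shows "tensor_lift P \<beta> (AA.tmul U W) =
    tensor_lift P (\<lambda>x y. tensor_lift P (\<lambda>u v. \<beta> (x \<otimes>\<^bsub>A\<^esub> u) (y \<otimes>\<^bsub>A\<^esub> v)) W) U"
proof -
  note L = AA.lift_linear[OF assms(1,2)]
  have "tensor_lift P \<beta> (AA.tmul U W) = tensor_lift P (\<lambda>x y.
      tensor_lift P \<beta> (tensor_lift AA.T (\<lambda>u v. AA.pure (x \<otimes>\<^bsub>A\<^esub> u) (y \<otimes>\<^bsub>A\<^esub> v)) W)) U"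
    unfolding AA.tmul_def
    using bilinear_closed[OF AA.bilinear_lift_pure_mult[OF assms(4)]] assms
    by (intro AA.lift_comp[OF L AA.module_tensor])
  also have "\<dots> = tensor_lift P (\<lambda>x y. tensor_lift P (\<lambda>u v. \<beta> (x \<otimes>\<^bsub>A\<^esub> u) (y \<otimes>\<^bsub>A\<^esub> v)) W) U"
  proof (rule AA.lift_cong[OF _ assms(3)])
    fix x y assume xy: "x \<in> carrier A" "y \<in> carrier A"
    have "tensor_lift P \<beta> (tensor_lift AA.T (\<lambda>u v. AA.pure (x \<otimes>\<^bsub>A\<^esub> u) (y \<otimes>\<^bsub>A\<^esub> v)) W) =
        tensor_lift P (\<lambda>u v. tensor_lift P \<beta> (AA.pure (x \<otimes>\<^bsub>A\<^esub> u) (y \<otimes>\<^bsub>A\<^esub> v))) W"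
      using xy assms by (intro AA.lift_comp[OF L AA.module_tensor]) (auto simp: AA.pure_closed)
    also have "\<dots> = tensor_lift P (\<lambda>u v. \<beta> (x \<otimes>\<^bsub>A\<^esub> u) (y \<otimes>\<^bsub>A\<^esub> v)) W"
      using xy assms(4) by (intro AA.lift_cong) (auto simp: AA.lift_pure[OF assms(1,2)])
    finally show "tensor_lift P \<beta> (tensor_lift AA.T (\<lambda>u v. AA.pure (x \<otimes>\<^bsub>A\<^esub> u) (y \<otimes>\<^bsub>A\<^esub> v)) W) =
        tensor_lift P (\<lambda>u v. \<beta> (x \<otimes>\<^bsub>A\<^esub> u) (y \<otimes>\<^bsub>A\<^esub> v)) W" .
  qed
  finally show ?thesis .
qed

lemma sw_mult:
  assumes "bilinear K A A P \<beta>" "module K P" "a \<in> carrier A" "b \<in> carrier A"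
  shows "sw P \<beta> (a \<otimes>\<^bsub>A\<^esub> b) = sw P (\<lambda>x y. sw P (\<lambda>u v. \<beta> (x \<otimes>\<^bsub>A\<^esub> u) (y \<otimes>\<^bsub>A\<^esub> v)) b) a"
proof -
  have "comult A (a \<otimes>\<^bsub>A\<^esub> b) = AA.tmul (comult A a) (comult A b)"
    using comult assms(3,4) comult_closed
    by (simp add: algebra_homs_def ring_hom_def AA.tensor_mult)
  then show ?thesis
    using assms by (simp add: sw_def lift_tmul comult_closed)
qed

section \<open>The antipode is a morphism of algebras\<close>

lemma antipode_one: "antipode A \<one>\<^bsub>A\<^esub> = \<one>\<^bsub>A\<^esub>"
proof -
  have "sw A (\<lambda>x y. antipode A x \<otimes>\<^bsub>A\<^esub> y) \<one>\<^bsub>A\<^esub> = antipode A \<one>\<^bsub>A\<^esub> \<otimes>\<^bsub>A\<^esub> \<one>\<^bsub>A\<^esub>"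
    by (rule sw_one) (intro lin_rules; simp add: antipode_closed)+
  then show ?thesis
    using sw_antipode_left[OF module_A A.one_closed lin_id] by (simp add: counit_one antipode_closed)
qed

text \<open>Both \<open>(a, b) \<mapsto> S(ab)\<close> and \<open>(a, b) \<mapsto> S(a)S(b)\<close> are convolution inverse to the multiplication
  \<open>A \<otimes> A \<rightarrow> A\<close>.\<close>

lemma antipode_mult:
  assumes a: "a \<in> carrier A" and b: "b \<in> carrier A"
  shows "antipode A (a \<otimes>\<^bsub>A\<^esub> b) = antipode A a \<otimes>\<^bsub>A\<^esub> antipode A b"
proof -
  let ?S = "antipode A" and ?\<epsilon> = "counit A"
  note cl = antipode_closed counit_closed sw_closed[OF module_A]
  \<comment> \<open>The summand of the threefold convolution product on \<open>A \<otimes> A\<close>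
    of \<open>S(ab)\<close>, the multiplication and \<open>S(a)S(b)\<close>. By \<open>right\<close>
    the last two factors cancel and leave \<open>S(ab)\<close>; by \<open>left\<close> the first two
    cancel and leave \<open>S(a)S(b)\<close>.\<close>
  define \<Gamma> where "\<Gamma> x y z u v w = (?S (x \<otimes>\<^bsub>A\<^esub> u) \<otimes>\<^bsub>A\<^esub> (y \<otimes>\<^bsub>A\<^esub> v)) \<otimes>\<^bsub>A\<^esub> (?S z \<otimes>\<^bsub>A\<^esub> ?S w)" for x y z u v w
  have \<Gamma>: "\<Gamma> x y z u v w \<in> carrier A" if "x \<in> carrier A" "y \<in> carrier A" "z \<in> carrier A"
      "u \<in> carrier A" "v \<in> carrier A" "w \<in> carrier A" for x y z u v w
    using that by (simp add: \<Gamma>_def cl)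
  have left: "sw A (\<lambda>x y. sw A (\<lambda>u v. ?S (x \<otimes>\<^bsub>A\<^esub> u) \<otimes>\<^bsub>A\<^esub> (y \<otimes>\<^bsub>A\<^esub> v)) b') a' = (?\<epsilon> a' \<otimes>\<^bsub>K\<^esub> ?\<epsilon> b') \<odot>\<^bsub>A\<^esub> \<one>\<^bsub>A\<^esub>"
    if "a' \<in> carrier A" "b' \<in> carrier A" for a' b'
  proof -
    have "bilinear K A A A (\<lambda>x y. ?S x \<otimes>\<^bsub>A\<^esub> y)" by (intro lin_rules) (auto simp: cl)
    from sw_mult[OF this module_A that] show ?thesis
      using sw_antipode_left[OF module_A _ lin_id, of "a' \<otimes>\<^bsub>A\<^esub> b'"] that by (simp add: counit_mult)
  qed
  have right: "sw A (\<lambda>x y. sw A (\<lambda>u v. (x \<otimes>\<^bsub>A\<^esub> u) \<otimes>\<^bsub>A\<^esub> (?S y \<otimes>\<^bsub>A\<^esub> ?S v)) b') a' = ?\<epsilon> a' \<odot>\<^bsub>A\<^esub> (?\<epsilon> b' \<odot>\<^bsub>A\<^esub> \<one>\<^bsub>A\<^esub>)"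
    if ab: "a' \<in> carrier A" "b' \<in> carrier A" for a' b'
  proof -
    have "sw A (\<lambda>x y. sw A (\<lambda>u v. (x \<otimes>\<^bsub>A\<^esub> u) \<otimes>\<^bsub>A\<^esub> (?S y \<otimes>\<^bsub>A\<^esub> ?S v)) b') a' =
        sw A (\<lambda>x y. (x \<otimes>\<^bsub>A\<^esub> ?S y) \<otimes>\<^bsub>A\<^esub> (?\<epsilon> b' \<odot>\<^bsub>A\<^esub> \<one>\<^bsub>A\<^esub>)) a'"
    proof (rule sw_cong[OF ab(1)])
      fix x y assume xy: "x \<in> carrier A" "y \<in> carrier A"
      have "sw A (\<lambda>u v. (x \<otimes>\<^bsub>A\<^esub> u) \<otimes>\<^bsub>A\<^esub> (?S y \<otimes>\<^bsub>A\<^esub> ?S v)) b' =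
          sw A (\<lambda>u v. (x \<otimes>\<^bsub>A\<^esub> ?S y) \<otimes>\<^bsub>A\<^esub> (u \<otimes>\<^bsub>A\<^esub> ?S v)) b'"
        using xy ab by (intro sw_cong) (simp_all add: cl A.m_ac)
      also have "\<dots> = ?\<epsilon> b' \<odot>\<^bsub>A\<^esub> ((x \<otimes>\<^bsub>A\<^esub> ?S y) \<otimes>\<^bsub>A\<^esub> \<one>\<^bsub>A\<^esub>)"
        using xy ab by (intro sw_antipode_right lin_rules) (auto simp: cl)
      also have "\<dots> = (x \<otimes>\<^bsub>A\<^esub> ?S y) \<otimes>\<^bsub>A\<^esub> (?\<epsilon> b' \<odot>\<^bsub>A\<^esub> \<one>\<^bsub>A\<^esub>)"
        using xy ab by (simp add: cl A.smult_assoc2_right)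
      finally show "sw A (\<lambda>u v. (x \<otimes>\<^bsub>A\<^esub> u) \<otimes>\<^bsub>A\<^esub> (?S y \<otimes>\<^bsub>A\<^esub> ?S v)) b' = (x \<otimes>\<^bsub>A\<^esub> ?S y) \<otimes>\<^bsub>A\<^esub> (?\<epsilon> b' \<odot>\<^bsub>A\<^esub> \<one>\<^bsub>A\<^esub>)" .
    qed
    also have "\<dots> = ?\<epsilon> a' \<odot>\<^bsub>A\<^esub> (\<one>\<^bsub>A\<^esub> \<otimes>\<^bsub>A\<^esub> (?\<epsilon> b' \<odot>\<^bsub>A\<^esub> \<one>\<^bsub>A\<^esub>))"
      using ab by (intro sw_antipode_right[where f = "\<lambda>t. t \<otimes>\<^bsub>A\<^esub> (?\<epsilon> b' \<odot>\<^bsub>A\<^esub> \<one>\<^bsub>A\<^esub>)"] lin_rules) (auto simp: cl)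
    finally show ?thesis using ab by (simp add: cl)
  qed
  have "?S (a \<otimes>\<^bsub>A\<^esub> b) = sw A (\<lambda>x y. sw A (\<lambda>u v. ?\<epsilon> y \<odot>\<^bsub>A\<^esub> (?\<epsilon> v \<odot>\<^bsub>A\<^esub> ?S (x \<otimes>\<^bsub>A\<^esub> u))) b) a"
  proof -
    have "?S (a \<otimes>\<^bsub>A\<^esub> b) = sw A (\<lambda>x y. ?\<epsilon> y \<odot>\<^bsub>A\<^esub> ?S (x \<otimes>\<^bsub>A\<^esub> b)) a"
      by (rule sw_counit_right[symmetric]) (use a b in \<open>auto intro!: lin_rules\<close>)
    also have "\<dots> = sw A (\<lambda>x y. sw A (\<lambda>u v. ?\<epsilon> y \<odot>\<^bsub>A\<^esub> (?\<epsilon> v \<odot>\<^bsub>A\<^esub> ?S (x \<otimes>\<^bsub>A\<^esub> u))) b) a"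
    proof (rule sw_cong[OF a])
      fix x y assume xy: "x \<in> carrier A" "y \<in> carrier A"
      have "?S (x \<otimes>\<^bsub>A\<^esub> b) = sw A (\<lambda>u v. ?\<epsilon> v \<odot>\<^bsub>A\<^esub> ?S (x \<otimes>\<^bsub>A\<^esub> u)) b"
        by (rule sw_counit_right[symmetric]) (use xy b in \<open>auto intro!: lin_rules\<close>)
      then show "?\<epsilon> y \<odot>\<^bsub>A\<^esub> ?S (x \<otimes>\<^bsub>A\<^esub> b) = sw A (\<lambda>u v. ?\<epsilon> y \<odot>\<^bsub>A\<^esub> (?\<epsilon> v \<odot>\<^bsub>A\<^esub> ?S (x \<otimes>\<^bsub>A\<^esub> u))) b"
        using xy b by (simp, intro sw_push[OF lin_smult_const[OF module_A lin_id] module_A module_A])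
          (auto simp: cl)
    qed
    finally show ?thesis .
  qed
  also have "\<dots> = sw A (\<lambda>x y. sw A (\<lambda>u v. sw A (\<lambda>y z. sw A (\<lambda>v w. \<Gamma> x y z u v w) v) y) b) a"
  proof (intro sw_cong a b)
    fix x y u v assume xy: "x \<in> carrier A" "y \<in> carrier A" "u \<in> carrier A" "v \<in> carrier A"
    have "sw A (\<lambda>y z. sw A (\<lambda>v w. \<Gamma> x y z u v w) v) y =
       sw A (\<lambda>y z. ?S (x \<otimes>\<^bsub>A\<^esub> u) \<otimes>\<^bsub>A\<^esub> sw A (\<lambda>v w. (y \<otimes>\<^bsub>A\<^esub> v) \<otimes>\<^bsub>A\<^esub> (?S z \<otimes>\<^bsub>A\<^esub> ?S w)) v) y"
      using xy by (intro sw_cong) (auto simp: sw_push[OF lin_mult_left[OF algebra lin_id] module_A module_A]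
        cl \<Gamma>_def A.m_assoc intro!: sw_cong)
    also have "\<dots> = ?S (x \<otimes>\<^bsub>A\<^esub> u) \<otimes>\<^bsub>A\<^esub> sw A (\<lambda>y z. sw A (\<lambda>v w. (y \<otimes>\<^bsub>A\<^esub> v) \<otimes>\<^bsub>A\<^esub> (?S z \<otimes>\<^bsub>A\<^esub> ?S w)) v) y"
      using xy by (subst sw_push[OF lin_mult_left[OF algebra lin_id] module_A module_A]) (simp_all add: cl)
    also have "\<dots> = ?\<epsilon> y \<odot>\<^bsub>A\<^esub> (?\<epsilon> v \<odot>\<^bsub>A\<^esub> ?S (x \<otimes>\<^bsub>A\<^esub> u))"
      using xy by (simp add: right cl A.smult_assoc2_right)
    finally show "?\<epsilon> y \<odot>\<^bsub>A\<^esub> (?\<epsilon> v \<odot>\<^bsub>A\<^esub> ?S (x \<otimes>\<^bsub>A\<^esub> u)) = sw A (\<lambda>y z. sw A (\<lambda>v w. \<Gamma> x y z u v w) v) y" by simp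
  qed
  \<comment> \<open>Reassociation has to be carried out for \<open>a\<close> and for
    \<open>b\<close>. Since their sums are nested in each other, the middle ones are interchanged
    before and after.\<close>
  also have "\<dots> = sw A (\<lambda>x y. sw A (\<lambda>y z. sw A (\<lambda>u v. sw A (\<lambda>v w. \<Gamma> x y z u v w) v) b) y) a"
    using a b by (intro sw_cong sw_swap module_A) (auto simp: cl \<Gamma>)
  also have "\<dots> = sw A (\<lambda>x y. sw A (\<lambda>y z. sw A (\<lambda>u w. sw A (\<lambda>u v. \<Gamma> x y z u v w) u) b) y) a"
    using a b unfolding \<Gamma>_def
    by (intro sw_cong sw_coassoc[symmetric] lin_rules) (auto simp: cl)
  also have "\<dots> = sw A (\<lambda>x z. sw A (\<lambda>x y. sw A (\<lambda>u w. sw A (\<lambda>u v. \<Gamma> x y z u v w) u) b) x) a"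
    using a b unfolding \<Gamma>_def
    by (intro sw_coassoc[symmetric] lin_rules) (auto simp: cl)
  also have "\<dots> = sw A (\<lambda>x z. sw A (\<lambda>u w. sw A (\<lambda>x y. sw A (\<lambda>u v. \<Gamma> x y z u v w) u) x) b) a"
    using a b by (intro sw_cong sw_swap module_A) (auto simp: cl \<Gamma>)
  also have "\<dots> = sw A (\<lambda>x z. sw A (\<lambda>u w. ?\<epsilon> x \<odot>\<^bsub>A\<^esub> (?\<epsilon> u \<odot>\<^bsub>A\<^esub> (?S z \<otimes>\<^bsub>A\<^esub> ?S w))) b) a"
  proof (intro sw_cong a b)
    fix x z u w assume xy: "x \<in> carrier A" "z \<in> carrier A" "u \<in> carrier A" "w \<in> carrier A"
    have "sw A (\<lambda>x y. sw A (\<lambda>u v. \<Gamma> x y z u v w) u) x =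
       sw A (\<lambda>x y. sw A (\<lambda>u v. ?S (x \<otimes>\<^bsub>A\<^esub> u) \<otimes>\<^bsub>A\<^esub> (y \<otimes>\<^bsub>A\<^esub> v)) u \<otimes>\<^bsub>A\<^esub> (?S z \<otimes>\<^bsub>A\<^esub> ?S w)) x"
      using xy by (intro sw_cong) (simp_all add: sw_push[OF lin_mult_right[OF algebra lin_id] module_A module_A]
        cl \<Gamma>_def)
    also have "\<dots> = sw A (\<lambda>x y. sw A (\<lambda>u v. ?S (x \<otimes>\<^bsub>A\<^esub> u) \<otimes>\<^bsub>A\<^esub> (y \<otimes>\<^bsub>A\<^esub> v)) u) x \<otimes>\<^bsub>A\<^esub> (?S z \<otimes>\<^bsub>A\<^esub> ?S w)"
      using xy by (subst sw_push[OF lin_mult_right[OF algebra lin_id] module_A module_A]) (simp_all add: cl)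
    also have "\<dots> = ?\<epsilon> x \<odot>\<^bsub>A\<^esub> (?\<epsilon> u \<odot>\<^bsub>A\<^esub> (?S z \<otimes>\<^bsub>A\<^esub> ?S w))"
      using xy by (simp add: left cl A.smult_assoc2 A.smult_assoc1)
    finally show "sw A (\<lambda>x y. sw A (\<lambda>u v. \<Gamma> x y z u v w) u) x = ?\<epsilon> x \<odot>\<^bsub>A\<^esub> (?\<epsilon> u \<odot>\<^bsub>A\<^esub> (?S z \<otimes>\<^bsub>A\<^esub> ?S w))" .
  qed
  also have "\<dots> = sw A (\<lambda>x z. ?\<epsilon> x \<odot>\<^bsub>A\<^esub> (?S z \<otimes>\<^bsub>A\<^esub> ?S b)) a"
  proof (rule sw_cong[OF a])
    fix x z assume xz: "x \<in> carrier A" "z \<in> carrier A"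
    have "sw A (\<lambda>u w. ?\<epsilon> u \<odot>\<^bsub>A\<^esub> (?S z \<otimes>\<^bsub>A\<^esub> ?S w)) b = ?S z \<otimes>\<^bsub>A\<^esub> ?S b"
      by (rule sw_counit_left) (use xz b in \<open>auto intro!: lin_rules simp: cl\<close>)
    moreover have "sw A (\<lambda>u w. ?\<epsilon> x \<odot>\<^bsub>A\<^esub> (?\<epsilon> u \<odot>\<^bsub>A\<^esub> (?S z \<otimes>\<^bsub>A\<^esub> ?S w))) b =
        ?\<epsilon> x \<odot>\<^bsub>A\<^esub> sw A (\<lambda>u w. ?\<epsilon> u \<odot>\<^bsub>A\<^esub> (?S z \<otimes>\<^bsub>A\<^esub> ?S w)) b"
      using xz b by (intro sw_push[OF lin_smult_const[OF module_A lin_id] module_A module_A, symmetric])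
        (auto simp: cl)
    ultimately show "sw A (\<lambda>u w. ?\<epsilon> x \<odot>\<^bsub>A\<^esub> (?\<epsilon> u \<odot>\<^bsub>A\<^esub> (?S z \<otimes>\<^bsub>A\<^esub> ?S w))) b = ?\<epsilon> x \<odot>\<^bsub>A\<^esub> (?S z \<otimes>\<^bsub>A\<^esub> ?S b)"
      by simp
  qed
  also have "\<dots> = ?S a \<otimes>\<^bsub>A\<^esub> ?S b"
    by (rule sw_counit_left) (use a b in \<open>auto intro!: lin_rules simp: cl\<close>)
  finally show ?thesis .
qed

section \<open>The group of points\<close>

lemma pointsD:
  assumes "g \<in> carrier (points K A R)"
  shows "g \<in> linear_maps K A R" "a \<in> carrier A \<Longrightarrow> g a \<in> carrier R"
    "a \<in> carrier A \<Longrightarrow> b \<in> carrier A \<Longrightarrow> g (a \<otimes>\<^bsub>A\<^esub> b) = g a \<otimes>\<^bsub>R\<^esub> g b"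
    "g \<one>\<^bsub>A\<^esub> = \<one>\<^bsub>R\<^esub>" "g \<in> extensional (carrier A)"
  using assms by (auto simp: points_def algebra_homs_def ring_hom_def)

lemma pointsI:
  assumes "f \<in> linear_maps K A R"
    and "\<And>a b. a \<in> carrier A \<Longrightarrow> b \<in> carrier A \<Longrightarrow> f (a \<otimes>\<^bsub>A\<^esub> b) = f a \<otimes>\<^bsub>R\<^esub> f b" "f \<one>\<^bsub>A\<^esub> = \<one>\<^bsub>R\<^esub>"
  shows "restrict f (carrier A) \<in> carrier (points K A R)"
proof -
  have "restrict f (carrier A) \<in> linear_maps K A R"
    by (rule lin_cong[OF assms(1) _ module_A]) simp
  then show ?thesis
    using assms by (auto simp: points_def algebra_homs_def lin_closed lin_add[OF assms(1)] intro!: ring_hom_memI)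
qed

lemma points_eqI:
  assumes "g \<in> carrier (points K A R)" "h \<in> carrier (points K A R)"
    "\<And>a. a \<in> carrier A \<Longrightarrow> g a = h a"
  shows "g = h"
  using extensionalityI[OF pointsD(5)[OF assms(1)] pointsD(5)[OF assms(2)] assms(3)] .

lemma points_mult:
  "a \<in> carrier A \<Longrightarrow> (g \<otimes>\<^bsub>points K A R\<^esub> h) a = sw R (\<lambda>x y. g x \<otimes>\<^bsub>R\<^esub> h y) a"
  by (simp add: points_def sw_def)

lemma points_one: "a \<in> carrier A \<Longrightarrow> \<one>\<^bsub>points K A R\<^esub> a = counit A a \<odot>\<^bsub>R\<^esub> \<one>\<^bsub>R\<^esub>"
  by (simp add: points_def)

context
  fixes R :: "('k, 'r) module"
  assumes R: "algebra K R"
begin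

interpretation R: algebra K R by (rule R)

lemma module_R: "module K R" by (rule R.module_axioms)

lemma bilinear_points:
  assumes "g \<in> linear_maps K A R" "h \<in> linear_maps K A R"
  shows "bilinear K A A R (\<lambda>x y. g x \<otimes>\<^bsub>R\<^esub> h y)"
  using lin_closed[OF assms(1)] lin_closed[OF assms(2)]
  by (intro lin_rules assms R) auto

lemma points_mult_closed:
  assumes g: "g \<in> carrier (points K A R)" and h: "h \<in> carrier (points K A R)"
  shows "g \<otimes>\<^bsub>points K A R\<^esub> h \<in> carrier (points K A R)"
proof -
  note G = pointsD[OF g] and H = pointsD[OF h]
  let ?f = "sw R (\<lambda>x y. g x \<otimes>\<^bsub>R\<^esub> h y)"
  have bil: "bilinear K A A R (\<lambda>x y. g x \<otimes>\<^bsub>R\<^esub> h y)" by (rule bilinear_points[OF G(1) H(1)])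
  have "restrict ?f (carrier A) \<in> carrier (points K A R)"
  proof (rule pointsI)
    show "?f \<in> linear_maps K A R" by (rule sw_linear[OF bil module_R])
    show "?f \<one>\<^bsub>A\<^esub> = \<one>\<^bsub>R\<^esub>" using sw_one[OF bil module_R] by (simp add: G H)
    fix a b assume ab: "a \<in> carrier A" "b \<in> carrier A"
    have "?f (a \<otimes>\<^bsub>A\<^esub> b) = sw R (\<lambda>x y. sw R (\<lambda>u v. (g x \<otimes>\<^bsub>R\<^esub> h y) \<otimes>\<^bsub>R\<^esub> (g u \<otimes>\<^bsub>R\<^esub> h v)) b) a"
      unfolding sw_mult[OF bil module_R ab]
      using ab by (intro sw_cong) (simp_all add: G H R.m_ac)
    also have "\<dots> = sw R (\<lambda>x y. (g x \<otimes>\<^bsub>R\<^esub> h y) \<otimes>\<^bsub>R\<^esub> ?f b) a"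
      using ab by (intro sw_cong sw_push[OF lin_mult_left[OF R lin_id] module_R module_R, symmetric]) (auto simp: G H)
    also have "\<dots> = ?f a \<otimes>\<^bsub>R\<^esub> ?f b"
      using ab by (intro sw_push[OF lin_mult_right[OF R lin_id] module_R module_R, symmetric])
        (auto simp: G H sw_closed[OF module_R])
    finally show "?f (a \<otimes>\<^bsub>A\<^esub> b) = ?f a \<otimes>\<^bsub>R\<^esub> ?f b" .
  qed
  then show ?thesis by (simp add: points_def sw_def[abs_def])
qed

lemma points_one_closed: "\<one>\<^bsub>points K A R\<^esub> \<in> carrier (points K A R)"
proof -
  have "restrict (\<lambda>a. counit A a \<odot>\<^bsub>R\<^esub> \<one>\<^bsub>R\<^esub>) (carrier A) \<in> carrier (points K A R)"
  proof (rule pointsI)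
    show "(\<lambda>a. counit A a \<odot>\<^bsub>R\<^esub> \<one>\<^bsub>R\<^esub>) \<in> linear_maps K A R"
      by (intro lin_smult_fun counit_linear module_R) simp
  qed (simp_all add: counit_one counit_mult counit_closed R.smult_assoc1 R.smult_assoc2)
  then show ?thesis by (simp add: points_def)
qed

text \<open>An inverse point must again be an algebra morphism; this is where multiplicativity of
  the antipode enters.\<close>

lemma points_antipode:
  assumes g: "g \<in> carrier (points K A R)"
  shows "(\<lambda>a\<in>carrier A. g (antipode A a)) \<in> carrier (points K A R)"
  using pointsD[OF g]
  by (intro pointsI lin_comp[OF antipode]) (auto simp: antipode_one antipode_mult antipode_closed)

lemma points_antipode_left:
  assumes g: "g \<in> carrier (points K A R)"
  shows "(\<lambda>a\<in>carrier A. g (antipode A a)) \<otimes>\<^bsub>points K A R\<^esub> g = \<one>\<^bsub>points K A R\<^esub>"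
proof (rule points_eqI[OF points_mult_closed[OF points_antipode[OF g] g] points_one_closed])
  fix a assume a: "a \<in> carrier A"
  note G = pointsD[OF g]
  have "sw R (\<lambda>x y. (\<lambda>a\<in>carrier A. g (antipode A a)) x \<otimes>\<^bsub>R\<^esub> g y) a = sw R (\<lambda>x y. g (antipode A x \<otimes>\<^bsub>A\<^esub> y)) a"
    using a by (intro sw_cong) (auto simp: G antipode_closed)
  then show "((\<lambda>a\<in>carrier A. g (antipode A a)) \<otimes>\<^bsub>points K A R\<^esub> g) a = \<one>\<^bsub>points K A R\<^esub> a"
    using a by (simp add: points_mult points_one sw_antipode_left[OF module_R _ G(1)] G)
qed

lemma group_points: "group (points K A R)"
proof (rule groupI)
  fix g h l assume g: "g \<in> carrier (points K A R)" and h: "h \<in> carrier (points K A R)"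
    and l: "l \<in> carrier (points K A R)"
  note G = pointsD[OF g] and H = pointsD[OF h] and L = pointsD[OF l]
  show "(g \<otimes>\<^bsub>points K A R\<^esub> h) \<otimes>\<^bsub>points K A R\<^esub> l = g \<otimes>\<^bsub>points K A R\<^esub> (h \<otimes>\<^bsub>points K A R\<^esub> l)"
  proof (rule points_eqI[where R = R])
    fix a assume a: "a \<in> carrier A"
    have "((g \<otimes>\<^bsub>points K A R\<^esub> h) \<otimes>\<^bsub>points K A R\<^esub> l) a = sw R (\<lambda>x z. sw R (\<lambda>x y. g x \<otimes>\<^bsub>R\<^esub> h y) x \<otimes>\<^bsub>R\<^esub> l z) a"
      using a by (simp add: points_mult cong: sw_cong)
    also have "\<dots> = sw R (\<lambda>x z. sw R (\<lambda>x y. (g x \<otimes>\<^bsub>R\<^esub> h y) \<otimes>\<^bsub>R\<^esub> l z) x) a"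
      using a by (intro sw_cong sw_push[OF lin_mult_right[OF R lin_id] module_R module_R]) (auto simp: G H L)
    also have "\<dots> = sw R (\<lambda>x y. sw R (\<lambda>y z. (g x \<otimes>\<^bsub>R\<^esub> h y) \<otimes>\<^bsub>R\<^esub> l z) y) a"
      using a by (intro sw_coassoc lin_rules module_R R) (auto simp: G H L)
    also have "\<dots> = sw R (\<lambda>x y. sw R (\<lambda>y z. g x \<otimes>\<^bsub>R\<^esub> (h y \<otimes>\<^bsub>R\<^esub> l z)) y) a"
      using a by (intro sw_cong) (auto simp: G H L R.m_assoc)
    also have "\<dots> = sw R (\<lambda>x y. g x \<otimes>\<^bsub>R\<^esub> sw R (\<lambda>y z. h y \<otimes>\<^bsub>R\<^esub> l z) y) a"
      using a by (intro sw_cong sw_push[OF lin_mult_left[OF R lin_id] module_R module_R, symmetric]) (auto simp: G H L)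
    also have "\<dots> = (g \<otimes>\<^bsub>points K A R\<^esub> (h \<otimes>\<^bsub>points K A R\<^esub> l)) a"
      using a by (simp add: points_mult cong: sw_cong)
    finally show "((g \<otimes>\<^bsub>points K A R\<^esub> h) \<otimes>\<^bsub>points K A R\<^esub> l) a = (g \<otimes>\<^bsub>points K A R\<^esub> (h \<otimes>\<^bsub>points K A R\<^esub> l)) a" .
  qed (intro points_mult_closed g h l)+
next
  fix g assume g: "g \<in> carrier (points K A R)"
  note G = pointsD[OF g]
  show "\<one>\<^bsub>points K A R\<^esub> \<otimes>\<^bsub>points K A R\<^esub> g = g"
  proof (rule points_eqI[OF points_mult_closed[OF points_one_closed g] g])
    fix a assume a: "a \<in> carrier A"
    have "sw R (\<lambda>x y. \<one>\<^bsub>points K A R\<^esub> x \<otimes>\<^bsub>R\<^esub> g y) a = sw R (\<lambda>x y. counit A x \<odot>\<^bsub>R\<^esub> g y) a"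
      using a by (intro sw_cong) (auto simp: points_one G counit_closed R.smult_assoc2)
    then show "(\<one>\<^bsub>points K A R\<^esub> \<otimes>\<^bsub>points K A R\<^esub> g) a = g a"
      using a by (simp add: points_mult sw_counit_left[OF module_R _ G(1)])
  qed
  show "\<exists>h\<in>carrier (points K A R). h \<otimes>\<^bsub>points K A R\<^esub> g = \<one>\<^bsub>points K A R\<^esub>"
    using points_antipode[OF g] points_antipode_left[OF g] by blast
qed (simp_all add: points_mult_closed points_one_closed)

lemma points_inv:
  assumes g: "g \<in> carrier (points K A R)"
  shows "inv\<^bsub>points K A R\<^esub> g = (\<lambda>a\<in>carrier A. g (antipode A a))"
  using group.inv_equality[OF group_points points_antipode_left[OF g] g points_antipode[OF g]] .

end

end

section \<open>Hopf ideals and quotient algebras\<close>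

text \<open>Expanding the second leg of a pure tensor in the dual system and moving the scalars to
  the left gathers the first legs into coefficients. A tensor thus becomes a list of coordinates in
  \<open>M\<close>.\<close>

lemma (in two_modules) tensor_dual_expansion:
  assumes D: "dual_system K N W D" and U: "U \<in> carrier T"
  shows "U = tsum T (\<lambda>b \<phi>. pure (tensor_lift M (\<lambda>m n. \<phi> n \<odot>\<^bsub>M\<^esub> m) U) b) D"
proof -
  have bil: "bilinear K M N M (\<lambda>m n. \<phi> n \<odot>\<^bsub>M\<^esub> m)" if "(b, \<phi>) \<in> set D" for b \<phi>
    using dual_systemD(2,4)[OF D that]
    by (intro bilinearI lin_smult_fun lin_smult_const lin_id M.module_axioms) auto
  have "(\<lambda>U. U) U = (\<lambda>U. tsum T (\<lambda>b \<phi>. pure (tensor_lift M (\<lambda>m n. \<phi> n \<odot>\<^bsub>M\<^esub> m) U) b) D) U"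
  proof (rule tensor_linear_ext[OF lin_id _ module_tensor U])
    show "(\<lambda>U. tsum T (\<lambda>b \<phi>. pure (tensor_lift M (\<lambda>m n. \<phi> n \<odot>\<^bsub>M\<^esub> m) U) b) D) \<in> linear_maps K T T"
      using dual_systemD(1)[OF D]
      by (intro lin_tsum_fun module_tensor lin_comp[OF lift_linear bilinear_left[OF bilinear_pure]]
          bil M.module_axioms) auto
    fix m n assume mn: "m \<in> carrier M" "n \<in> carrier N"
    note pr = bilinear_right[OF bilinear_pure mn(1)] and pl = bilinear_left[OF bilinear_pure]
    have "pure m n = pure m (tsum N (\<lambda>b \<phi>. \<phi> n \<odot>\<^bsub>N\<^esub> b) D)"
      using dual_system_sum[OF D mn(2)] by simp
    also have "\<dots> = tsum T (\<lambda>b \<phi>. pure m (\<phi> n \<odot>\<^bsub>N\<^esub> b)) D"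
      using dual_systemD[OF D] mn
      by (intro lin_tsum[OF pr N.module_axioms module_tensor]) auto
    also have "\<dots> = tsum T (\<lambda>b \<phi>. pure (tensor_lift M (\<lambda>m n. \<phi> n \<odot>\<^bsub>M\<^esub> m) (pure m n)) b) D"
    proof (rule tsum_cong)
      fix b \<phi> assume b: "(b, \<phi>) \<in> set D"
      note B = dual_systemD[OF D b]
      show "pure m (\<phi> n \<odot>\<^bsub>N\<^esub> b) = pure (tensor_lift M (\<lambda>m n. \<phi> n \<odot>\<^bsub>M\<^esub> m) (pure m n)) b"
        using lift_pure[OF bil[OF b] M.module_axioms mn] lin_smult[OF pr, of "\<phi> n" b]
          lin_smult[OF pl[OF B(1)], of "\<phi> n" m] B mn by simp
    qed
    finally show "pure m n = tsum T (\<lambda>b \<phi>. pure (tensor_lift M (\<lambda>m n. \<phi> n \<odot>\<^bsub>M\<^esub> m) (pure m n)) b) D" .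
  qed
  then show ?thesis by simp
qed

text \<open>The dual system stands in for a basis of the second factor. This separation property
  later gives uniqueness of the left coaction, detects equality in \<open>R \<otimes> V\<close>, and
  embeds \<open>R \<otimes> A\<close> in \<open>'r\<close>.\<close>

lemma (in two_modules) tensor_eqI:
  assumes D: "dual_system K N W D" and "U \<in> carrier T" "U' \<in> carrier T"
    and "\<And>b \<phi>. (b, \<phi>) \<in> set D \<Longrightarrow> tensor_lift M (\<lambda>m n. \<phi> n \<odot>\<^bsub>M\<^esub> m) U = tensor_lift M (\<lambda>m n. \<phi> n \<odot>\<^bsub>M\<^esub> m) U'"
  shows "U = U'"
proof -
  have "tsum T (\<lambda>b \<phi>. pure (tensor_lift M (\<lambda>m n. \<phi> n \<odot>\<^bsub>M\<^esub> m) U) b) D =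
      tsum T (\<lambda>b \<phi>. pure (tensor_lift M (\<lambda>m n. \<phi> n \<odot>\<^bsub>M\<^esub> m) U') b) D"
    using assms(4) by (intro tsum_cong) simp
  then show ?thesis
    using tensor_dual_expansion[OF D assms(2)] tensor_dual_expansion[OF D assms(3)] by simp
qed

lemma (in algebra) submodule_ideal:
  assumes "ideal I M"
  shows "submodule I R M"
proof -
  interpret I: ideal I M by fact
  show ?thesis
  proof (rule submoduleI')
    fix a x assume a: "a \<in> carrier R" and x: "x \<in> I"
    have "a \<odot>\<^bsub>M\<^esub> x = (a \<odot>\<^bsub>M\<^esub> \<one>\<^bsub>M\<^esub>) \<otimes>\<^bsub>M\<^esub> x"
      using a x I.a_subset by (simp add: smult_assoc2 subset_iff)
    then show "a \<odot>\<^bsub>M\<^esub> x \<in> I" using a x by (simp add: I.I_l_closed)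
  qed (use I.a_subset in \<open>auto simp: I.a_closed additive_subgroup.zero_closed[OF I.additive_subgroup_axioms]\<close>)
qed

section \<open>The quotient by an ideal\<close>

locale quotient_module = A: algebra K A + I: ideal I A
  for K :: "'k ring" and A :: "('k, 'a, 'y) module_scheme" and I
begin

abbreviation "C \<equiv> quotient_algebra A I"
abbreviation "\<pi> \<equiv> (\<lambda>x. I +>\<^bsub>A\<^esub> x)"

text \<open>These open the quotient so that facts about the quotient ring apply. Where they are
  deleted, \<open>carrier C\<close> stays folded, which is the form used by the module facts about
  \<open>C\<close>.\<close>

lemma C_simps [simp]: "carrier C = carrier (A Quot I)" "add C = add (A Quot I)"
  "ring.zero C = ring.zero (A Quot I)"
  by (simp_all add: quotient_algebra_def)

lemma submodule_I: "submodule I K A"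
  by (rule A.submodule_ideal[OF I.ideal_axioms])

lemma \<pi>_eq_iff:
  assumes "x \<in> carrier A" "y \<in> carrier A"
  shows "\<pi> x = \<pi> y \<longleftrightarrow> x \<ominus>\<^bsub>A\<^esub> y \<in> I"
  using A.quotient_eq_iff_same_a_r_cos[OF I.ideal_axioms assms] by blast

lemma carrier_C: "carrier C = \<pi> ` carrier A"
  by (auto simp: FactRing_simps)

lemma \<pi>_add: "x \<in> carrier A \<Longrightarrow> y \<in> carrier A \<Longrightarrow> \<pi> x \<oplus>\<^bsub>C\<^esub> \<pi> y = \<pi> (x \<oplus>\<^bsub>A\<^esub> y)"
  by (simp add: FactRing_def I.a_rcos_sum)

lemma \<pi>_smult:
  assumes r: "r \<in> carrier K" and x: "x \<in> carrier A"
  shows "r \<odot>\<^bsub>C\<^esub> \<pi> x = \<pi> (r \<odot>\<^bsub>A\<^esub> x)"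
proof -
  have "\<pi> (r \<odot>\<^bsub>A\<^esub> y) = \<pi> (r \<odot>\<^bsub>A\<^esub> x)" if "y \<in> \<pi> x" for y
  proof -
    have y: "y \<in> carrier A" using that x I.a_elemrcos_carrier by blast
    have "\<pi> y = \<pi> x" using I.a_repr_independence'[OF that x] by simp
    then have "y \<ominus>\<^bsub>A\<^esub> x \<in> I" using \<pi>_eq_iff[OF y x] by simp
    then have "r \<odot>\<^bsub>A\<^esub> (y \<ominus>\<^bsub>A\<^esub> x) \<in> I" using A.submoduleD(4)[OF submodule_I r] by blast
    then show ?thesis using \<pi>_eq_iff x y r
      by (simp add: A.smult_r_distr A.smult_r_minus a_minus_def)
  qed
  moreover have "x \<in> \<pi> x" using x by (rule I.a_rcos_self)
  ultimately have "(\<Union>y\<in>\<pi> x. \<pi> (r \<odot>\<^bsub>A\<^esub> y)) = \<pi> (r \<odot>\<^bsub>A\<^esub> x)" by blast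
  then show ?thesis by (simp add: quotient_algebra_def)
qed

lemma module_C: "module K C"
proof (rule moduleI)
  show "cring K" by (rule A.R_cring)
  interpret Q: ring "A Quot I" by (rule I.quotient_is_ring)
  show "abelian_group C"
    by (rule abelian_groupI; unfold C_simps; rule abelian_groupE[OF Q.abelian_group_axioms]; assumption)
  fix r s x y
  show "r \<odot>\<^bsub>C\<^esub> x \<in> carrier C" if "r \<in> carrier K" "x \<in> carrier C"
    using that unfolding carrier_C by (auto simp del: C_simps simp: \<pi>_smult)
  show "(r \<oplus>\<^bsub>K\<^esub> s) \<odot>\<^bsub>C\<^esub> x = r \<odot>\<^bsub>C\<^esub> x \<oplus>\<^bsub>C\<^esub> s \<odot>\<^bsub>C\<^esub> x"
    if "r \<in> carrier K" "s \<in> carrier K" "x \<in> carrier C"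
    using that unfolding carrier_C by (auto simp del: C_simps simp: \<pi>_smult \<pi>_add A.smult_l_distr)
  show "r \<odot>\<^bsub>C\<^esub> (x \<oplus>\<^bsub>C\<^esub> y) = r \<odot>\<^bsub>C\<^esub> x \<oplus>\<^bsub>C\<^esub> r \<odot>\<^bsub>C\<^esub> y"
    if "r \<in> carrier K" "x \<in> carrier C" "y \<in> carrier C"
    using that unfolding carrier_C by (auto simp del: C_simps simp: \<pi>_smult \<pi>_add A.smult_r_distr)
  show "(r \<otimes>\<^bsub>K\<^esub> s) \<odot>\<^bsub>C\<^esub> x = r \<odot>\<^bsub>C\<^esub> (s \<odot>\<^bsub>C\<^esub> x)"
    if "r \<in> carrier K" "s \<in> carrier K" "x \<in> carrier C"
    using that unfolding carrier_C by (auto simp del: C_simps simp: \<pi>_smult A.smult_assoc1)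
  show "\<one>\<^bsub>K\<^esub> \<odot>\<^bsub>C\<^esub> x = x" if "x \<in> carrier C"
    using that unfolding carrier_C by (auto simp del: C_simps simp: \<pi>_smult)
qed

lemma \<pi>_linear: "\<pi> \<in> linear_maps K A C"
  by (rule linear_mapsI) (auto simp del: C_simps simp: carrier_C \<pi>_add \<pi>_smult)

lemma \<pi>_closed: "x \<in> carrier A \<Longrightarrow> \<pi> x \<in> carrier C"
  by (rule lin_closed[OF \<pi>_linear])

text \<open>Coinvariance is an equation in \<open>A \<otimes> A/I\<close>. To evaluate it by means
  of a function on \<open>A \<times> A\<close>, that function has to descend to the quotient in its
  second argument; vanishing on \<open>I\<close> makes the choice of a representative
  immaterial.\<close>

lemma quotient_bilinear:
  assumes P: "module K P" and B: "bilinear K A A P \<beta>"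
    and z: "\<And>x y. x \<in> carrier A \<Longrightarrow> y \<in> I \<Longrightarrow> \<beta> x y = \<zero>\<^bsub>P\<^esub>"
  obtains \<beta>' where "bilinear K A C P \<beta>'" "\<And>x y. x \<in> carrier A \<Longrightarrow> y \<in> carrier A \<Longrightarrow> \<beta>' x (\<pi> y) = \<beta> x y"
proof -
  interpret P: module K P by fact
  define \<beta>' where "\<beta>' x c = \<beta> x (SOME y. y \<in> carrier A \<and> \<pi> y = c)" for x c
  have \<beta>': "\<beta>' x (\<pi> y) = \<beta> x y" if x: "x \<in> carrier A" and y: "y \<in> carrier A" for x y
  proof -
    define y' where "y' = (SOME y'. y' \<in> carrier A \<and> \<pi> y' = \<pi> y)"
    have y': "y' \<in> carrier A \<and> \<pi> y' = \<pi> y"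
      unfolding y'_def by (rule someI[of _ y]) (use y in simp)
    then have y'A: "y' \<in> carrier A" and "y' \<ominus>\<^bsub>A\<^esub> y \<in> I" using \<pi>_eq_iff y by auto
    from z[OF x this(2)] have "\<beta> x y' \<ominus>\<^bsub>P\<^esub> \<beta> x y = \<zero>\<^bsub>P\<^esub>"
      using lin_minus[OF bilinear_right[OF B x] A.module_axioms P y'A y] by simp
    then have "\<beta> x y' = \<beta> x y"
      by (rule P.minus_eq_zeroD[OF bilinear_closed[OF B x y'A] bilinear_closed[OF B x y]])
    then show ?thesis by (simp add: \<beta>'_def y'_def)
  qed
  have "bilinear K A C P \<beta>'"
  proof (intro bilinearI linear_mapsI)
    fix x c assume x: "x \<in> carrier A" and "c \<in> carrier C"
    then obtain y where y: "y \<in> carrier A" "c = \<pi> y" unfolding carrier_C by blast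
    show "\<beta>' x c \<in> carrier P" using bilinear_closed[OF B x y(1)] by (simp add: \<beta>'[OF x y(1)] y(2))
    then show "\<beta>' x c \<in> carrier P" .
    show "\<beta>' (x \<oplus>\<^bsub>A\<^esub> x') c = \<beta>' x c \<oplus>\<^bsub>P\<^esub> \<beta>' x' c" if "x' \<in> carrier A" for x'
      using lin_add[OF bilinear_left[OF B y(1)] x that] x y(1) that by (simp add: \<beta>' y(2))
    show "\<beta>' x (c \<oplus>\<^bsub>C\<^esub> d) = \<beta>' x c \<oplus>\<^bsub>P\<^esub> \<beta>' x d" if d: "d \<in> carrier C" for d
    proof -
      obtain y' where y': "y' \<in> carrier A" "d = \<pi> y'" using d unfolding carrier_C by blast
      then show ?thesis
        using lin_add[OF bilinear_right[OF B x] y(1) y'(1)] x y(1) by (simp del: C_simps add: \<beta>' \<pi>_add y(2))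
    qed
    fix r assume r: "r \<in> carrier K"
    show "\<beta>' (r \<odot>\<^bsub>A\<^esub> x) c = r \<odot>\<^bsub>P\<^esub> \<beta>' x c"
      using lin_smult[OF bilinear_left[OF B y(1)] r x] x y(1) r by (simp add: \<beta>' y(2))
    show "\<beta>' x (r \<odot>\<^bsub>C\<^esub> c) = r \<odot>\<^bsub>P\<^esub> \<beta>' x c"
      using lin_smult[OF bilinear_right[OF B x] r y(1)] x y(1) r by (simp add: \<beta>' \<pi>_smult y(2))
  qed
  then show thesis using that \<beta>' by blast
qed

end

context finite_group_scheme
begin

lemma hopf_ideal_ideal: "hopf_ideal K A J \<Longrightarrow> ideal J A"
  by (simp add: hopf_ideal_def)

lemma hopf_idealD:
  assumes "hopf_ideal K A J" "a \<in> J"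
  shows "\<exists>xs\<in>lists (J \<times> carrier A \<union> carrier A \<times> J). comult A a = AA.cls xs"
    "counit A a = \<zero>\<^bsub>K\<^esub>" "antipode A a \<in> J" "a \<in> carrier A"
  using assms ideal.Icarr[of J A a] by (simp_all add: hopf_ideal_def)

lemma sw_hopf_ideal:
  assumes J: "hopf_ideal K A J" and P: "module K P" and B: "bilinear K A A P \<beta>" and a: "a \<in> J"
    and l: "\<And>x y. x \<in> J \<Longrightarrow> y \<in> carrier A \<Longrightarrow> \<beta> x y = \<zero>\<^bsub>P\<^esub>"
    and r: "\<And>x y. x \<in> carrier A \<Longrightarrow> y \<in> J \<Longrightarrow> \<beta> x y = \<zero>\<^bsub>P\<^esub>"
  shows "sw P \<beta> a = \<zero>\<^bsub>P\<^esub>"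
proof -
  interpret P: module K P by fact
  interpret J: ideal J A by (rule hopf_ideal_ideal[OF J])
  obtain xs where xs: "xs \<in> lists (J \<times> carrier A \<union> carrier A \<times> J)" "comult A a = AA.cls xs"
    using hopf_idealD(1)[OF J a] by blast
  have "J \<times> carrier A \<union> carrier A \<times> J \<subseteq> carrier A \<times> carrier A" using J.a_subset by blast
  then have "xs \<in> AA.tlists" using xs(1) lists_mono unfolding AA.tlists_def by blast
  then have "sw P \<beta> a = tsum P \<beta> xs" by (simp add: sw_def xs(2) AA.lift_cls[OF _ B P])
  also have "\<dots> = tsum P (\<lambda>x y. \<zero>\<^bsub>P\<^esub>) xs" using xs(1) l r by (intro tsum_cong) (auto simp: in_lists_conv_set)
  finally show ?thesis by (simp add: P.tsum_zero)
qed

text \<open>The three clauses of \<open>hopf_ideal\<close> correspond to the group operations: the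
  counit gives the unit, the antipode the inverses and the comultiplication the products.\<close>

lemma closed_subscheme_subgroup:
  assumes J: "hopf_ideal K A J" and R: "algebra K R"
  shows "subgroup (closed_subscheme K A J R) (points K A R)"
proof (rule group.subgroupI[OF group_points[OF R]])
  interpret R: algebra K R by fact
  interpret J: ideal J A by (rule hopf_ideal_ideal[OF J])
  have JA: "x \<in> J \<Longrightarrow> x \<in> carrier A" for x using J.a_subset by blast
  show "closed_subscheme K A J R \<subseteq> carrier (points K A R)" by (auto simp: closed_subscheme_def)
  have "\<one>\<^bsub>points K A R\<^esub> \<in> closed_subscheme K A J R"
    using JA points_one_closed[OF R] by (simp add: closed_subscheme_def points_one hopf_idealD(2)[OF J])
  then show "closed_subscheme K A J R \<noteq> {}" by blast
  fix g assume "g \<in> closed_subscheme K A J R"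
  then have g: "g \<in> carrier (points K A R)" "\<And>x. x \<in> J \<Longrightarrow> g x = \<zero>\<^bsub>R\<^esub>" by (auto simp: closed_subscheme_def)
  have "inv\<^bsub>points K A R\<^esub> g \<in> carrier (points K A R)"
    using group.inv_closed[OF group_points[OF R] g(1)] .
  then show "inv\<^bsub>points K A R\<^esub> g \<in> closed_subscheme K A J R"
    using g(2) JA by (simp add: closed_subscheme_def points_inv[OF R g(1)] hopf_idealD(3)[OF J])
  fix h assume "h \<in> closed_subscheme K A J R"
  then have h: "h \<in> carrier (points K A R)" "\<And>x. x \<in> J \<Longrightarrow> h x = \<zero>\<^bsub>R\<^esub>" by (auto simp: closed_subscheme_def)
  note G = pointsD[OF g(1)] and H = pointsD[OF h(1)]
  have "sw R (\<lambda>x y. g x \<otimes>\<^bsub>R\<^esub> h y) a = \<zero>\<^bsub>R\<^esub>" if "a \<in> J" for a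
    by (rule sw_hopf_ideal[OF J module_R[OF R] bilinear_points[OF R G(1) H(1)] that])
      (auto simp: g h G H)
  then show "g \<otimes>\<^bsub>points K A R\<^esub> h \<in> closed_subscheme K A J R"
    using points_mult_closed[OF R g(1) h(1)] JA by (simp add: closed_subscheme_def points_mult)
qed

end

section \<open>Coinvariants\<close>

locale subgroup_of_finite_group_scheme = finite_group_scheme K A
  for K :: "'k ring" and A :: "('k, 'a) hopf_algebra" +
  fixes I :: "'a set"
  assumes hopf_ideal: "hopf_ideal K A I"

sublocale subgroup_of_finite_group_scheme \<subseteq> Q: quotient_module K A I
  by (intro quotient_module.intro algebra hopf_ideal_ideal[OF hopf_ideal])

sublocale subgroup_of_finite_group_scheme \<subseteq> AC: two_modules K A "quotient_algebra A I"
  by (intro two_modulesI module_A Q.module_C)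

context subgroup_of_finite_group_scheme
begin

abbreviation "VA \<equiv> coinvariants K A I"

definition V where "V = carrier VA"

lemma VA_simps [simp]: "carrier VA = V" "add VA = add A" "ring.zero VA = ring.zero A"
  "smult VA = smult A"
  by (simp_all add: coinvariants_def V_def)

lemma bilinear_pure_\<pi>: "bilinear K A A AC.T (\<lambda>x y. AC.pure x (Q.\<pi> y))"
  by (intro bilinearI lin_comp[OF Q.\<pi>_linear bilinear_right[OF AC.bilinear_pure]]
      bilinear_left[OF AC.bilinear_pure] Q.\<pi>_closed)

lemma V_iff: "a \<in> V \<longleftrightarrow> a \<in> carrier A \<and> sw AC.T (\<lambda>x y. AC.pure x (Q.\<pi> y)) a = AC.pure a (Q.\<pi> \<one>\<^bsub>A\<^esub>)"
  by (simp add: V_def coinvariants_def right_coaction_def tensor_map_def sw_def)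

lemma V_A: "v \<in> V \<Longrightarrow> v \<in> carrier A"
  by (simp add: V_iff)

text \<open>Coinvariance says that \<open>v\<^sub>1 \<otimes> v\<^sub>2\<close> agrees with
  \<open>v \<otimes> 1\<close> modulo \<open>A \<otimes> I\<close>. This is its form for
  calculations: a bilinear map that kills \<open>I\<close> on the right does not see the
  difference.\<close>

lemma sw_V:
  assumes P: "module K P" and B: "bilinear K A A P \<beta>"
    and z: "\<And>x y. x \<in> carrier A \<Longrightarrow> y \<in> I \<Longrightarrow> \<beta> x y = \<zero>\<^bsub>P\<^esub>" and v: "v \<in> V"
  shows "sw P \<beta> v = \<beta> v \<one>\<^bsub>A\<^esub>"
proof -
  obtain \<beta>' where \<beta>': "bilinear K A Q.C P \<beta>'"
    "\<And>x y. x \<in> carrier A \<Longrightarrow> y \<in> carrier A \<Longrightarrow> \<beta>' x (Q.\<pi> y) = \<beta> x y"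
    using Q.quotient_bilinear[OF P B z] by blast
  have vA: "v \<in> carrier A" by (rule V_A[OF v])
  have "sw P \<beta> v = sw P (\<lambda>x y. tensor_lift P \<beta>' (AC.pure x (Q.\<pi> y))) v"
    using vA by (intro sw_cong) (simp_all del: Q.C_simps add: AC.lift_pure[OF \<beta>'(1) P] Q.\<pi>_closed \<beta>'(2))
  also have "\<dots> = tensor_lift P \<beta>' (sw AC.T (\<lambda>x y. AC.pure x (Q.\<pi> y)) v)"
    using vA bilinear_closed[OF bilinear_pure_\<pi>]
    by (intro sw_push[OF AC.lift_linear[OF \<beta>'(1) P] AC.module_tensor P, symmetric])
  also have "\<dots> = \<beta> v \<one>\<^bsub>A\<^esub>"
    using v by (simp del: Q.C_simps add: V_iff AC.lift_pure[OF \<beta>'(1) P] Q.\<pi>_closed \<beta>'(2))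
  finally show ?thesis .
qed

lemma submodule_V: "submodule V K A"
proof -
  note s = sw_linear[OF bilinear_pure_\<pi> AC.module_tensor]
    and p = bilinear_left[OF AC.bilinear_pure Q.\<pi>_closed[OF A.one_closed]]
  show ?thesis
  proof (rule A.submoduleI')
    show "\<zero>\<^bsub>A\<^esub> \<in> V"
      using lin_zero[OF s module_A AC.module_tensor] lin_zero[OF p module_A AC.module_tensor]
      by (simp add: V_iff)
  qed (auto simp: V_iff lin_add[OF s] lin_add[OF p] lin_smult[OF s] lin_smult[OF p])
qed

lemma module_VA: "module K VA"
proof -
  have "VA = A\<lparr>carrier := V\<rparr>" by (simp add: coinvariants_def V_def)
  then show ?thesis using submodule.submodule_is_module[OF submodule_V module_A] by simp
qed

text \<open>Left and right translations commute. By coassociativity the right coaction of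
  \<open>\<phi>(v\<^sub>1) v\<^sub>2\<close> is
  \<open>\<phi>(v\<^sub>1) v\<^sub>2 \<otimes> v\<^sub>3\<close>, and grouping the first two legs
  lets the coinvariance of \<open>v\<close> replace \<open>v\<^sub>3\<close> by 1.\<close>

lemma contraction_V:
  assumes \<phi>: "\<phi> \<in> linear_maps K A (scalars K)" and v: "v \<in> V"
  shows "sw A (\<lambda>x y. \<phi> x \<odot>\<^bsub>A\<^esub> y) v \<in> V"
  unfolding V_iff
proof
  have vA: "v \<in> carrier A" by (rule V_A[OF v])
  have \<phi>c: "x \<in> carrier A \<Longrightarrow> \<phi> x \<in> carrier K" for x using lin_closed[OF \<phi>] by simp
  show cA: "sw A (\<lambda>x y. \<phi> x \<odot>\<^bsub>A\<^esub> y) v \<in> carrier A"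
    using vA \<phi>c by (intro sw_closed module_A) auto
  let ?\<tau> = "sw AC.T (\<lambda>x y. AC.pure x (Q.\<pi> y))"
  note s = sw_linear[OF bilinear_pure_\<pi> AC.module_tensor]
    and p = bilinear_left[OF AC.bilinear_pure Q.\<pi>_closed[OF A.one_closed]]
  have pc: "AC.pure x (Q.\<pi> y) \<in> carrier AC.T" if "x \<in> carrier A" "y \<in> carrier A" for x y
    using bilinear_closed[OF bilinear_pure_\<pi> that] .
  have sc: "?\<tau> x \<in> carrier AC.T" if "x \<in> carrier A" for x using lin_closed[OF s that] .
  have "?\<tau> (sw A (\<lambda>x y. \<phi> x \<odot>\<^bsub>A\<^esub> y) v) = sw AC.T (\<lambda>x y. ?\<tau> (\<phi> x \<odot>\<^bsub>A\<^esub> y)) v"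
    using vA \<phi>c by (intro sw_push[OF s module_A AC.module_tensor]) auto
  also have "\<dots> = sw AC.T (\<lambda>x y. sw AC.T (\<lambda>y z. \<phi> x \<odot>\<^bsub>AC.T\<^esub> AC.pure y (Q.\<pi> z)) y) v"
  proof (rule sw_cong[OF vA])
    fix x y assume xy: "x \<in> carrier A" "y \<in> carrier A"
    have "?\<tau> (\<phi> x \<odot>\<^bsub>A\<^esub> y) = \<phi> x \<odot>\<^bsub>AC.T\<^esub> ?\<tau> y" using lin_smult[OF s] xy \<phi>c by blast
    also have "\<dots> = sw AC.T (\<lambda>y z. \<phi> x \<odot>\<^bsub>AC.T\<^esub> AC.pure y (Q.\<pi> z)) y"
      using xy \<phi>c pc by (intro sw_push[OF lin_smult_const[OF AC.module_tensor lin_id]] AC.module_tensor) auto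
    finally show "?\<tau> (\<phi> x \<odot>\<^bsub>A\<^esub> y) = sw AC.T (\<lambda>y z. \<phi> x \<odot>\<^bsub>AC.T\<^esub> AC.pure y (Q.\<pi> z)) y" .
  qed
  also have "\<dots> = sw AC.T (\<lambda>x z. sw AC.T (\<lambda>x y. \<phi> x \<odot>\<^bsub>AC.T\<^esub> AC.pure y (Q.\<pi> z)) x) v"
    using vA \<phi>c pc
    by (intro sw_coassoc[symmetric] AC.module_tensor lin_smult_fun lin_smult_const \<phi>
        bilinear_left[OF bilinear_pure_\<pi>] bilinear_right[OF bilinear_pure_\<pi>]) auto
  also have "\<dots> = sw AC.T (\<lambda>x y. \<phi> x \<odot>\<^bsub>AC.T\<^esub> AC.pure y (Q.\<pi> \<one>\<^bsub>A\<^esub>)) v"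
  proof (rule sw_V[OF AC.module_tensor _ _ v])
    show "bilinear K A A AC.T (\<lambda>x z. sw AC.T (\<lambda>x y. \<phi> x \<odot>\<^bsub>AC.T\<^esub> AC.pure y (Q.\<pi> z)) x)"
      using \<phi>c pc
      by (intro lin_rules AC.module_tensor \<phi> lin_sw[OF _ _ lin_id]
        bilinear_left[OF bilinear_pure_\<pi>] bilinear_right[OF bilinear_pure_\<pi>]) auto
    fix x z assume xz: "x \<in> carrier A" "z \<in> I"
    have zA: "z \<in> carrier A" using xz Q.I.a_subset by blast
    have "Q.\<pi> z = Q.\<pi> \<zero>\<^bsub>A\<^esub>" using xz zA Q.\<pi>_eq_iff by (simp add: A.minus_zero_right)
    then have "AC.pure y (Q.\<pi> z) = \<zero>\<^bsub>AC.T\<^esub>" if "y \<in> carrier A" for y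
      using lin_zero[OF bilinear_right[OF bilinear_pure_\<pi> that] module_A AC.module_tensor] by simp
    then have "sw AC.T (\<lambda>x y. \<phi> x \<odot>\<^bsub>AC.T\<^esub> AC.pure y (Q.\<pi> z)) x = sw AC.T (\<lambda>x y. \<zero>\<^bsub>AC.T\<^esub>) x"
      using xz \<phi>c by (intro sw_cong) auto
    then show "sw AC.T (\<lambda>x y. \<phi> x \<odot>\<^bsub>AC.T\<^esub> AC.pure y (Q.\<pi> z)) x = \<zero>\<^bsub>AC.T\<^esub>"
      by (simp add: sw_def tensor_lift_tsum AC.T.tsum_zero)
  qed
  also have "\<dots> = sw AC.T (\<lambda>x y. AC.pure (\<phi> x \<odot>\<^bsub>A\<^esub> y) (Q.\<pi> \<one>\<^bsub>A\<^esub>)) v"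
    using vA \<phi>c by (intro sw_cong) (auto simp: lin_smult[OF p])
  also have "\<dots> = AC.pure (sw A (\<lambda>x y. \<phi> x \<odot>\<^bsub>A\<^esub> y) v) (Q.\<pi> \<one>\<^bsub>A\<^esub>)"
    using vA \<phi>c by (intro sw_push[OF p module_A AC.module_tensor, symmetric]) auto
  finally show "?\<tau> (sw A (\<lambda>x y. \<phi> x \<odot>\<^bsub>A\<^esub> y) v) = AC.pure (sw A (\<lambda>x y. \<phi> x \<odot>\<^bsub>A\<^esub> y) v) (Q.\<pi> \<one>\<^bsub>A\<^esub>)" .
qed

end

section \<open>The action on the coinvariants\<close>

context subgroup_of_finite_group_scheme
begin

definition "D = (SOME D. dual_system K A V D)"

lemma D: "dual_system K A V D"
proof -
  obtain D' where "dual_system K A V D'"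
    using dual_system_exists[OF field module_A finite_dim submodule_V] by blast
  then show ?thesis unfolding D_def by (rule someI)
qed

definition "DV = filter (\<lambda>(b, \<phi>). b \<in> V) D"

definition contract :: "('a \<Rightarrow> 'k) \<Rightarrow> 'a \<Rightarrow> 'a"
  where "contract \<phi> v = sw A (\<lambda>x y. \<phi> x \<odot>\<^bsub>A\<^esub> y) v"

lemmas DD = dual_systemD[OF D]

lemma lin_VA: "f \<in> linear_maps K A P \<Longrightarrow> f \<in> linear_maps K VA P"
  using V_A by (auto simp: linear_maps_def)

lemma bilinear_VA: "bilinear K M A P \<beta> \<Longrightarrow> bilinear K M VA P \<beta>"
  using V_A by (auto simp: bilinear_def intro: lin_VA)

text \<open>\<open>D\<close> is adapted to \<open>V\<close>: a functional belonging to a vector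
  outside \<open>V\<close> vanishes at \<open>v\<close>, so the filter drops zero terms
  only.\<close>

lemma tsum_DV:
  assumes v: "v \<in> V"
  shows "tsum A (\<lambda>b \<phi>. \<phi> v \<odot>\<^bsub>A\<^esub> b) DV = v"
proof -
  have "tsum A (\<lambda>b \<phi>. \<phi> v \<odot>\<^bsub>A\<^esub> b) (filter (\<lambda>(b, \<phi>). b \<in> V) xs) = tsum A (\<lambda>b \<phi>. \<phi> v \<odot>\<^bsub>A\<^esub> b) xs"
    if "set xs \<subseteq> set D" for xs
    using that
  proof (induction xs)
    case (Cons p xs)
    obtain b \<phi> where p: "p = (b, \<phi>)" by force
    have cl: "tsum A (\<lambda>b \<phi>. \<phi> v \<odot>\<^bsub>A\<^esub> b) xs \<in> carrier A"
      using Cons.prems DD V_A[OF v] by (intro A.tsum_closed) auto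
    show ?case
      using Cons DD(1,3)[of b \<phi>] p v cl by (auto simp: A.smult_l_null)
  qed simp
  then show ?thesis using dual_system_sum[OF D V_A[OF v]] by (simp add: DV_def)
qed

lemma DV: "dual_system K VA V DV"
  unfolding dual_system_def
proof (intro conjI ballI)
  fix p assume "p \<in> set DV"
  then obtain b \<phi> where "p = (b, \<phi>)" "(b, \<phi>) \<in> set D" "b \<in> V" by (auto simp: DV_def)
  then show "case p of (b, \<phi>) \<Rightarrow> b \<in> carrier VA \<and> \<phi> \<in> linear_maps K VA (scalars K) \<and> (b \<in> V \<or> (\<forall>w\<in>V. \<phi> w = \<zero>\<^bsub>K\<^esub>))"
    using DD(2) by (auto intro: lin_VA)
next
  fix a assume "a \<in> carrier VA"
  then show "tsum VA (\<lambda>b \<phi>. \<phi> a \<odot>\<^bsub>VA\<^esub> b) DV = a"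
    using tsum_DV[of a] by (simp add: tsum_def)
qed

lemma DV_D: "(b, \<phi>) \<in> set DV \<Longrightarrow> (b, \<phi>) \<in> set D \<and> b \<in> V"
  by (auto simp: DV_def)

lemma bilinear_contract:
  "\<phi> \<in> linear_maps K A (scalars K) \<Longrightarrow> bilinear K A A A (\<lambda>x y. \<phi> x \<odot>\<^bsub>A\<^esub> y)"
  using lin_closed[of \<phi> K A "scalars K"] by (intro lin_rules) auto

lemma contract_linear: "\<phi> \<in> linear_maps K A (scalars K) \<Longrightarrow> contract \<phi> \<in> linear_maps K A A"
  unfolding contract_def[abs_def] by (rule sw_linear[OF bilinear_contract module_A])

lemma contract_V: "\<phi> \<in> linear_maps K A (scalars K) \<Longrightarrow> v \<in> V \<Longrightarrow> contract \<phi> v \<in> V"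
  unfolding contract_def by (rule contraction_V)

lemma contract_linear_V:
  "\<phi> \<in> linear_maps K A (scalars K) \<Longrightarrow> contract \<phi> \<in> linear_maps K VA VA"
  using contract_linear[of \<phi>] contract_V[of \<phi>] V_A by (auto simp: linear_maps_def)

text \<open>Expanding the left leg along \<open>D\<close> writes the coproduct of \<open>a\<close>
  as the sum of the tensors \<open>b \<otimes> contract \<phi> a\<close>. For \<open>a\<close> in
  \<open>V\<close> all right legs lie in \<open>V\<close> again, which is how the coaction on
  \<open>V\<close> becomes explicit.\<close>

lemma sw_expand:
  assumes P: "module K P" and B: "bilinear K A A P \<beta>" and a: "a \<in> carrier A"
  shows "sw P \<beta> a = tsum P (\<lambda>b \<phi>. \<beta> b (contract \<phi> a)) D"
proof -
  interpret P: module K P by fact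
  have "sw P \<beta> a = sw P (\<lambda>x y. tsum P (\<lambda>b \<phi>. \<phi> x \<odot>\<^bsub>P\<^esub> \<beta> b y) D) a"
  proof (rule sw_cong[OF a])
    fix x y assume xy: "x \<in> carrier A" "y \<in> carrier A"
    have "\<beta> x y = \<beta> (tsum A (\<lambda>b \<phi>. \<phi> x \<odot>\<^bsub>A\<^esub> b) D) y" using dual_system_sum[OF D xy(1)] by simp
    also have "\<dots> = tsum P (\<lambda>b \<phi>. \<beta> (\<phi> x \<odot>\<^bsub>A\<^esub> b) y) D"
      using DD xy by (intro lin_tsum[OF bilinear_left[OF B xy(2)] module_A P]) auto
    also have "\<dots> = tsum P (\<lambda>b \<phi>. \<phi> x \<odot>\<^bsub>P\<^esub> \<beta> b y) D"
      using DD xy by (intro tsum_cong lin_smult[OF bilinear_left[OF B xy(2)]]) auto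
    finally show "\<beta> x y = tsum P (\<lambda>b \<phi>. \<phi> x \<odot>\<^bsub>P\<^esub> \<beta> b y) D" .
  qed
  also have "\<dots> = tsum P (\<lambda>b \<phi>. sw P (\<lambda>x y. \<phi> x \<odot>\<^bsub>P\<^esub> \<beta> b y) a) D"
    using DD bilinear_closed[OF B] by (intro sw_tsum_swap P a) auto
  also have "\<dots> = tsum P (\<lambda>b \<phi>. \<beta> b (contract \<phi> a)) D"
  proof (rule tsum_cong)
    fix b \<phi> assume "(b, \<phi>) \<in> set D"
    note d = DD[OF this]
    have "\<beta> b (contract \<phi> a) = sw P (\<lambda>x y. \<beta> b (\<phi> x \<odot>\<^bsub>A\<^esub> y)) a"
      unfolding contract_def using d by (intro sw_push[OF bilinear_right[OF B d(1)] module_A P a]) auto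
    also have "\<dots> = sw P (\<lambda>x y. \<phi> x \<odot>\<^bsub>P\<^esub> \<beta> b y) a"
      using d by (intro sw_cong a lin_smult[OF bilinear_right[OF B d(1)]]) auto
    finally show "sw P (\<lambda>x y. \<phi> x \<odot>\<^bsub>P\<^esub> \<beta> b y) a = \<beta> b (contract \<phi> a)" by simp
  qed
  finally show ?thesis .
qed

text \<open>\<open>\<Delta>(V) \<subseteq> A \<otimes> V\<close>.\<close>

lemma sw_cong_V:
  assumes P: "module K P" and "bilinear K A A P \<beta>" "bilinear K A A P \<beta>'" and v: "v \<in> V"
    and "\<And>x w. x \<in> carrier A \<Longrightarrow> w \<in> V \<Longrightarrow> \<beta> x w = \<beta>' x w"
  shows "sw P \<beta> v = sw P \<beta>' v"
  unfolding sw_expand[OF P assms(2) V_A[OF v]] sw_expand[OF P assms(3) V_A[OF v]]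
  using DD assms(5) contract_V[OF _ v] by (intro tsum_cong) blast

lemma two_modules_V: "module K M \<Longrightarrow> two_modules K M VA"
  by (rule two_modulesI[OF _ module_VA])

text \<open>The definite description presupposes that
  \<open>A \<otimes> V \<rightarrow> A \<otimes> A\<close> is injective. This holds because the
  functionals in \<open>DV\<close> are defined on all of \<open>A\<close>, so the coordinates of a
  tensor can be read off from its image.\<close>

lemma left_coaction_eq:
  assumes v: "v \<in> V"
  shows "left_coaction K A I v = tsum (tensor K A VA) (\<lambda>b \<phi>. pure_tensor K A VA b (contract \<phi> v)) D"
proof -
  interpret AV: two_modules K A VA by (rule two_modules_V[OF module_A])
  let ?U = "tsum AV.T (\<lambda>b \<phi>. AV.pure b (contract \<phi> v)) D"
  let ?\<iota> = "tensor_map K A A id id :: ('a \<times> 'a) list set \<Rightarrow> _"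
  have b\<iota>: "bilinear K A VA AA.T (\<lambda>m n. AA.pure (id m) (id n))"
    using bilinear_VA[OF AA.bilinear_pure] by simp
  have \<iota>: "?\<iota> \<in> linear_maps K AV.T AA.T"
    unfolding tensor_map_def by (rule AV.lift_linear[OF b\<iota> AA.module_tensor])
  have pc: "AV.pure b (contract \<phi> v) \<in> carrier AV.T" if "(b, \<phi>) \<in> set D" for b \<phi>
    using DD[OF that] contract_V[OF _ v] by (intro AV.pure_closed) auto
  have U: "?U \<in> carrier AV.T" using pc by (intro AV.T.tsum_closed) auto
  have "?\<iota> ?U = tsum AA.T (\<lambda>b \<phi>. ?\<iota> (AV.pure b (contract \<phi> v))) D"
    using pc by (intro lin_tsum[OF \<iota> AV.module_tensor AA.module_tensor])
  also have "\<dots> = tsum AA.T (\<lambda>b \<phi>. AA.pure b (contract \<phi> v)) D"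
  proof (rule tsum_cong)
    fix b \<phi> assume b: "(b, \<phi>) \<in> set D"
    then show "?\<iota> (AV.pure b (contract \<phi> v)) = AA.pure b (contract \<phi> v)"
      using AV.lift_pure[OF b\<iota> AA.module_tensor, of b "contract \<phi> v"] DD(1,2)[OF b] contract_V[OF _ v]
      by (simp add: tensor_map_def)
  qed
  also have "\<dots> = sw AA.T AA.pure v"
    by (rule sw_expand[OF AA.module_tensor AA.bilinear_pure V_A[OF v], symmetric])
  also have "\<dots> = comult A v"
    using comult_closed[OF V_A[OF v]] by (simp add: sw_def AA.lift_pure_id)
  finally have \<iota>U: "?\<iota> ?U = comult A v" .
  show ?thesis
    unfolding left_coaction_def
  proof (rule the_equality)
    show "?U \<in> carrier AV.T \<and> ?\<iota> ?U = comult A v" using U \<iota>U by simp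
    fix W assume W: "W \<in> carrier AV.T \<and> ?\<iota> W = comult A v"
    show "W = ?U"
    proof (rule AV.tensor_eqI[OF DV])
      fix b \<phi> assume b: "(b, \<phi>) \<in> set DV"
      then have \<phi>: "\<phi> \<in> linear_maps K A (scalars K)" "\<And>a. a \<in> carrier A \<Longrightarrow> \<phi> a \<in> carrier K"
        using DV_D DD by blast+
      have B: "bilinear K A A A (\<lambda>m n. \<phi> n \<odot>\<^bsub>A\<^esub> m)"
        using \<phi> by (intro lin_rules) auto
      \<comment> \<open>The contraction with \<phi> factors through the map into
        \<open>A \<otimes> A\<close>, where both candidates become the coproduct of
        \<open>v\<close>.\<close>
      have *: "tensor_lift A (\<lambda>m n. \<phi> n \<odot>\<^bsub>A\<^esub> m) X = tensor_lift A (\<lambda>m n. \<phi> n \<odot>\<^bsub>A\<^esub> m) (?\<iota> X)"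
        if "X \<in> carrier AV.T" for X
      proof -
        have "tensor_lift A (\<lambda>m n. \<phi> n \<odot>\<^bsub>A\<^esub> m) (?\<iota> X) =
            tensor_lift A (\<lambda>m n. tensor_lift A (\<lambda>m n. \<phi> n \<odot>\<^bsub>A\<^esub> m) (AA.pure (id m) (id n))) X"
          unfolding tensor_map_def using bilinear_closed[OF b\<iota>]
          by (intro AV.lift_comp[OF AA.lift_linear[OF B module_A] AA.module_tensor module_A _ that])
        also have "\<dots> = tensor_lift A (\<lambda>m n. \<phi> n \<odot>\<^bsub>A\<^esub> m) X"
          by (intro AV.lift_cong that) (auto simp: AA.lift_pure[OF B module_A] V_A)
        finally show ?thesis by simp
      qed
      show "tensor_lift A (\<lambda>m n. \<phi> n \<odot>\<^bsub>A\<^esub> m) W = tensor_lift A (\<lambda>m n. \<phi> n \<odot>\<^bsub>A\<^esub> m) ?U"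
        using *[of W] *[OF U] W \<iota>U by simp
    qed (use W U in auto)
  qed
qed

text \<open>Triviality of the action, tested on matrix coefficients instead of in
  \<open>R \<otimes> V\<close>. The condition makes sense for every function \<open>g\<close>, and
  letting \<psi> range over functionals of \<open>A\<close> ties it directly to Sweedler
  sums.\<close>

definition acts_trivially :: "('k, 'r) module \<Rightarrow> ('a \<Rightarrow> 'r) \<Rightarrow> bool"
  where "acts_trivially R g \<longleftrightarrow> (\<forall>v\<in>V. \<forall>\<psi>\<in>linear_maps K A (scalars K).
    sw R (\<lambda>x y. \<psi> y \<odot>\<^bsub>R\<^esub> g x) v = \<psi> v \<odot>\<^bsub>R\<^esub> \<one>\<^bsub>R\<^esub>)"

text \<open>A lift sees only addition and zero of its target, and in these the two records
  agree.\<close>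

lemma tensor_lift_base_change: "tensor_lift (base_change K R VA) \<beta> U = tensor_lift (tensor K R VA) \<beta> U"
  by (simp add: tensor_lift_def base_change_def)

lemma translate_trivial_iff:
  fixes R :: "('k, 'r) module"
  assumes R: "algebra K R" and g: "g \<in> linear_maps K A R"
  shows "translate K A I R g = (\<lambda>U\<in>carrier (base_change K R VA). U) \<longleftrightarrow> acts_trivially R g"
proof -
  interpret R: algebra K R by fact
  have mR: "module K R" by (rule R.module_axioms)
  interpret AV: two_modules K A VA by (rule two_modules_V[OF module_A])
  interpret RV: two_modules K R VA by (rule two_modules_V[OF mR])
  have gc: "a \<in> carrier A \<Longrightarrow> g a \<in> carrier R" for a by (rule lin_closed[OF g])
  \<comment> \<open>The value of the translation at a pure tensor, with the left coaction expanded
    along \<open>D\<close>.\<close>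
  define \<beta> where "\<beta> r v = tsum RV.T (\<lambda>b \<phi>. RV.pure (r \<otimes>\<^bsub>R\<^esub> g b) (contract \<phi> v)) D" for r v
  have b\<beta>: "bilinear K R VA RV.T \<beta>"
    unfolding \<beta>_def
    using DD(1,2) gc contract_V
    by (intro bilinearI lin_tsum_fun RV.module_tensor
        lin_comp[OF contract_linear_V bilinear_right[OF RV.bilinear_pure]]
        lin_comp[OF lin_mult_right[OF R lin_id] bilinear_left[OF RV.bilinear_pure]]) auto
  have inner: "tensor_lift RV.T (\<lambda>a w. RV.pure (r \<otimes>\<^bsub>R\<^esub> g a) w) (left_coaction K A I v) = \<beta> r v"
    if r: "r \<in> carrier R" and v: "v \<in> V" for r v
  proof -
    have B: "bilinear K A VA RV.T (\<lambda>a w. RV.pure (r \<otimes>\<^bsub>R\<^esub> g a) w)"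
      using r gc by (intro bilinearI bilinear_right[OF RV.bilinear_pure]
          lin_comp[OF lin_mult_left[OF R g] bilinear_left[OF RV.bilinear_pure]]) auto
    show ?thesis
      unfolding left_coaction_eq[OF v] \<beta>_def
      using DD(1,2) contract_V[OF _ v]
      by (subst lin_tsum[OF AV.lift_linear[OF B RV.module_tensor] AV.module_tensor RV.module_tensor])
        (auto intro!: AV.pure_closed tsum_cong AV.lift_pure[OF B RV.module_tensor])
  qed
  have tr: "translate K A I R g = (\<lambda>U\<in>carrier RV.T. tensor_lift RV.T \<beta> U)"
  proof -
    have "carrier (base_change K R VA) = carrier RV.T" by (simp add: base_change_def)
    then show ?thesis
      unfolding translate_def Let_def tensor_lift_base_change
      by (simp only:) (intro restrict_ext RV.lift_cong; simp add: inner)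
  qed
  \<comment> \<open>Contracting the translated vector with \<psi> produces exactly the matrix
    coefficient in \<open>acts_trivially\<close>, multiplied by \<open>r\<close>.\<close>
  have \<psi>lift: "tensor_lift R (\<lambda>m n. \<psi> n \<odot>\<^bsub>R\<^esub> m) (\<beta> r v) = r \<otimes>\<^bsub>R\<^esub> sw R (\<lambda>x y. \<psi> y \<odot>\<^bsub>R\<^esub> g x) v"
    if \<psi>: "\<psi> \<in> linear_maps K A (scalars K)" and r: "r \<in> carrier R" and v: "v \<in> V" for \<psi> r v
  proof -
    have \<psi>c: "a \<in> carrier A \<Longrightarrow> \<psi> a \<in> carrier K" for a using lin_closed[OF \<psi>] by simp
    have B\<psi>: "bilinear K R VA R (\<lambda>m n. \<psi> n \<odot>\<^bsub>R\<^esub> m)"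
      using \<psi>c V_A by (intro bilinearI lin_smult_fun lin_smult_const lin_id mR lin_VA[OF \<psi>]) auto
    have Bg: "bilinear K A A R (\<lambda>x y. \<psi> y \<odot>\<^bsub>R\<^esub> g x)"
      using \<psi>c gc by (intro lin_rules \<psi> mR g) auto
    have "tensor_lift R (\<lambda>m n. \<psi> n \<odot>\<^bsub>R\<^esub> m) (\<beta> r v) =
        tsum R (\<lambda>b \<phi>. tensor_lift R (\<lambda>m n. \<psi> n \<odot>\<^bsub>R\<^esub> m) (RV.pure (r \<otimes>\<^bsub>R\<^esub> g b) (contract \<phi> v))) D"
      unfolding \<beta>_def using DD(1,2) contract_V[OF _ v] r gc
      by (intro lin_tsum[OF RV.lift_linear[OF B\<psi> mR] RV.module_tensor mR] RV.pure_closed) auto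
    also have "\<dots> = tsum R (\<lambda>b \<phi>. r \<otimes>\<^bsub>R\<^esub> (\<psi> (contract \<phi> v) \<odot>\<^bsub>R\<^esub> g b)) D"
      using DD(1,2) contract_V[OF _ v] r gc \<psi>c V_A
      by (intro tsum_cong) (simp add: RV.lift_pure[OF B\<psi> mR] R.smult_assoc2_right)
    also have "\<dots> = r \<otimes>\<^bsub>R\<^esub> tsum R (\<lambda>b \<phi>. \<psi> (contract \<phi> v) \<odot>\<^bsub>R\<^esub> g b) D"
      using DD(1,2) contract_V[OF _ v] r gc \<psi>c V_A
      by (intro lin_tsum[OF lin_mult_left[OF R lin_id r] mR mR, symmetric]) auto
    finally show ?thesis by (simp add: sw_expand[OF mR Bg V_A[OF v]])
  qed
  have \<psi>pure: "tensor_lift R (\<lambda>m n. \<psi> n \<odot>\<^bsub>R\<^esub> m) (RV.pure r v) = \<psi> v \<odot>\<^bsub>R\<^esub> r"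
    if \<psi>: "\<psi> \<in> linear_maps K A (scalars K)" and r: "r \<in> carrier R" and v: "v \<in> V" for \<psi> r v
  proof -
    have \<psi>c: "a \<in> carrier A \<Longrightarrow> \<psi> a \<in> carrier K" for a using lin_closed[OF \<psi>] by simp
    have B\<psi>: "bilinear K R VA R (\<lambda>m n. \<psi> n \<odot>\<^bsub>R\<^esub> m)"
      using \<psi>c V_A by (intro bilinearI lin_smult_fun lin_smult_const lin_id mR lin_VA[OF \<psi>]) auto
    show ?thesis using r v by (simp add: RV.lift_pure[OF B\<psi> mR])
  qed
  have swc: "sw R (\<lambda>x y. \<psi> y \<odot>\<^bsub>R\<^esub> g x) v \<in> carrier R"
    if \<psi>: "\<psi> \<in> linear_maps K A (scalars K)" and v: "v \<in> V" for \<psi> v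
    using lin_closed[OF \<psi>] gc V_A[OF v] by (intro sw_closed mR) auto
  show ?thesis
  proof
    assume L: "translate K A I R g = (\<lambda>U\<in>carrier (base_change K R VA). U)"
    show "acts_trivially R g"
      unfolding acts_trivially_def
    proof (intro ballI)
      fix v \<psi> assume v: "v \<in> V" and \<psi>: "\<psi> \<in> linear_maps K A (scalars K)"
      have p: "RV.pure \<one>\<^bsub>R\<^esub> v \<in> carrier RV.T" using v by (simp add: RV.pure_closed)
      have "translate K A I R g (RV.pure \<one>\<^bsub>R\<^esub> v) = RV.pure \<one>\<^bsub>R\<^esub> v"
        using p unfolding L by (simp add: base_change_def)
      then have "\<beta> \<one>\<^bsub>R\<^esub> v = RV.pure \<one>\<^bsub>R\<^esub> v"
        using p v by (simp add: tr RV.lift_pure[OF b\<beta> RV.module_tensor])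
      then show "sw R (\<lambda>x y. \<psi> y \<odot>\<^bsub>R\<^esub> g x) v = \<psi> v \<odot>\<^bsub>R\<^esub> \<one>\<^bsub>R\<^esub>"
        using \<psi>lift[OF \<psi> R.one_closed v] \<psi>pure[OF \<psi> R.one_closed v] swc[OF \<psi> v] by simp
    qed
  next
    assume T: "acts_trivially R g"
    \<comment> \<open>The functionals in \<open>DV\<close> come from \<open>D\<close>, so they are
      among those tested by \<open>acts_trivially\<close>, and they separate the elements of
      \<open>R \<otimes> V\<close>.\<close>
    have *: "\<beta> r v = RV.pure r v" if r: "r \<in> carrier R" and v: "v \<in> V" for r v
    proof (rule RV.tensor_eqI[OF DV])
      show "\<beta> r v \<in> carrier RV.T" using bilinear_closed[OF b\<beta> r] v by simp
      show "RV.pure r v \<in> carrier RV.T" using r v by (simp add: RV.pure_closed)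
      fix b \<phi> assume "(b, \<phi>) \<in> set DV"
      then have \<phi>: "\<phi> \<in> linear_maps K A (scalars K)" "\<phi> v \<in> carrier K"
        using DV_D DD V_A[OF v] by blast+
      then have "sw R (\<lambda>x y. \<phi> y \<odot>\<^bsub>R\<^esub> g x) v = \<phi> v \<odot>\<^bsub>R\<^esub> \<one>\<^bsub>R\<^esub>"
        using T v unfolding acts_trivially_def by blast
      then show "tensor_lift R (\<lambda>m n. \<phi> n \<odot>\<^bsub>R\<^esub> m) (\<beta> r v) = tensor_lift R (\<lambda>m n. \<phi> n \<odot>\<^bsub>R\<^esub> m) (RV.pure r v)"
        using r \<phi> by (simp add: \<psi>lift[OF \<phi>(1) r v] \<psi>pure[OF \<phi>(1) r v] R.smult_assoc2_right)
    qed
    have "tensor_lift RV.T \<beta> U = U" if "U \<in> carrier RV.T" for U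
    proof -
      have "tensor_lift RV.T \<beta> U = tensor_lift RV.T RV.pure U"
        using * by (intro RV.lift_cong that) simp
      then show ?thesis using RV.lift_pure_id[OF that] by simp
    qed
    then show "translate K A I R g = (\<lambda>U\<in>carrier (base_change K R VA). U)"
      unfolding tr by (auto simp: base_change_def intro!: restrict_ext)
  qed
qed

lemma core_iff:
  fixes R :: "('k, 'r) module"
  assumes R: "algebra K R"
  shows "g \<in> core K A I R \<longleftrightarrow> g \<in> carrier (points K A R) \<and> acts_trivially R (inv\<^bsub>points K A R\<^esub> g)"
proof -
  have "\<one>\<^bsub>general_linear K VA R\<^esub> = (\<lambda>U\<in>carrier (base_change K R VA). U)"
    by (simp add: general_linear_def BijGroup_def Let_def)
  moreover have "inv\<^bsub>points K A R\<^esub> g \<in> linear_maps K A R" if "g \<in> carrier (points K A R)"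
    using group.inv_closed[OF group_points[OF R] that] pointsD(1) by blast
  ultimately show ?thesis
    using translate_trivial_iff[OF R] by (auto simp: core_def kernel_def mu_def)
qed

end

section \<open>The core is a normal subgroup-scheme\<close>

lemma (in cring) idealI_cring:
  assumes "W \<subseteq> carrier R" "\<zero> \<in> W" "\<And>x y. x \<in> W \<Longrightarrow> y \<in> W \<Longrightarrow> x \<oplus> y \<in> W"
    and m: "\<And>a x. a \<in> carrier R \<Longrightarrow> x \<in> W \<Longrightarrow> a \<otimes> x \<in> W"
  shows "ideal W R"
proof (rule idealI[OF ring_axioms])
  show "subgroup W (add_monoid R)"
  proof (rule add.subgroupI)
    fix x assume x: "x \<in> W"
    then have "\<ominus> x = (\<ominus> \<one>) \<otimes> x" using assms(1) by (auto simp: l_minus)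
    then show "\<ominus> x \<in> W" using m[of "\<ominus> \<one>" x] x by simp
  qed (use assms in auto)
  fix a x assume *: "a \<in> W" "x \<in> carrier R"
  then show "x \<otimes> a \<in> W" using m by blast
  then show "a \<otimes> x \<in> W" using m_comm[of a x] * assms(1) by auto
qed

lemma ideal_zeros:
  assumes "algebra K A" "algebra K R" "g \<in> algebra_homs K A R"
  shows "ideal {a \<in> carrier A. g a = \<zero>\<^bsub>R\<^esub>} A"
proof -
  interpret A: algebra K A by fact
  interpret R: algebra K R by fact
  have g: "g \<in> linear_maps K A R" "g \<in> ring_hom A R" using assms(3) by (auto simp: algebra_homs_def)
  show ?thesis
    by (rule A.idealI_cring)
      (auto simp: lin_zero[OF g(1) A.module_axioms R.module_axioms] lin_add[OF g(1)] lin_closed[OF g(1)]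
        ring_hom_mult[OF g(2)])
qed

context quotient_module
begin

lemma algebra_C: "algebra K C"
proof (rule algebraI)
  interpret Q: cring "A Quot I" by (rule I.quotient_is_cring[OF A.M_cring])
  interpret C: module K C by (rule module_C)
  have ops: "monoid.mult C = monoid.mult (A Quot I)" "one C = one (A Quot I)"
    by (simp_all add: quotient_algebra_def)
  show "cring C"
    by (intro cringI comm_monoidI C.abelian_group_axioms; unfold C_simps ops;
        (rule Q.m_closed Q.one_closed Q.m_assoc Q.l_one Q.m_comm Q.l_distr; assumption)?)
      (rule Q.one_closed)?
  fix r x y assume r: "r \<in> carrier K" and "x \<in> carrier C" "y \<in> carrier C"
  then obtain a b where ab: "a \<in> carrier A" "x = \<pi> a" "b \<in> carrier A" "y = \<pi> b" unfolding carrier_C by blast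
  have "\<pi> a \<otimes>\<^bsub>C\<^esub> \<pi> b = \<pi> (a \<otimes>\<^bsub>A\<^esub> b)" if "a \<in> carrier A" "b \<in> carrier A" for a b
    using that ring_hom_mult[OF I.rcos_ring_hom, of a b] by (simp add: ops)
  then show "(r \<odot>\<^bsub>C\<^esub> x) \<otimes>\<^bsub>C\<^esub> y = r \<odot>\<^bsub>C\<^esub> (x \<otimes>\<^bsub>C\<^esub> y)"
    using r ab by (simp del: C_simps add: \<pi>_smult A.smult_assoc2)
qed (use module_C in \<open>auto simp: module_def module_axioms_def\<close>)

lemma \<pi>_hom: "\<pi> \<in> algebra_homs K A C"
proof -
  have "monoid.mult C = monoid.mult (A Quot I)" "one C = one (A Quot I)"
    by (simp_all add: quotient_algebra_def)
  then have "\<pi> \<in> ring_hom A C" using I.rcos_ring_hom by (auto simp: ring_hom_def)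
  then show ?thesis using \<pi>_linear by (simp add: algebra_homs_def)
qed

lemma \<pi>_zero_iff: "x \<in> carrier A \<Longrightarrow> \<pi> x = \<zero>\<^bsub>C\<^esub> \<longleftrightarrow> x \<in> I"
  using \<pi>_eq_iff[of x "\<zero>\<^bsub>A\<^esub>"] lin_zero[OF \<pi>_linear A.module_axioms module_C]
  by (simp add: A.minus_zero_right)

end

section \<open>Convolution of linear maps\<close>

context finite_group_scheme
begin

text \<open>The formula of the product of points without the restriction to the carrier. Its
  arguments may be arbitrary linear maps, since the test maps in the characterisation of trivial
  action are not multiplicative.\<close>

definition conv :: "('k, 'r) module \<Rightarrow> ('a \<Rightarrow> 'r) \<Rightarrow> ('a \<Rightarrow> 'r) \<Rightarrow> 'a \<Rightarrow> 'r"
  where "conv R p q = sw R (\<lambda>x y. p x \<otimes>\<^bsub>R\<^esub> q y)"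

context
  fixes R :: "('k, 'r) module"
  assumes R: "algebra K R"
begin

interpretation R: algebra K R by (rule R)

lemma conv_linear: "p \<in> linear_maps K A R \<Longrightarrow> q \<in> linear_maps K A R \<Longrightarrow> conv R p q \<in> linear_maps K A R"
  unfolding conv_def by (rule sw_linear[OF bilinear_points[OF R] module_R[OF R]])

lemma conv_cong:
  "a \<in> carrier A \<Longrightarrow> (\<And>x. x \<in> carrier A \<Longrightarrow> p x = p' x) \<Longrightarrow> (\<And>x. x \<in> carrier A \<Longrightarrow> q x = q' x) \<Longrightarrow>
    conv R p q a = conv R p' q' a"
  unfolding conv_def by (intro sw_cong) simp_all

lemma conv_assoc:
  assumes p: "p \<in> linear_maps K A R" and q: "q \<in> linear_maps K A R" and s: "s \<in> linear_maps K A R"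
    and a: "a \<in> carrier A"
  shows "conv R (conv R p q) s a = conv R p (conv R q s) a"
proof -
  note cl = lin_closed[OF p] lin_closed[OF q] lin_closed[OF s]
  have "conv R (conv R p q) s a = sw R (\<lambda>x z. sw R (\<lambda>x y. (p x \<otimes>\<^bsub>R\<^esub> q y) \<otimes>\<^bsub>R\<^esub> s z) x) a"
    unfolding conv_def using a
    by (intro sw_cong sw_push[OF lin_mult_right[OF R lin_id] module_R[OF R] module_R[OF R]]) (auto simp: cl)
  also have "\<dots> = sw R (\<lambda>x y. sw R (\<lambda>y z. (p x \<otimes>\<^bsub>R\<^esub> q y) \<otimes>\<^bsub>R\<^esub> s z) y) a"
    using a by (intro sw_coassoc lin_rules module_R R p q s) (auto simp: cl)
  also have "\<dots> = sw R (\<lambda>x y. sw R (\<lambda>y z. p x \<otimes>\<^bsub>R\<^esub> (q y \<otimes>\<^bsub>R\<^esub> s z)) y) a"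
    using a by (intro sw_cong) (auto simp: cl R.m_assoc)
  also have "\<dots> = conv R p (conv R q s) a"
    unfolding conv_def using a
    by (intro sw_cong sw_push[OF lin_mult_left[OF R lin_id] module_R[OF R] module_R[OF R], symmetric]) (auto simp: cl)
  finally show ?thesis .
qed

lemma conv_unit:
  assumes "h \<in> linear_maps K A R" "a \<in> carrier A"
  shows "conv R (\<lambda>a. counit A a \<odot>\<^bsub>R\<^esub> \<one>\<^bsub>R\<^esub>) h a = h a"
proof -
  have "conv R (\<lambda>a. counit A a \<odot>\<^bsub>R\<^esub> \<one>\<^bsub>R\<^esub>) h a = sw R (\<lambda>x y. counit A x \<odot>\<^bsub>R\<^esub> h y) a"
    unfolding conv_def using assms lin_closed[OF assms(1)]
    by (intro sw_cong) (auto simp: counit_closed R.smult_assoc2)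
  then show ?thesis using sw_counit_left[OF module_R[OF R] assms(2,1)] by simp
qed

lemma conv_antipode:
  assumes "g \<in> algebra_homs K A R" "a \<in> carrier A"
  shows "conv R (\<lambda>x. g (antipode A x)) g a = counit A a \<odot>\<^bsub>R\<^esub> \<one>\<^bsub>R\<^esub>"
proof -
  have g: "g \<in> linear_maps K A R" "g \<in> ring_hom A R" using assms(1) by (auto simp: algebra_homs_def)
  have "conv R (\<lambda>x. g (antipode A x)) g a = sw R (\<lambda>x y. g (antipode A x \<otimes>\<^bsub>A\<^esub> y)) a"
    unfolding conv_def using assms(2)
    by (intro sw_cong) (auto simp: ring_hom_mult[OF g(2)] antipode_closed)
  then show ?thesis using sw_antipode_left[OF module_R[OF R] assms(2) g(1)] ring_hom_one[OF g(2)] by simp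
qed

lemma antipode_hom: "g \<in> algebra_homs K A R \<Longrightarrow> (\<lambda>x. g (antipode A x)) \<in> algebra_homs K A R"
  by (auto simp: algebra_homs_def ring_hom_mult ring_hom_closed ring_hom_one antipode_mult antipode_closed
      antipode_one ring_hom_add lin_add[OF antipode] intro!: ring_hom_memI lin_comp[OF antipode])

end

lemma sw_add_fun:
  assumes "module K P" "a \<in> carrier A"
    and "\<And>x y. x \<in> carrier A \<Longrightarrow> y \<in> carrier A \<Longrightarrow> \<beta> x y \<in> carrier P"
    and "\<And>x y. x \<in> carrier A \<Longrightarrow> y \<in> carrier A \<Longrightarrow> \<gamma> x y \<in> carrier P"
  shows "sw P (\<lambda>x y. \<beta> x y \<oplus>\<^bsub>P\<^esub> \<gamma> x y) a = sw P \<beta> a \<oplus>\<^bsub>P\<^esub> sw P \<gamma> a"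
proof -
  interpret P: module K P by fact
  show ?thesis
    unfolding sw_def tensor_lift_tsum
    using AA.tensor_rep_lists[OF comult_closed[OF assms(2)]] assms(3,4)
    by (intro P.tsum_add) blast+
qed

lemma points_homs: "g \<in> carrier (points K A R) \<Longrightarrow> g \<in> algebra_homs K A R"
  by (simp add: points_def)

end

context subgroup_of_finite_group_scheme
begin

text \<open>Acting trivially on \<open>A\<^sup>H\<close> means that convolution with \<open>g\<close> fixes the restrictions to \<open>A\<^sup>H\<close>
  of all linear maps; in this form the trivially acting points visibly form a normal subgroup.\<close>

lemma acts_trivially_iff_conv:
  assumes R: "algebra K R" and g: "g \<in> linear_maps K A R"
  shows "acts_trivially R g \<longleftrightarrow> (\<forall>v\<in>V. \<forall>h\<in>linear_maps K A R. conv R g h v = h v)"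
proof -
  interpret R: algebra K R by fact
  note mR = module_R[OF R]
  have gc: "a \<in> carrier A \<Longrightarrow> g a \<in> carrier R" for a by (rule lin_closed[OF g])
  show ?thesis
  proof
    assume T: "acts_trivially R g"
    show "\<forall>v\<in>V. \<forall>h\<in>linear_maps K A R. conv R g h v = h v"
    proof (intro ballI)
      fix v h assume v: "v \<in> V" and h: "h \<in> linear_maps K A R"
      have vA: "v \<in> carrier A" by (rule V_A[OF v])
      have hc: "a \<in> carrier A \<Longrightarrow> h a \<in> carrier R" for a by (rule lin_closed[OF h])
      have h_exp: "h a = tsum R (\<lambda>b \<phi>. \<phi> a \<odot>\<^bsub>R\<^esub> h b) D" if a: "a \<in> carrier A" for a
      proof -
        have "h a = h (tsum A (\<lambda>b \<phi>. \<phi> a \<odot>\<^bsub>A\<^esub> b) D)" using dual_system_sum[OF D a] by simp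
        also have "\<dots> = tsum R (\<lambda>b \<phi>. h (\<phi> a \<odot>\<^bsub>A\<^esub> b)) D"
          using DD a by (intro lin_tsum[OF h module_A mR]) auto
        also have "\<dots> = tsum R (\<lambda>b \<phi>. \<phi> a \<odot>\<^bsub>R\<^esub> h b) D"
          using DD a by (intro tsum_cong lin_smult[OF h]) auto
        finally show ?thesis .
      qed
      have "conv R g h v = sw R (\<lambda>x y. tsum R (\<lambda>b \<phi>. (\<phi> y \<odot>\<^bsub>R\<^esub> g x) \<otimes>\<^bsub>R\<^esub> h b) D) v"
        unfolding conv_def
      proof (rule sw_cong[OF vA])
        fix x y assume xy: "x \<in> carrier A" "y \<in> carrier A"
        have "g x \<otimes>\<^bsub>R\<^esub> h y = g x \<otimes>\<^bsub>R\<^esub> tsum R (\<lambda>b \<phi>. \<phi> y \<odot>\<^bsub>R\<^esub> h b) D" using h_exp[OF xy(2)] by simp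
        also have "\<dots> = tsum R (\<lambda>b \<phi>. g x \<otimes>\<^bsub>R\<^esub> (\<phi> y \<odot>\<^bsub>R\<^esub> h b)) D"
          using DD xy gc hc by (intro lin_tsum[OF lin_mult_left[OF R lin_id] mR mR]) auto
        also have "\<dots> = tsum R (\<lambda>b \<phi>. (\<phi> y \<odot>\<^bsub>R\<^esub> g x) \<otimes>\<^bsub>R\<^esub> h b) D"
          using DD xy gc hc by (intro tsum_cong) (simp add: R.smult_assoc2 R.smult_assoc2_right)
        finally show "g x \<otimes>\<^bsub>R\<^esub> h y = tsum R (\<lambda>b \<phi>. (\<phi> y \<odot>\<^bsub>R\<^esub> g x) \<otimes>\<^bsub>R\<^esub> h b) D" .
      qed
      also have "\<dots> = tsum R (\<lambda>b \<phi>. sw R (\<lambda>x y. (\<phi> y \<odot>\<^bsub>R\<^esub> g x) \<otimes>\<^bsub>R\<^esub> h b) v) D"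
        using DD gc hc by (intro sw_tsum_swap mR vA) auto
      also have "\<dots> = tsum R (\<lambda>b \<phi>. \<phi> v \<odot>\<^bsub>R\<^esub> h b) D"
      proof (rule tsum_cong)
        fix b \<phi> assume "(b, \<phi>) \<in> set D"
        note d = DD[OF this]
        have "sw R (\<lambda>x y. (\<phi> y \<odot>\<^bsub>R\<^esub> g x) \<otimes>\<^bsub>R\<^esub> h b) v = sw R (\<lambda>x y. \<phi> y \<odot>\<^bsub>R\<^esub> g x) v \<otimes>\<^bsub>R\<^esub> h b"
          using d gc hc vA by (intro sw_push[OF lin_mult_right[OF R lin_id] mR mR, symmetric]) auto
        also have "\<dots> = (\<phi> v \<odot>\<^bsub>R\<^esub> \<one>\<^bsub>R\<^esub>) \<otimes>\<^bsub>R\<^esub> h b" using T v d(2) by (simp add: acts_trivially_def)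
        finally show "sw R (\<lambda>x y. (\<phi> y \<odot>\<^bsub>R\<^esub> g x) \<otimes>\<^bsub>R\<^esub> h b) v = \<phi> v \<odot>\<^bsub>R\<^esub> h b"
          using d hc vA by (simp add: R.smult_assoc2)
      qed
      finally show "conv R g h v = h v" using h_exp[OF vA] by simp
    qed
  next
    assume T: "\<forall>v\<in>V. \<forall>h\<in>linear_maps K A R. conv R g h v = h v"
    show "acts_trivially R g"
      unfolding acts_trivially_def
    proof (intro ballI)
      fix v \<psi> assume v: "v \<in> V" and \<psi>: "\<psi> \<in> linear_maps K A (scalars K)"
      have \<psi>c: "a \<in> carrier A \<Longrightarrow> \<psi> a \<in> carrier K" for a using lin_closed[OF \<psi>] by simp
      have "conv R g (\<lambda>a. \<psi> a \<odot>\<^bsub>R\<^esub> \<one>\<^bsub>R\<^esub>) v = sw R (\<lambda>x y. \<psi> y \<odot>\<^bsub>R\<^esub> g x) v"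
        unfolding conv_def using V_A[OF v] \<psi>c gc
        by (intro sw_cong) (auto simp: R.smult_assoc2_right)
      then show "sw R (\<lambda>x y. \<psi> y \<odot>\<^bsub>R\<^esub> g x) v = \<psi> v \<odot>\<^bsub>R\<^esub> \<one>\<^bsub>R\<^esub>"
        using T v lin_smult_fun[OF mR \<psi> R.one_closed] by auto
    qed
  qed
qed

text \<open>The coproduct sends \<open>V\<close> into \<open>A \<otimes> V\<close>, so the right
  factor is evaluated on \<open>V\<close> only. This allows a trivially acting point to be cancelled
  in the middle of a product.\<close>

lemma conv_cong_V:
  assumes R: "algebra K R" and "p \<in> linear_maps K A R" "q \<in> linear_maps K A R" "q' \<in> linear_maps K A R"
    and "v \<in> V" "\<And>w. w \<in> V \<Longrightarrow> q w = q' w"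
  shows "conv R p q v = conv R p q' v"
  unfolding conv_def using assms
  by (intro sw_cong_V[OF module_R[OF R]] bilinear_points[OF R]) auto

text \<open>With \<open>g' = g \<circ> S\<close>, the inverse of \<open>g\<close> under convolution,
  one has \<open>g' * h = g' * (g * h) = h\<close> on \<open>V\<close>.\<close>

lemma acts_trivially_antipode:
  assumes R: "algebra K R" and g: "g \<in> algebra_homs K A R" and T: "acts_trivially R g"
  shows "acts_trivially R (\<lambda>x. g (antipode A x))"
proof -
  have gl: "g \<in> linear_maps K A R" and gS: "(\<lambda>x. g (antipode A x)) \<in> linear_maps K A R"
    using g antipode_hom[OF R g] by (auto simp: algebra_homs_def)
  show ?thesis
    unfolding acts_trivially_iff_conv[OF R gS]
  proof (intro ballI)
    fix v h assume v: "v \<in> V" and h: "h \<in> linear_maps K A R"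
    have "conv R (\<lambda>x. g (antipode A x)) h v = conv R (\<lambda>x. g (antipode A x)) (conv R g h) v"
      using T unfolding acts_trivially_iff_conv[OF R gl]
      by (intro conv_cong_V R gS h conv_linear gl v) (simp add: h)
    also have "\<dots> = conv R (conv R (\<lambda>x. g (antipode A x)) g) h v"
      by (intro conv_assoc[symmetric] R gS gl h V_A v)
    also have "\<dots> = conv R (\<lambda>a. counit A a \<odot>\<^bsub>R\<^esub> \<one>\<^bsub>R\<^esub>) h v"
      by (intro conv_cong[OF R V_A[OF v]] conv_antipode[OF R g]) simp_all
    also have "\<dots> = h v" by (intro conv_unit R h V_A v)
    finally show "conv R (\<lambda>x. g (antipode A x)) h v = h v" .
  qed
qed

section \<open>The Hopf ideal that defines the core\<close>

definition gen :: "('a \<Rightarrow> 'k) \<Rightarrow> 'a \<Rightarrow> 'a"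
  where "gen \<phi> v = sw A (\<lambda>x y. \<phi> y \<odot>\<^bsub>A\<^esub> x) v \<ominus>\<^bsub>A\<^esub> \<phi> v \<odot>\<^bsub>A\<^esub> \<one>\<^bsub>A\<^esub>"

definition "J = Idl\<^bsub>A\<^esub> {gen \<phi> v | \<phi> v. \<phi> \<in> linear_maps K A (scalars K) \<and> v \<in> V}"

lemma bilinear_gen: "\<phi> \<in> linear_maps K A (scalars K) \<Longrightarrow> bilinear K A A A (\<lambda>x y. \<phi> y \<odot>\<^bsub>A\<^esub> x)"
  using lin_closed[of \<phi> K A "scalars K"] by (intro lin_rules) auto

lemma gen_closed:
  assumes "\<phi> \<in> linear_maps K A (scalars K)" "v \<in> carrier A"
  shows "gen \<phi> v \<in> carrier A"
  using lin_closed[OF sw_linear[OF bilinear_gen[OF assms(1)] module_A] assms(2)] lin_closed[OF assms]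
  by (simp add: gen_def)

lemma gens_carrier: "{gen \<phi> v | \<phi> v. \<phi> \<in> linear_maps K A (scalars K) \<and> v \<in> V} \<subseteq> carrier A"
  using gen_closed V_A by blast

lemma ideal_J: "ideal J A"
  unfolding J_def by (rule A.genideal_ideal[OF gens_carrier])

lemma gen_J: "\<phi> \<in> linear_maps K A (scalars K) \<Longrightarrow> v \<in> V \<Longrightarrow> gen \<phi> v \<in> J"
  unfolding J_def using A.genideal_self[OF gens_carrier] by blast

lemma J_minimal:
  assumes "ideal X A" "\<And>\<phi> v. \<phi> \<in> linear_maps K A (scalars K) \<Longrightarrow> v \<in> V \<Longrightarrow> gen \<phi> v \<in> X"
  shows "J \<subseteq> X"
  unfolding J_def using assms by (intro A.genideal_minimal) auto

text \<open>The value of \<open>g\<close> at \<open>gen \<phi> v\<close> is the defect in the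
  equation of \<open>acts_trivially\<close>. Since \<open>g\<close> is a morphism its zeros form an
  ideal, so vanishing on the generators is vanishing on \<open>J\<close>.\<close>

lemma vanishes_J_iff:
  assumes R: "algebra K R" and g: "g \<in> algebra_homs K A R"
  shows "(\<forall>a\<in>J. g a = \<zero>\<^bsub>R\<^esub>) \<longleftrightarrow> acts_trivially R g"
proof -
  interpret R: algebra K R by fact
  note mR = module_R[OF R]
  have gl: "g \<in> linear_maps K A R" and gr: "g \<in> ring_hom A R" using g by (auto simp: algebra_homs_def)
  have gc: "a \<in> carrier A \<Longrightarrow> g a \<in> carrier R" for a by (rule lin_closed[OF gl])
  have gen: "g (gen \<phi> v) = sw R (\<lambda>x y. \<phi> y \<odot>\<^bsub>R\<^esub> g x) v \<ominus>\<^bsub>R\<^esub> \<phi> v \<odot>\<^bsub>R\<^esub> \<one>\<^bsub>R\<^esub>"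
    if \<phi>: "\<phi> \<in> linear_maps K A (scalars K)" and v: "v \<in> V" for \<phi> v
  proof -
    have \<phi>c: "a \<in> carrier A \<Longrightarrow> \<phi> a \<in> carrier K" for a using lin_closed[OF \<phi>] by simp
    have vA: "v \<in> carrier A" by (rule V_A[OF v])
    have sc: "sw A (\<lambda>x y. \<phi> y \<odot>\<^bsub>A\<^esub> x) v \<in> carrier A" using \<phi>c vA by (intro sw_closed module_A) auto
    have "g (sw A (\<lambda>x y. \<phi> y \<odot>\<^bsub>A\<^esub> x) v) = sw R (\<lambda>x y. g (\<phi> y \<odot>\<^bsub>A\<^esub> x)) v"
      using \<phi>c vA by (intro sw_push[OF gl module_A mR]) auto
    also have "\<dots> = sw R (\<lambda>x y. \<phi> y \<odot>\<^bsub>R\<^esub> g x) v"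
      using \<phi>c vA by (intro sw_cong lin_smult[OF gl]) auto
    finally show ?thesis
      using lin_minus[OF gl module_A mR sc, of "\<phi> v \<odot>\<^bsub>A\<^esub> \<one>\<^bsub>A\<^esub>"] \<phi>c[OF vA] lin_smult[OF gl, of "\<phi> v" "\<one>\<^bsub>A\<^esub>"]
        ring_hom_one[OF gr]
      by (simp add: gen_def)
  qed
  have sc: "sw R (\<lambda>x y. \<phi> y \<odot>\<^bsub>R\<^esub> g x) v \<in> carrier R" "\<phi> v \<odot>\<^bsub>R\<^esub> \<one>\<^bsub>R\<^esub> \<in> carrier R"
    if "\<phi> \<in> linear_maps K A (scalars K)" "v \<in> V" for \<phi> v
    using lin_closed[OF that(1)] V_A[OF that(2)] gc by (auto intro!: sw_closed mR)
  show ?thesis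
  proof
    assume L: "\<forall>a\<in>J. g a = \<zero>\<^bsub>R\<^esub>"
    show "acts_trivially R g"
      unfolding acts_trivially_def
    proof (intro ballI)
      fix v \<phi> assume *: "v \<in> V" "\<phi> \<in> linear_maps K A (scalars K)"
      have "sw R (\<lambda>x y. \<phi> y \<odot>\<^bsub>R\<^esub> g x) v \<ominus>\<^bsub>R\<^esub> \<phi> v \<odot>\<^bsub>R\<^esub> \<one>\<^bsub>R\<^esub> = \<zero>\<^bsub>R\<^esub>"
        using L gen_J[OF *(2,1)] gen[OF *(2,1)] by simp
      then show "sw R (\<lambda>x y. \<phi> y \<odot>\<^bsub>R\<^esub> g x) v = \<phi> v \<odot>\<^bsub>R\<^esub> \<one>\<^bsub>R\<^esub>"
        by (rule R.minus_eq_zeroD[OF sc[OF *(2,1)]])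
    qed
  next
    assume T: "acts_trivially R g"
    have "J \<subseteq> {a \<in> carrier A. g a = \<zero>\<^bsub>R\<^esub>}"
    proof (rule J_minimal[OF ideal_zeros[OF algebra R g]])
      fix \<phi> v assume *: "\<phi> \<in> linear_maps K A (scalars K)" "v \<in> V"
      have "sw R (\<lambda>x y. \<phi> y \<odot>\<^bsub>R\<^esub> g x) v = \<phi> v \<odot>\<^bsub>R\<^esub> \<one>\<^bsub>R\<^esub>"
        using T * unfolding acts_trivially_def by blast
      then have "g (gen \<phi> v) = \<zero>\<^bsub>R\<^esub>" using gen[OF *] sc[OF *] by (simp add: R.minus_self)
      then show "gen \<phi> v \<in> {a \<in> carrier A. g a = \<zero>\<^bsub>R\<^esub>}" using gen_closed[OF *(1)] V_A[OF *(2)] by simp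
    qed
    then show "\<forall>a\<in>J. g a = \<zero>\<^bsub>R\<^esub>" by blast
  qed
qed

lemma counit_acts_trivially: "acts_trivially (scalars K) (counit A)"
  unfolding acts_trivially_def
proof (intro ballI)
  fix v \<psi> assume v: "v \<in> V" and \<psi>: "\<psi> \<in> linear_maps K A (scalars K)"
  have \<psi>c: "a \<in> carrier A \<Longrightarrow> \<psi> a \<in> carrier K" for a using lin_closed[OF \<psi>] by simp
  have "sw (scalars K) (\<lambda>x y. \<psi> y \<odot>\<^bsub>scalars K\<^esub> counit A x) v = sw (scalars K) (\<lambda>x y. counit A x \<odot>\<^bsub>scalars K\<^esub> \<psi> y) v"
    using V_A[OF v] \<psi>c by (intro sw_cong) (auto simp: counit_closed K.m_comm)
  then show "sw (scalars K) (\<lambda>x y. \<psi> y \<odot>\<^bsub>scalars K\<^esub> counit A x) v = \<psi> v \<odot>\<^bsub>scalars K\<^esub> \<one>\<^bsub>scalars K\<^esub>"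
    using sw_counit_left[OF module_scalars V_A[OF v] \<psi>] \<psi>c[OF V_A[OF v]] by simp
qed

text \<open>Let \<open>f\<close> be the matrix coefficient belonging to \<phi>. Coassociativity
  gives \<open>\<Delta>(f v) = \<Sum> v\<^sub>1 \<otimes> f(v\<^sub>2)\<close>. Splitting
  \<open>f\<close> in the right leg into \<open>gen \<phi>\<close> and a multiple of 1 separates off
  \<open>f(v) \<otimes> 1\<close>, and subtracting \<open>\<phi>(v) 1 \<otimes> 1\<close> turns this
  into \<open>gen \<phi> v \<otimes> 1\<close>. In the remaining sum, expanded along
  \<open>D\<close>, the right legs are generators again because \<open>contract\<close> preserves
  \<open>V\<close>.\<close>

lemma comult_gen:
  assumes \<phi>: "\<phi> \<in> linear_maps K A (scalars K)" and v: "v \<in> V"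
  shows "comult A (gen \<phi> v) =
    AA.cls (map (\<lambda>(b, \<psi>). (b, gen \<phi> (contract \<psi> v))) D @ [(gen \<phi> v, \<one>\<^bsub>A\<^esub>)])"
proof -
  have \<phi>c: "a \<in> carrier A \<Longrightarrow> \<phi> a \<in> carrier K" for a using lin_closed[OF \<phi>] by simp
  have vA: "v \<in> carrier A" by (rule V_A[OF v])
  note mT = AA.module_tensor
  define f where "f = sw A (\<lambda>x y. \<phi> y \<odot>\<^bsub>A\<^esub> x)"
  have f: "f \<in> linear_maps K A A" unfolding f_def by (rule sw_linear[OF bilinear_gen[OF \<phi>] module_A])
  have fc: "a \<in> carrier A \<Longrightarrow> f a \<in> carrier A" for a by (rule lin_closed[OF f])
  have gen_f: "gen \<phi> a = f a \<ominus>\<^bsub>A\<^esub> \<phi> a \<odot>\<^bsub>A\<^esub> \<one>\<^bsub>A\<^esub>" for a by (simp add: gen_def f_def)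
  have gen_lin: "gen \<phi> \<in> linear_maps K A A"
  proof -
    have "(\<lambda>a. f a \<oplus>\<^bsub>A\<^esub> (\<ominus>\<^bsub>K\<^esub> \<one>\<^bsub>K\<^esub>) \<odot>\<^bsub>A\<^esub> (\<phi> a \<odot>\<^bsub>A\<^esub> \<one>\<^bsub>A\<^esub>)) \<in> linear_maps K A A"
      by (intro lin_add_fun lin_smult_const lin_smult_fun f \<phi> module_A) auto
    then show ?thesis
      by (rule lin_cong[OF _ _ module_A]) (simp add: gen_f \<phi>c A.smult_l_minus A.minus_eq)
  qed
  have gc: "a \<in> carrier A \<Longrightarrow> gen \<phi> a \<in> carrier A" for a by (rule gen_closed[OF \<phi>])
  have f_gen: "f a = gen \<phi> a \<oplus>\<^bsub>A\<^esub> \<phi> a \<odot>\<^bsub>A\<^esub> \<one>\<^bsub>A\<^esub>" if "a \<in> carrier A" for a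
    using that fc \<phi>c A.add_minus_cancel[of "f a" "\<phi> a \<odot>\<^bsub>A\<^esub> \<one>\<^bsub>A\<^esub>"] gc
    by (simp add: A.M.a_comm gen_f)
  have pl: "(\<lambda>x. AA.pure x y) \<in> linear_maps K A AA.T" and pr: "(\<lambda>x. AA.pure y x) \<in> linear_maps K A AA.T"
    if "y \<in> carrier A" for y
    using that bilinear_left[OF AA.bilinear_pure] bilinear_right[OF AA.bilinear_pure] by auto
  have comult_sw: "comult A x = sw AA.T AA.pure x" if "x \<in> carrier A" for x
    using comult_closed[OF that] by (simp add: sw_def AA.lift_pure_id)
  have "comult A (f v) = sw AA.T (\<lambda>x z. comult A (\<phi> z \<odot>\<^bsub>A\<^esub> x)) v"
    unfolding f_def using \<phi>c vA by (intro sw_push[OF comult_linear module_A mT]) auto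
  also have "\<dots> = sw AA.T (\<lambda>x z. sw AA.T (\<lambda>x y. \<phi> z \<odot>\<^bsub>AA.T\<^esub> AA.pure x y) x) v"
  proof (rule sw_cong[OF vA])
    fix x z assume xz: "x \<in> carrier A" "z \<in> carrier A"
    have "comult A (\<phi> z \<odot>\<^bsub>A\<^esub> x) = \<phi> z \<odot>\<^bsub>AA.T\<^esub> sw AA.T AA.pure x"
      using xz \<phi>c by (simp add: lin_smult[OF comult_linear] comult_sw[OF xz(1)])
    also have "\<dots> = sw AA.T (\<lambda>x y. \<phi> z \<odot>\<^bsub>AA.T\<^esub> AA.pure x y) x"
      using xz \<phi>c by (intro sw_push[OF lin_smult_const[OF mT lin_id] mT mT]) (auto simp: AA.pure_closed)
    finally show "comult A (\<phi> z \<odot>\<^bsub>A\<^esub> x) = sw AA.T (\<lambda>x y. \<phi> z \<odot>\<^bsub>AA.T\<^esub> AA.pure x y) x" .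
  qed
  also have "\<dots> = sw AA.T (\<lambda>x y. sw AA.T (\<lambda>y z. \<phi> z \<odot>\<^bsub>AA.T\<^esub> AA.pure x y) y) v"
    using vA \<phi>c by (intro sw_coassoc mT lin_smult_const lin_smult_fun \<phi> pl pr) (auto simp: AA.pure_closed)
  also have "\<dots> = sw AA.T (\<lambda>x y. AA.pure x (gen \<phi> y) \<oplus>\<^bsub>AA.T\<^esub> \<phi> y \<odot>\<^bsub>AA.T\<^esub> AA.pure x \<one>\<^bsub>A\<^esub>) v"
  proof (rule sw_cong[OF vA])
    fix x y assume xy: "x \<in> carrier A" "y \<in> carrier A"
    have "sw AA.T (\<lambda>y z. \<phi> z \<odot>\<^bsub>AA.T\<^esub> AA.pure x y) y = sw AA.T (\<lambda>y z. AA.pure x (\<phi> z \<odot>\<^bsub>A\<^esub> y)) y"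
      using xy \<phi>c by (intro sw_cong) (auto simp: lin_smult[OF pr[OF xy(1)]])
    also have "\<dots> = AA.pure x (f y)"
      unfolding f_def using xy \<phi>c by (intro sw_push[OF pr[OF xy(1)] module_A mT, symmetric]) auto
    also have "\<dots> = AA.pure x (gen \<phi> y) \<oplus>\<^bsub>AA.T\<^esub> \<phi> y \<odot>\<^bsub>AA.T\<^esub> AA.pure x \<one>\<^bsub>A\<^esub>"
      using xy \<phi>c gc by (simp add: f_gen lin_add[OF pr[OF xy(1)]] lin_smult[OF pr[OF xy(1)]])
    finally show "sw AA.T (\<lambda>y z. \<phi> z \<odot>\<^bsub>AA.T\<^esub> AA.pure x y) y =
        AA.pure x (gen \<phi> y) \<oplus>\<^bsub>AA.T\<^esub> \<phi> y \<odot>\<^bsub>AA.T\<^esub> AA.pure x \<one>\<^bsub>A\<^esub>" .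
  qed
  also have "\<dots> = sw AA.T (\<lambda>x y. AA.pure x (gen \<phi> y)) v \<oplus>\<^bsub>AA.T\<^esub> sw AA.T (\<lambda>x y. \<phi> y \<odot>\<^bsub>AA.T\<^esub> AA.pure x \<one>\<^bsub>A\<^esub>) v"
    using vA \<phi>c gc by (intro sw_add_fun mT) (auto simp: AA.pure_closed)
  also have "sw AA.T (\<lambda>x y. \<phi> y \<odot>\<^bsub>AA.T\<^esub> AA.pure x \<one>\<^bsub>A\<^esub>) v = AA.pure (f v) \<one>\<^bsub>A\<^esub>"
  proof -
    have "AA.pure (f v) \<one>\<^bsub>A\<^esub> = sw AA.T (\<lambda>x y. AA.pure (\<phi> y \<odot>\<^bsub>A\<^esub> x) \<one>\<^bsub>A\<^esub>) v"
      unfolding f_def using vA \<phi>c by (intro sw_push[OF pl[OF A.one_closed] module_A mT]) auto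
    also have "\<dots> = sw AA.T (\<lambda>x y. \<phi> y \<odot>\<^bsub>AA.T\<^esub> AA.pure x \<one>\<^bsub>A\<^esub>) v"
      using vA \<phi>c by (intro sw_cong lin_smult[OF pl[OF A.one_closed]]) auto
    finally show ?thesis by simp
  qed
  finally have "comult A (f v) = sw AA.T (\<lambda>x y. AA.pure x (gen \<phi> y)) v \<oplus>\<^bsub>AA.T\<^esub> AA.pure (f v) \<one>\<^bsub>A\<^esub>" .
  then have "comult A (gen \<phi> v) = (sw AA.T (\<lambda>x y. AA.pure x (gen \<phi> y)) v \<oplus>\<^bsub>AA.T\<^esub> AA.pure (f v) \<one>\<^bsub>A\<^esub>)
      \<ominus>\<^bsub>AA.T\<^esub> \<phi> v \<odot>\<^bsub>AA.T\<^esub> AA.pure \<one>\<^bsub>A\<^esub> \<one>\<^bsub>A\<^esub>"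
    using vA \<phi>c[OF vA] fc comult
    by (simp add: gen_f lin_minus[OF comult_linear module_A mT] lin_smult[OF comult_linear]
        algebra_homs_def ring_hom_def AA.one_tensor)
  also have "\<dots> = sw AA.T (\<lambda>x y. AA.pure x (gen \<phi> y)) v \<oplus>\<^bsub>AA.T\<^esub> AA.pure (gen \<phi> v) \<one>\<^bsub>A\<^esub>"
  proof -
    have "AA.pure (gen \<phi> v) \<one>\<^bsub>A\<^esub> = AA.pure (f v) \<one>\<^bsub>A\<^esub> \<ominus>\<^bsub>AA.T\<^esub> \<phi> v \<odot>\<^bsub>AA.T\<^esub> AA.pure \<one>\<^bsub>A\<^esub> \<one>\<^bsub>A\<^esub>"
      using vA \<phi>c[OF vA] fc
      by (simp add: gen_f lin_minus[OF pl[OF A.one_closed] module_A mT] lin_smult[OF pl[OF A.one_closed]])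
    moreover have "sw AA.T (\<lambda>x y. AA.pure x (gen \<phi> y)) v \<in> carrier AA.T"
      using vA gc by (intro sw_closed mT) (auto simp: AA.pure_closed)
    ultimately show ?thesis
      using vA \<phi>c[OF vA] fc by (simp add: AA.T.minus_eq AA.T.a_assoc AA.pure_closed)
  qed
  also have "sw AA.T (\<lambda>x y. AA.pure x (gen \<phi> y)) v = tsum AA.T (\<lambda>b \<psi>. AA.pure b (gen \<phi> (contract \<psi> v))) D"
    by (intro sw_expand mT vA bilinearI lin_comp[OF gen_lin pr] pl gc)
  also have "\<dots> = AA.cls (map (\<lambda>(b, \<psi>). (b, gen \<phi> (contract \<psi> v))) D)"
  proof -
    have "map (\<lambda>(b, \<psi>). (b, gen \<phi> (contract \<psi> v))) D \<in> AA.tlists"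
      using DD(1,2) gc contract_V[OF _ v] V_A by (auto simp: AA.tlists_iff)
    from AA.cls_tsum[OF this] show ?thesis by (simp add: tsum_map)
  qed
  also have "\<dots> \<oplus>\<^bsub>AA.T\<^esub> AA.pure (gen \<phi> v) \<one>\<^bsub>A\<^esub> =
      AA.cls (map (\<lambda>(b, \<psi>). (b, gen \<phi> (contract \<psi> v))) D @ [(gen \<phi> v, \<one>\<^bsub>A\<^esub>)])"
    unfolding pure_tensor_def using DD(1,2) gc contract_V[OF _ v] V_A vA
    by (intro AA.tensor_add) (auto simp: AA.tlists_iff)
  finally show ?thesis .
qed

text \<open>For the comultiplication, the elements whose coproduct has the required form make up an
  ideal, so the generators decide. The other two clauses are read off from points: the counit acts
  trivially, and the inverse of a trivially acting point acts trivially.\<close>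

lemma hopf_ideal_J: "hopf_ideal K A J"
proof -
  interpret J: ideal J A by (rule ideal_J)
  let ?L = "lists (J \<times> carrier A \<union> carrier A \<times> J)"
  let ?X = "{a \<in> carrier A. \<exists>xs\<in>?L. comult A a = AA.cls xs}"
  have LT: "xs \<in> AA.tlists" if "xs \<in> ?L" for xs
  proof -
    have "J \<times> carrier A \<union> carrier A \<times> J \<subseteq> carrier A \<times> carrier A" using J.a_subset by blast
    then show ?thesis using that lists_mono unfolding AA.tlists_def by blast
  qed
  have "ideal ?X A"
  proof (rule A.idealI_cring)
    show "\<zero>\<^bsub>A\<^esub> \<in> ?X"
      using lin_zero[OF comult_linear module_A AA.module_tensor] AA.tensor_zero
      by (auto intro!: bexI[of _ "[]"])
    fix a x assume "x \<in> ?X"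
    then obtain xs where xs: "x \<in> carrier A" "xs \<in> ?L" "comult A x = AA.cls xs" by blast
    {
      assume "a \<in> ?X"
      then obtain ys where ys: "a \<in> carrier A" "ys \<in> ?L" "comult A a = AA.cls ys" by blast
      have "comult A (a \<oplus>\<^bsub>A\<^esub> x) = AA.cls (ys @ xs)"
        using xs ys LT by (simp add: lin_add[OF comult_linear] AA.tensor_add)
      moreover have "ys @ xs \<in> ?L" using xs(2) ys(2) by simp
      ultimately show "a \<oplus>\<^bsub>A\<^esub> x \<in> ?X" using xs ys by blast
    }
    assume a: "a \<in> carrier A"
    obtain ys where ys: "ys \<in> AA.tlists" "comult A a = AA.cls ys"
      using comult_closed[OF a] unfolding AA.carrier_tensor by blast
    define zs where "zs = [(m \<otimes>\<^bsub>A\<^esub> m', n \<otimes>\<^bsub>A\<^esub> n'). (m, n) \<leftarrow> ys, (m', n') \<leftarrow> xs]"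
    have "comult A (a \<otimes>\<^bsub>A\<^esub> x) = AA.tmul (comult A a) (comult A x)"
      using comult a xs(1) comult_closed by (simp add: algebra_homs_def ring_hom_def AA.tensor_mult)
    also have "\<dots> = AA.cls zs"
      unfolding zs_def xs(3) ys(2) by (rule AA.cls_product[symmetric, OF ys(1) LT[OF xs(2)]])
    finally have "comult A (a \<otimes>\<^bsub>A\<^esub> x) = AA.cls zs" .
    moreover have "(m \<otimes>\<^bsub>A\<^esub> m', n \<otimes>\<^bsub>A\<^esub> n') \<in> J \<times> carrier A \<union> carrier A \<times> J"
      if "(m, n) \<in> set ys" "(m', n') \<in> set xs" for m n m' n'
    proof -
      have "(m', n') \<in> J \<times> carrier A \<union> carrier A \<times> J" using xs(2) that(2) by (auto simp: in_lists_conv_set)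
      then show ?thesis
        using AA.tlistsD[OF ys(1) that(1)] J.I_l_closed J.a_subset by (auto simp: subset_iff)
    qed
    then have "zs \<in> ?L" unfolding zs_def by (fastforce simp: in_lists_conv_set)
    ultimately show "a \<otimes>\<^bsub>A\<^esub> x \<in> ?X" using a xs(1) by blast
  qed auto
  then have X: "J \<subseteq> ?X"
  proof (rule J_minimal)
    fix \<phi> v assume \<phi>: "\<phi> \<in> linear_maps K A (scalars K)" and v: "v \<in> V"
    have "map (\<lambda>(b, \<psi>). (b, gen \<phi> (contract \<psi> v))) D @ [(gen \<phi> v, \<one>\<^bsub>A\<^esub>)] \<in> ?L"
      using DD(1,2) gen_J[OF \<phi> contract_V[OF _ v]] gen_J[OF \<phi> v] by (auto simp: in_lists_conv_set)
    then show "gen \<phi> v \<in> ?X"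
      using comult_gen[OF \<phi> v] gen_closed[OF \<phi> V_A[OF v]] by blast
  qed
  have eps: "\<forall>a\<in>J. counit A a = \<zero>\<^bsub>K\<^esub>"
    using vanishes_J_iff[OF algebra_scalars[OF A.R_cring] counit] counit_acts_trivially by simp
  interpret QJ: quotient_module K A J by (intro quotient_module.intro algebra ideal_J)
  have JA: "a \<in> J \<Longrightarrow> a \<in> carrier A" for a using J.a_subset by blast
  \<comment> \<open>The projection to \<open>A/J\<close> is the universal trivially acting point.
    Its inverse acts trivially too, so it kills \<open>J\<close>; as the inverse is the projection
    after the antipode, the antipode preserves \<open>J\<close>.\<close>
  have "acts_trivially QJ.C QJ.\<pi>"
    using vanishes_J_iff[OF QJ.algebra_C QJ.\<pi>_hom] QJ.\<pi>_zero_iff JA by simp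
  then have "acts_trivially QJ.C (\<lambda>x. QJ.\<pi> (antipode A x))"
    by (rule acts_trivially_antipode[OF QJ.algebra_C QJ.\<pi>_hom])
  then have "\<forall>a\<in>J. QJ.\<pi> (antipode A a) = \<zero>\<^bsub>QJ.C\<^esub>"
    using vanishes_J_iff[OF QJ.algebra_C antipode_hom[OF QJ.algebra_C QJ.\<pi>_hom]] by simp
  then have "\<forall>a\<in>J. antipode A a \<in> J"
    using QJ.\<pi>_zero_iff[OF antipode_closed[OF JA]] by simp
  then show ?thesis
    using ideal_J X eps unfolding hopf_ideal_def by blast
qed

lemma acts_trivially_cong:
  assumes "algebra K R" "\<And>a. a \<in> carrier A \<Longrightarrow> g a = g' a"
  shows "acts_trivially R g = acts_trivially R g'"
proof -
  have "sw R (\<lambda>x y. \<psi> y \<odot>\<^bsub>R\<^esub> g x) v = sw R (\<lambda>x y. \<psi> y \<odot>\<^bsub>R\<^esub> g' x) v" if "v \<in> V" for \<psi> v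
    using assms(2) V_A[OF that] by (intro sw_cong) auto
  then show ?thesis by (simp add: acts_trivially_def)
qed

text \<open>\<open>mu\<close> inverts its argument, so membership in the core is triviality of the
  inverse. Trivially acting points are stable under inversion, which removes the inverse in both
  directions.\<close>

lemma core_eq_closed_subscheme:
  fixes R :: "('k, 'r) module"
  assumes R: "algebra K R"
  shows "core K A I R = closed_subscheme K A J R"
proof (rule Set.set_eqI, rule iffI)
  have inv_trivial: "acts_trivially R (inv\<^bsub>points K A R\<^esub> g)"
    if "g \<in> carrier (points K A R)" "acts_trivially R g" for g
    using acts_trivially_antipode[OF R points_homs[OF that(1)] that(2)]
      acts_trivially_cong[OF R, of "inv\<^bsub>points K A R\<^esub> g" "\<lambda>x. g (antipode A x)"]
    by (simp add: points_inv[OF R that(1)])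
  note grp = group_points[OF R]
  fix g
  {
    assume "g \<in> core K A I R"
    then have g: "g \<in> carrier (points K A R)" "acts_trivially R (inv\<^bsub>points K A R\<^esub> g)"
      using core_iff[OF R] by blast+
    then have "acts_trivially R g"
      using inv_trivial[OF group.inv_closed[OF grp g(1)] g(2)] group.inv_inv[OF grp g(1)] by simp
    then show "g \<in> closed_subscheme K A J R"
      using g(1) vanishes_J_iff[OF R points_homs[OF g(1)]] by (simp add: closed_subscheme_def)
  }
  assume "g \<in> closed_subscheme K A J R"
  then have g: "g \<in> carrier (points K A R)" "acts_trivially R g"
    using vanishes_J_iff[OF R points_homs] by (auto simp: closed_subscheme_def)
  then show "g \<in> core K A I R" using core_iff[OF R] inv_trivial by blast
qed

lemma core_normal:
  fixes R :: "('k, 'r) module"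
  assumes R: "algebra K R"
  shows "core K A I R \<lhd> points K A R"
proof -
  note grp = group_points[OF R]
  show ?thesis
    unfolding core_eq_closed_subscheme[OF R]
  proof (rule group.normal_invI[OF grp closed_subscheme_subgroup[OF hopf_ideal_J R]])
    fix x g assume x: "x \<in> carrier (points K A R)" and "g \<in> closed_subscheme K A J R"
    then have g: "g \<in> carrier (points K A R)" "acts_trivially R g"
      using vanishes_J_iff[OF R points_homs] by (auto simp: closed_subscheme_def)
    let ?x' = "inv\<^bsub>points K A R\<^esub> x"
    have x': "?x' \<in> carrier (points K A R)" by (rule group.inv_closed[OF grp x])
    let ?y = "x \<otimes>\<^bsub>points K A R\<^esub> g \<otimes>\<^bsub>points K A R\<^esub> ?x'"
    have y: "?y \<in> carrier (points K A R)" by (intro points_mult_closed R x g(1) x')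
    note lx = pointsD(1)[OF x] and lg = pointsD(1)[OF g(1)] and lx' = pointsD(1)[OF x']
    have pm: "(p \<otimes>\<^bsub>points K A R\<^esub> q) a = conv R p q a" if "a \<in> carrier A" for p q a
      using that by (simp add: points_mult conv_def)
    have "acts_trivially R ?y"
      unfolding acts_trivially_iff_conv[OF R pointsD(1)[OF y]]
    proof (intro ballI)
      fix v h assume v: "v \<in> V" and h: "h \<in> linear_maps K A R"
      have vA: "v \<in> carrier A" by (rule V_A[OF v])
      note cl = conv_linear[OF R]
      have "conv R ?y h v = conv R (conv R (conv R x g) ?x') h v"
        by (intro conv_cong[OF R vA]) (simp add: pm, intro conv_cong[OF R], simp_all add: pm)
      also have "\<dots> = conv R (conv R x g) (conv R ?x' h) v"
        by (rule conv_assoc[OF R cl[OF lx lg] lx' h vA])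
      also have "\<dots> = conv R x (conv R g (conv R ?x' h)) v"
        by (rule conv_assoc[OF R lx lg cl[OF lx' h] vA])
      \<comment> \<open>The point \<open>g\<close> is tested against \<open>?x' * h\<close>, a
        linear map that need not be multiplicative; this is why all linear test maps are allowed.
        The equality is known on \<open>V\<close> alone, which suffices under convolution by
        \<open>x\<close> on the left.\<close>
      also have "\<dots> = conv R x (conv R ?x' h) v"
        using g(2) cl[OF lx' h] unfolding acts_trivially_iff_conv[OF R lg]
        by (intro conv_cong_V[OF R lx cl[OF lg cl[OF lx' h]] cl[OF lx' h] v]) blast
      also have "\<dots> = conv R (conv R x ?x') h v"
        by (rule conv_assoc[OF R lx lx' h vA, symmetric])
      also have "\<dots> = conv R (\<lambda>a. counit A a \<odot>\<^bsub>R\<^esub> \<one>\<^bsub>R\<^esub>) h v"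
        using group.r_inv[OF grp x]
        by (intro conv_cong[OF R vA]) (simp_all add: pm[symmetric] points_one)
      also have "\<dots> = h v" by (rule conv_unit[OF R h vA])
      finally show "conv R ?y h v = h v" .
    qed
    then show "?y \<in> closed_subscheme K A J R"
      using y vanishes_J_iff[OF R points_homs[OF y]] by (simp add: closed_subscheme_def)
  qed
qed

lemma core_normal_subgroup_scheme:
  "normal_subgroup_scheme K A (core K A I :: ('k, 'a, 'r) subfunctor)"
  unfolding normal_subgroup_scheme_def subgroup_scheme_def
  using hopf_ideal_J core_eq_closed_subscheme core_normal by blast

end

section \<open>Integrals on the subgroup and containment of the core\<close>

context subgroup_of_finite_group_scheme
begin

lemma algebra_Ks: "algebra K (scalars K)"
  by (rule algebra_scalars[OF A.R_cring])

definition "E = filter (\<lambda>(b, \<phi>). b \<notin> I) (SOME D. dual_system K A I D)"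

text \<open>A functional on the coordinate ring of \<open>H\<close>, kept as a functional on
  \<open>A\<close>. All arguments then stay elements of \<open>A\<close>, and cosets appear only as
  values.\<close>

definition functional_mod :: "('a \<Rightarrow> 'k) \<Rightarrow> bool"
  where "functional_mod \<phi> \<longleftrightarrow> \<phi> \<in> linear_maps K A (scalars K) \<and> (\<forall>x\<in>I. \<phi> x = \<zero>\<^bsub>K\<^esub>)"

lemma functional_modD:
  assumes "functional_mod \<phi>"
  shows "\<phi> \<in> linear_maps K A (scalars K)" "a \<in> carrier A \<Longrightarrow> \<phi> a \<in> carrier K" "x \<in> I \<Longrightarrow> \<phi> x = \<zero>\<^bsub>K\<^esub>"
  using assms lin_closed[of \<phi> K A "scalars K" a] by (auto simp: functional_mod_def)

lemma I_A: "x \<in> I \<Longrightarrow> x \<in> carrier A"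
  using Q.I.a_subset by blast

lemma dual_system_I: "dual_system K A I (SOME D. dual_system K A I D)"
proof -
  obtain D' where "dual_system K A I D'"
    using dual_system_exists[OF field module_A finite_dim Q.submodule_I] by blast
  then show ?thesis by (rule someI)
qed

lemma ED:
  assumes "(b, \<phi>) \<in> set E"
  shows "b \<in> carrier A" "functional_mod \<phi>"
  using assms dual_systemD[OF dual_system_I] by (auto simp: E_def functional_mod_def)

text \<open>Modulo \<open>I\<close>, the list \<open>E\<close> is a dual system of the coordinate ring of \<open>H\<close>.\<close>

lemma E_expand:
  assumes P: "module K P" and F: "F \<in> linear_maps K A P" and z: "\<And>x. x \<in> I \<Longrightarrow> F x = \<zero>\<^bsub>P\<^esub>"
    and a: "a \<in> carrier A"
  shows "F a = tsum P (\<lambda>b \<phi>. \<phi> a \<odot>\<^bsub>P\<^esub> F b) E"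
proof -
  interpret P: module K P by fact
  define D' where "D' = (SOME D. dual_system K A I D)"
  have D': "dual_system K A I D'" unfolding D'_def by (rule dual_system_I)
  note d = dual_systemD[OF D']
  have "tsum P (\<lambda>b \<phi>. \<phi> a \<odot>\<^bsub>P\<^esub> F b) (filter (\<lambda>(b, \<phi>). b \<notin> I) xs) = tsum P (\<lambda>b \<phi>. \<phi> a \<odot>\<^bsub>P\<^esub> F b) xs"
    if "set xs \<subseteq> set D'" for xs
    using that
  proof (induction xs)
    case (Cons p xs)
    obtain b \<phi> where p: "p = (b, \<phi>)" by force
    have cl: "tsum P (\<lambda>b \<phi>. \<phi> a \<odot>\<^bsub>P\<^esub> F b) xs \<in> carrier P"
      using Cons.prems d a lin_closed[OF F] by (intro P.tsum_closed) auto
    have "F b = \<zero>\<^bsub>P\<^esub>" if "b \<in> I" using z[OF that] .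
    then show ?case
      using Cons d(4)[of b \<phi> a] a p cl by auto
  qed simp
  from this[of D'] have "tsum P (\<lambda>b \<phi>. \<phi> a \<odot>\<^bsub>P\<^esub> F b) E = tsum P (\<lambda>b \<phi>. \<phi> a \<odot>\<^bsub>P\<^esub> F b) D'"
    by (simp add: E_def D'_def)
  also have "\<dots> = tsum P (\<lambda>b \<phi>. F (\<phi> a \<odot>\<^bsub>A\<^esub> b)) D'"
    using d a by (intro tsum_cong) (simp add: lin_smult[OF F])
  also have "\<dots> = F (tsum A (\<lambda>b \<phi>. \<phi> a \<odot>\<^bsub>A\<^esub> b) D')"
    using d a by (intro lin_tsum[OF F module_A P, symmetric]) auto
  also have "\<dots> = F a" using dual_system_sum[OF D' a] by simp
  finally show ?thesis by simp
qed

text \<open>The product of the dual algebra. It is also the \<phi>-coordinate of the vector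
  \<open>z\<^sub>1 f(z\<^sub>2)\<close>, and therefore the diagonal sum in \<open>integral\<close>
  is a trace.\<close>

definition kap :: "('a \<Rightarrow> 'k) \<Rightarrow> ('a \<Rightarrow> 'k) \<Rightarrow> 'a \<Rightarrow> 'k"
  where "kap \<phi> f = sw (scalars K) (\<lambda>x y. \<phi> x \<otimes>\<^bsub>K\<^esub> f y)"

lemma functional_mod_kap:
  assumes \<phi>: "functional_mod \<phi>" and f: "functional_mod f"
  shows "functional_mod (kap \<phi> f)"
proof -
  note d = functional_modD[OF \<phi>] functional_modD[OF f]
  have B: "bilinear K A A (scalars K) (\<lambda>x y. \<phi> x \<otimes>\<^bsub>K\<^esub> f y)"
    using bilinear_points[OF algebra_Ks d(1,4)] by simp
  have "sw (scalars K) (\<lambda>x y. \<phi> x \<otimes>\<^bsub>K\<^esub> f y) a = \<zero>\<^bsub>scalars K\<^esub>" if "a \<in> I" for a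
    by (rule sw_hopf_ideal[OF hopf_ideal module_scalars B that]) (auto simp: d I_A)
  then show ?thesis
    unfolding functional_mod_def kap_def using sw_linear[OF B module_scalars] by simp
qed

lemma functional_mod_counit: "functional_mod (counit A)"
  using counit_linear hopf_idealD(2)[OF hopf_ideal] by (auto simp: functional_mod_def)

definition integral :: "('a \<Rightarrow> 'k) \<Rightarrow> 'a \<Rightarrow> 'k"
  where "integral f c = tsum (scalars K) (\<lambda>b \<phi>. kap \<phi> f (c \<otimes>\<^bsub>A\<^esub> b)) E"

lemma kap_mult_linear:
  assumes "functional_mod \<phi>" "functional_mod f" "b \<in> carrier A"
  shows "(\<lambda>c. kap \<phi> f (c \<otimes>\<^bsub>A\<^esub> b)) \<in> linear_maps K A (scalars K)"
  by (intro lin_comp[OF lin_mult_right[OF algebra lin_id assms(3)]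
        functional_modD(1)[OF functional_mod_kap[OF assms(1,2)]]])

lemma functional_mod_integral:
  assumes f: "functional_mod f"
  shows "functional_mod (integral f)"
  unfolding functional_mod_def
proof
  show "integral f \<in> linear_maps K A (scalars K)"
    unfolding integral_def[abs_def]
    by (intro lin_tsum_fun module_scalars kap_mult_linear f ED)
  show "\<forall>x\<in>I. integral f x = \<zero>\<^bsub>K\<^esub>"
  proof
    fix x assume x: "x \<in> I"
    interpret KS: module K "scalars K" by (rule module_scalars)
    have "integral f x = tsum (scalars K) (\<lambda>b \<phi>. \<zero>\<^bsub>scalars K\<^esub>) E"
      unfolding integral_def
    proof (rule tsum_cong)
      fix b \<phi> assume "(b, \<phi>) \<in> set E"
      note e = ED[OF this]
      have "x \<otimes>\<^bsub>A\<^esub> b \<in> I" using x e(1) by (rule Q.I.I_r_closed)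
      then show "kap \<phi> f (x \<otimes>\<^bsub>A\<^esub> b) = \<zero>\<^bsub>scalars K\<^esub>"
        using functional_modD(3)[OF functional_mod_kap[OF e(2) f]] by simp
    qed
    then show "integral f x = \<zero>\<^bsub>K\<^esub>" using KS.tsum_zero[of E] by simp
  qed
qed

text \<open>Writing \<open>L\<^sub>c\<close> for the operator \<open>x \<mapsto> (cx)\<^sub>1 f((cx)\<^sub>2)\<close> on the coordinate ring of \<open>H\<close>,
  \<open>integral f c\<close> is its trace. The map \<open>a \<otimes> x \<mapsto> a x\<^sub>1 \<otimes> x\<^sub>2\<close> conjugates \<open>1 \<otimes> L\<^sub>c\<close> to
  \<open>a \<otimes> x \<mapsto> a c\<^sub>1 \<otimes> L\<^bsub>c\<^sub>2\<^esub> x\<close>; comparing the traces shows that \<open>integral f\<close> is an integral.\<close>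

lemma integral_invariant:
  assumes f: "functional_mod f" and c: "c \<in> carrier A"
  shows "sw Q.C (\<lambda>x y. integral f y \<odot>\<^bsub>Q.C\<^esub> Q.\<pi> x) c = integral f c \<odot>\<^bsub>Q.C\<^esub> Q.\<pi> \<one>\<^bsub>A\<^esub>"
proof -
  let ?C = "Q.C" and ?\<pi> = "Q.\<pi>" and ?S = "antipode A" and ?\<epsilon> = "counit A"
  interpret C: algebra K ?C by (rule Q.algebra_C)
  note aC = Q.algebra_C and mC = Q.module_C
  have \<pi>: "?\<pi> \<in> linear_maps K A ?C" by (rule Q.\<pi>_linear)
  have \<pi>m: "?\<pi> (x \<otimes>\<^bsub>A\<^esub> y) = ?\<pi> x \<otimes>\<^bsub>?C\<^esub> ?\<pi> y" if "x \<in> carrier A" "y \<in> carrier A" for x y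
    using Q.\<pi>_hom that by (simp add: algebra_homs_def ring_hom_mult)
  have \<pi>1: "?\<pi> \<one>\<^bsub>A\<^esub> = \<one>\<^bsub>?C\<^esub>" using Q.\<pi>_hom by (simp add: algebra_homs_def ring_hom_one)
  have \<pi>c: "?\<pi> x \<in> carrier ?C" if "x \<in> carrier A" for x by (rule Q.\<pi>_closed[OF that])
  have \<pi>S: "(\<lambda>x. ?\<pi> (?S x)) \<in> linear_maps K A ?C" by (rule lin_comp[OF antipode \<pi>])
  have \<pi>0: "?\<pi> x = \<zero>\<^bsub>?C\<^esub>" if "x \<in> I" for x using Q.\<pi>_zero_iff[OF I_A[OF that]] that by simp
  note fd = functional_modD[OF f]
  note nosimp = Q.C_simps
  have kd: "kap \<phi> f \<in> linear_maps K A (scalars K)" "a \<in> carrier A \<Longrightarrow> kap \<phi> f a \<in> carrier K"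
    "a \<in> I \<Longrightarrow> kap \<phi> f a = \<zero>\<^bsub>K\<^esub>" if "functional_mod \<phi>" for \<phi> a
    using functional_modD[OF functional_mod_kap[OF that f]] by blast+
  \<comment> \<open>With \<Phi> the conjugating map and \<open>z = c x\<close>, applying
    \<open>1 \<otimes> L\<^sub>c\<close> and then \<Phi> to \<open>1 \<otimes> x\<close> gives
    \<open>z\<^sub>1 \<otimes> z\<^sub>2 f(z\<^sub>3)\<close>. \<open>H \<phi> z\<close> is the
    \<phi>-coordinate of its second leg: a matrix entry with values in \<open>A/I\<close>.\<close>
  define H where "H \<phi> = sw ?C (\<lambda>z w. kap \<phi> f w \<odot>\<^bsub>?C\<^esub> ?\<pi> z)" for \<phi>
  have BH: "bilinear K A A ?C (\<lambda>z w. kap \<phi> f w \<odot>\<^bsub>?C\<^esub> ?\<pi> z)" if "functional_mod \<phi>" for \<phi>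
    using kd[OF that] \<pi>c by (intro bilinearI lin_smult_fun lin_smult_const mC \<pi>) auto
  have H: "H \<phi> \<in> linear_maps K A ?C" "a \<in> carrier A \<Longrightarrow> H \<phi> a \<in> carrier ?C"
    "a \<in> I \<Longrightarrow> H \<phi> a = \<zero>\<^bsub>?C\<^esub>" if \<phi>: "functional_mod \<phi>" for \<phi> a
  proof -
    show L: "H \<phi> \<in> linear_maps K A ?C" unfolding H_def by (rule sw_linear[OF BH[OF \<phi>] mC])
    then show "a \<in> carrier A \<Longrightarrow> H \<phi> a \<in> carrier ?C" by (rule lin_closed)
    show "H \<phi> a = \<zero>\<^bsub>?C\<^esub>" if "a \<in> I"
      unfolding H_def using kd[OF \<phi>] \<pi>c
      by (intro sw_hopf_ideal[OF hopf_ideal mC BH[OF \<phi>] that]) (simp_all del: nosimp add: \<pi>0 I_A)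
  qed
  \<comment> \<open>The matrix entries of the inverse of \<Phi>, which sends
    \<open>a \<otimes> x\<close> to \<open>a S(x\<^sub>1) \<otimes> x\<^sub>2\<close>.\<close>
  define G where "G \<phi> = sw ?C (\<lambda>x y. \<phi> y \<odot>\<^bsub>?C\<^esub> ?\<pi> (?S x))" for \<phi>
  have BG: "bilinear K A A ?C (\<lambda>x y. \<phi> y \<odot>\<^bsub>?C\<^esub> ?\<pi> (?S x))" if "functional_mod \<phi>" for \<phi>
    using functional_modD[OF that] \<pi>c antipode_closed
    by (intro bilinearI lin_smult_fun lin_smult_const mC \<pi>S) auto
  have G: "G \<phi> \<in> linear_maps K A ?C" "a \<in> carrier A \<Longrightarrow> G \<phi> a \<in> carrier ?C"
    "a \<in> I \<Longrightarrow> G \<phi> a = \<zero>\<^bsub>?C\<^esub>" if \<phi>: "functional_mod \<phi>" for \<phi> a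
  proof -
    show L: "G \<phi> \<in> linear_maps K A ?C" unfolding G_def by (rule sw_linear[OF BG[OF \<phi>] mC])
    then show "a \<in> carrier A \<Longrightarrow> G \<phi> a \<in> carrier ?C" by (rule lin_closed)
    show "G \<phi> a = \<zero>\<^bsub>?C\<^esub>" if "a \<in> I"
      unfolding G_def using functional_modD[OF \<phi>] \<pi>c antipode_closed hopf_idealD(3)[OF hopf_ideal]
      by (intro sw_hopf_ideal[OF hopf_ideal mC BG[OF \<phi>] that]) (simp_all del: nosimp add: \<pi>0 I_A)
  qed
  \<comment> \<open>The conjugation formula, entry by entry: in
    \<open>S(b\<^sub>1) (c b\<^sub>2)\<^sub>1\<close> the antipode cancels the first leg of
    \<open>b\<^sub>2\<close>, and what is left is \<open>c\<^sub>1\<close> together with an entry of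
    the operator for \<open>c\<^sub>2\<close>.\<close>
  have step1: "sw ?C (\<lambda>x y. kap \<phi> f (y \<otimes>\<^bsub>A\<^esub> b) \<odot>\<^bsub>?C\<^esub> ?\<pi> x) c =
      sw ?C (\<lambda>p q. ?\<pi> (?S p) \<otimes>\<^bsub>?C\<^esub> H \<phi> (c \<otimes>\<^bsub>A\<^esub> q)) b"
    if b: "b \<in> carrier A" and \<phi>: "functional_mod \<phi>" for b \<phi>
  proof -
    note k = kd[OF \<phi>]
    have inner: "?\<pi> (?S p) \<otimes>\<^bsub>?C\<^esub> H \<phi> (c \<otimes>\<^bsub>A\<^esub> q) = sw ?C (\<lambda>x y. sw ?C (\<lambda>u v.
        kap \<phi> f (y \<otimes>\<^bsub>A\<^esub> v) \<odot>\<^bsub>?C\<^esub> (?\<pi> (?S p \<otimes>\<^bsub>A\<^esub> u) \<otimes>\<^bsub>?C\<^esub> ?\<pi> x)) q) c"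
      if pq: "p \<in> carrier A" "q \<in> carrier A" for p q
    proof -
      have Sp: "?\<pi> (?S p) \<in> carrier ?C" using pq by (intro \<pi>c antipode_closed)
      have "H \<phi> (c \<otimes>\<^bsub>A\<^esub> q) = sw ?C (\<lambda>x y. sw ?C (\<lambda>u v. kap \<phi> f (y \<otimes>\<^bsub>A\<^esub> v) \<odot>\<^bsub>?C\<^esub> ?\<pi> (x \<otimes>\<^bsub>A\<^esub> u)) q) c"
        unfolding H_def by (rule sw_mult[OF BH[OF \<phi>] mC c pq(2)])
      then have "?\<pi> (?S p) \<otimes>\<^bsub>?C\<^esub> H \<phi> (c \<otimes>\<^bsub>A\<^esub> q) = ?\<pi> (?S p) \<otimes>\<^bsub>?C\<^esub>
          sw ?C (\<lambda>x y. sw ?C (\<lambda>u v. kap \<phi> f (y \<otimes>\<^bsub>A\<^esub> v) \<odot>\<^bsub>?C\<^esub> ?\<pi> (x \<otimes>\<^bsub>A\<^esub> u)) q) c"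
        by (rule arg_cong)
      also have "\<dots> = sw ?C (\<lambda>x y. ?\<pi> (?S p) \<otimes>\<^bsub>?C\<^esub>
          sw ?C (\<lambda>u v. kap \<phi> f (y \<otimes>\<^bsub>A\<^esub> v) \<odot>\<^bsub>?C\<^esub> ?\<pi> (x \<otimes>\<^bsub>A\<^esub> u)) q) c"
        using pq c k(2) \<pi>c by (intro sw_push[OF lin_mult_left[OF aC lin_id Sp] mC mC] sw_closed mC AC.N.smult_closed) auto
      also have "\<dots> = sw ?C (\<lambda>x y. sw ?C (\<lambda>u v. ?\<pi> (?S p) \<otimes>\<^bsub>?C\<^esub> (kap \<phi> f (y \<otimes>\<^bsub>A\<^esub> v) \<odot>\<^bsub>?C\<^esub> ?\<pi> (x \<otimes>\<^bsub>A\<^esub> u))) q) c"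
        using pq c k(2) \<pi>c by (intro sw_cong sw_push[OF lin_mult_left[OF aC lin_id Sp] mC mC] AC.N.smult_closed) auto
      also have "\<dots> = sw ?C (\<lambda>x y. sw ?C (\<lambda>u v.
        kap \<phi> f (y \<otimes>\<^bsub>A\<^esub> v) \<odot>\<^bsub>?C\<^esub> (?\<pi> (?S p \<otimes>\<^bsub>A\<^esub> u) \<otimes>\<^bsub>?C\<^esub> ?\<pi> x)) q) c"
        using pq c k(2) \<pi>c
        by (intro sw_cong) (simp_all del: nosimp add: \<pi>m antipode_closed C.smult_assoc2_right C.m_ac)
      finally show ?thesis .
    qed
    have "sw ?C (\<lambda>p q. ?\<pi> (?S p) \<otimes>\<^bsub>?C\<^esub> H \<phi> (c \<otimes>\<^bsub>A\<^esub> q)) b = sw ?C (\<lambda>p q. sw ?C (\<lambda>x y. sw ?C (\<lambda>u v.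
        kap \<phi> f (y \<otimes>\<^bsub>A\<^esub> v) \<odot>\<^bsub>?C\<^esub> (?\<pi> (?S p \<otimes>\<^bsub>A\<^esub> u) \<otimes>\<^bsub>?C\<^esub> ?\<pi> x)) q) c) b"
      using b by (intro sw_cong inner)
    also have "\<dots> = sw ?C (\<lambda>x y. sw ?C (\<lambda>p q. sw ?C (\<lambda>u v.
        kap \<phi> f (y \<otimes>\<^bsub>A\<^esub> v) \<odot>\<^bsub>?C\<^esub> (?\<pi> (?S p \<otimes>\<^bsub>A\<^esub> u) \<otimes>\<^bsub>?C\<^esub> ?\<pi> x)) q) b) c"
      using b c k(2) \<pi>c antipode_closed by (intro sw_swap mC sw_closed AC.N.smult_closed C.m_closed) auto
    also have "\<dots> = sw ?C (\<lambda>x y. kap \<phi> f (y \<otimes>\<^bsub>A\<^esub> b) \<odot>\<^bsub>?C\<^esub> ?\<pi> x) c"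
    proof (rule sw_cong[OF c])
      fix x y assume xy: "x \<in> carrier A" "y \<in> carrier A"
      have \<pi>Sl: "(\<lambda>x. ?\<pi> (h x \<otimes>\<^bsub>A\<^esub> u)) \<in> linear_maps K A ?C" if "u \<in> carrier A" "h \<in> linear_maps K A A" for u h
        using that by (intro lin_comp[OF lin_mult_right[OF algebra] \<pi>])
      have \<pi>Sr: "(\<lambda>u. ?\<pi> (p \<otimes>\<^bsub>A\<^esub> u)) \<in> linear_maps K A ?C" if "p \<in> carrier A" for p
        using that by (intro lin_comp[OF lin_mult_left[OF algebra lin_id] \<pi>])
      have kl: "(\<lambda>v. kap \<phi> f (y \<otimes>\<^bsub>A\<^esub> v)) \<in> linear_maps K A (scalars K)"
        by (intro lin_comp[OF lin_mult_left[OF algebra lin_id xy(2)] k(1)])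
      have "sw ?C (\<lambda>p q. sw ?C (\<lambda>u v. kap \<phi> f (y \<otimes>\<^bsub>A\<^esub> v) \<odot>\<^bsub>?C\<^esub> (?\<pi> (?S p \<otimes>\<^bsub>A\<^esub> u) \<otimes>\<^bsub>?C\<^esub> ?\<pi> x)) q) b =
          sw ?C (\<lambda>r v. sw ?C (\<lambda>p u. kap \<phi> f (y \<otimes>\<^bsub>A\<^esub> v) \<odot>\<^bsub>?C\<^esub> (?\<pi> (?S p \<otimes>\<^bsub>A\<^esub> u) \<otimes>\<^bsub>?C\<^esub> ?\<pi> x)) r) b"
        using b xy k(2) \<pi>c antipode_closed
        by (intro sw_coassoc[symmetric] mC lin_smult_const lin_smult_fun kl C.m_closed
            lin_mult_right[OF aC] \<pi>Sl[OF _ antipode] \<pi>Sr) auto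
      also have "\<dots> = sw ?C (\<lambda>r v. ?\<epsilon> r \<odot>\<^bsub>?C\<^esub> (kap \<phi> f (y \<otimes>\<^bsub>A\<^esub> v) \<odot>\<^bsub>?C\<^esub> ?\<pi> x)) b"
      proof (rule sw_cong[OF b])
        fix r v assume rv: "r \<in> carrier A" "v \<in> carrier A"
        have "(\<lambda>t. kap \<phi> f (y \<otimes>\<^bsub>A\<^esub> v) \<odot>\<^bsub>?C\<^esub> (?\<pi> t \<otimes>\<^bsub>?C\<^esub> ?\<pi> x)) \<in> linear_maps K A ?C"
          using rv xy k(2) \<pi>c by (intro lin_smult_const lin_mult_right[OF aC \<pi>] mC) auto
        from sw_antipode_left[OF mC rv(1) this]
        show "sw ?C (\<lambda>p u. kap \<phi> f (y \<otimes>\<^bsub>A\<^esub> v) \<odot>\<^bsub>?C\<^esub> (?\<pi> (?S p \<otimes>\<^bsub>A\<^esub> u) \<otimes>\<^bsub>?C\<^esub> ?\<pi> x)) r =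
            ?\<epsilon> r \<odot>\<^bsub>?C\<^esub> (kap \<phi> f (y \<otimes>\<^bsub>A\<^esub> v) \<odot>\<^bsub>?C\<^esub> ?\<pi> x)"
          using \<pi>c[OF xy(1)] by (simp del: nosimp add: \<pi>1)
      qed
      also have "\<dots> = kap \<phi> f (y \<otimes>\<^bsub>A\<^esub> b) \<odot>\<^bsub>?C\<^esub> ?\<pi> x"
        by (intro sw_counit_left mC b lin_smult_fun kl \<pi>c xy)
      finally show "sw ?C (\<lambda>p q. sw ?C (\<lambda>u v. kap \<phi> f (y \<otimes>\<^bsub>A\<^esub> v) \<odot>\<^bsub>?C\<^esub>
          (?\<pi> (?S p \<otimes>\<^bsub>A\<^esub> u) \<otimes>\<^bsub>?C\<^esub> ?\<pi> x)) q) b = kap \<phi> f (y \<otimes>\<^bsub>A\<^esub> b) \<odot>\<^bsub>?C\<^esub> ?\<pi> x" .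
    qed
    finally show ?thesis by simp
  qed
  \<comment> \<open>Expanding the second leg of \<open>b\<close> along \<open>E\<close> turns the
    right-hand side of \<open>step1\<close> into a product of the two matrices.\<close>
  have step2: "sw ?C (\<lambda>p q. ?\<pi> (?S p) \<otimes>\<^bsub>?C\<^esub> H \<phi> (c \<otimes>\<^bsub>A\<^esub> q)) b =
      tsum ?C (\<lambda>b' \<phi>'. G \<phi>' b \<otimes>\<^bsub>?C\<^esub> H \<phi> (c \<otimes>\<^bsub>A\<^esub> b')) E"
    if b: "b \<in> carrier A" and \<phi>: "functional_mod \<phi>" for b \<phi>
  proof -
    note h = H[OF \<phi>]
    have "sw ?C (\<lambda>p q. ?\<pi> (?S p) \<otimes>\<^bsub>?C\<^esub> H \<phi> (c \<otimes>\<^bsub>A\<^esub> q)) b =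
        sw ?C (\<lambda>p q. tsum ?C (\<lambda>b' \<phi>'. (\<phi>' q \<odot>\<^bsub>?C\<^esub> ?\<pi> (?S p)) \<otimes>\<^bsub>?C\<^esub> H \<phi> (c \<otimes>\<^bsub>A\<^esub> b')) E) b"
    proof (rule sw_cong[OF b])
      fix p q assume pq: "p \<in> carrier A" "q \<in> carrier A"
      have Sp: "?\<pi> (?S p) \<in> carrier ?C" using pq by (intro \<pi>c antipode_closed)
      have "?\<pi> (?S p) \<otimes>\<^bsub>?C\<^esub> H \<phi> (c \<otimes>\<^bsub>A\<^esub> q) =
          tsum ?C (\<lambda>b' \<phi>'. \<phi>' q \<odot>\<^bsub>?C\<^esub> (?\<pi> (?S p) \<otimes>\<^bsub>?C\<^esub> H \<phi> (c \<otimes>\<^bsub>A\<^esub> b'))) E"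
      proof (rule E_expand[OF mC _ _ pq(2)])
        show "(\<lambda>q. ?\<pi> (?S p) \<otimes>\<^bsub>?C\<^esub> H \<phi> (c \<otimes>\<^bsub>A\<^esub> q)) \<in> linear_maps K A ?C"
          using Sp c by (intro lin_mult_left[OF aC] lin_comp[OF lin_mult_left[OF algebra lin_id] h(1)])
        fix x assume "x \<in> I"
        then have "c \<otimes>\<^bsub>A\<^esub> x \<in> I" using c by (intro Q.I.I_l_closed)
        then show "?\<pi> (?S p) \<otimes>\<^bsub>?C\<^esub> H \<phi> (c \<otimes>\<^bsub>A\<^esub> x) = \<zero>\<^bsub>?C\<^esub>" using h(3) Sp by (simp del: nosimp)
      qed
      also have "\<dots> = tsum ?C (\<lambda>b' \<phi>'. (\<phi>' q \<odot>\<^bsub>?C\<^esub> ?\<pi> (?S p)) \<otimes>\<^bsub>?C\<^esub> H \<phi> (c \<otimes>\<^bsub>A\<^esub> b')) E"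
        using ED(1) functional_modD(2)[OF ED(2)] pq c h(2) Sp
        by (intro tsum_cong C.smult_assoc2[symmetric]) auto
      finally show "?\<pi> (?S p) \<otimes>\<^bsub>?C\<^esub> H \<phi> (c \<otimes>\<^bsub>A\<^esub> q) =
          tsum ?C (\<lambda>b' \<phi>'. (\<phi>' q \<odot>\<^bsub>?C\<^esub> ?\<pi> (?S p)) \<otimes>\<^bsub>?C\<^esub> H \<phi> (c \<otimes>\<^bsub>A\<^esub> b')) E" .
    qed
    also have "\<dots> = tsum ?C (\<lambda>b' \<phi>'. sw ?C (\<lambda>p q. (\<phi>' q \<odot>\<^bsub>?C\<^esub> ?\<pi> (?S p)) \<otimes>\<^bsub>?C\<^esub> H \<phi> (c \<otimes>\<^bsub>A\<^esub> b')) b) E"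
      using ED(1) functional_modD(2)[OF ED(2)] c h(2) \<pi>c antipode_closed
      by (intro sw_tsum_swap mC b C.m_closed AC.N.smult_closed) auto
    also have "\<dots> = tsum ?C (\<lambda>b' \<phi>'. G \<phi>' b \<otimes>\<^bsub>?C\<^esub> H \<phi> (c \<otimes>\<^bsub>A\<^esub> b')) E"
      unfolding G_def using ED(1) functional_modD(2)[OF ED(2)] c h(2) \<pi>c antipode_closed
      by (intro tsum_cong sw_push[OF lin_mult_right[OF aC lin_id] mC mC b, symmetric] AC.N.smult_closed) auto
    finally show ?thesis .
  qed
  \<comment> \<open>The inverse undoes \<Phi>:
    \<open>p\<^sub>1 S(p\<^sub>2) \<otimes> p\<^sub>3\<close> is \<open>1 \<otimes> p\<close>, read
    in the \<phi>'-coordinate.\<close>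
  have G\<pi>: "sw ?C (\<lambda>z x. G \<phi>' x \<otimes>\<^bsub>?C\<^esub> ?\<pi> z) p = \<phi>' p \<odot>\<^bsub>?C\<^esub> ?\<pi> \<one>\<^bsub>A\<^esub>"
    if \<phi>': "functional_mod \<phi>'" and p: "p \<in> carrier A" for \<phi>' p
  proof -
    note d = functional_modD[OF \<phi>']
    have \<pi>Sr: "(\<lambda>u. ?\<pi> (z \<otimes>\<^bsub>A\<^esub> ?S u)) \<in> linear_maps K A ?C"
      and \<pi>Sl: "(\<lambda>u. ?\<pi> (u \<otimes>\<^bsub>A\<^esub> ?S z)) \<in> linear_maps K A ?C" if "z \<in> carrier A" for z
      using that antipode_closed
      by (intro lin_comp[OF lin_mult_left[OF algebra antipode] \<pi>] lin_comp[OF lin_mult_right[OF algebra lin_id] \<pi>]; simp)+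
    have "sw ?C (\<lambda>z x. G \<phi>' x \<otimes>\<^bsub>?C\<^esub> ?\<pi> z) p =
        sw ?C (\<lambda>z x. sw ?C (\<lambda>x y. \<phi>' y \<odot>\<^bsub>?C\<^esub> ?\<pi> (z \<otimes>\<^bsub>A\<^esub> ?S x)) x) p"
    proof (rule sw_cong[OF p])
      fix z x assume zx: "z \<in> carrier A" "x \<in> carrier A"
      have "G \<phi>' x \<otimes>\<^bsub>?C\<^esub> ?\<pi> z = sw ?C (\<lambda>x y. (\<phi>' y \<odot>\<^bsub>?C\<^esub> ?\<pi> (?S x)) \<otimes>\<^bsub>?C\<^esub> ?\<pi> z) x"
        unfolding G_def using zx d(2) \<pi>c antipode_closed
        by (intro sw_push[OF lin_mult_right[OF aC lin_id] mC mC] AC.N.smult_closed) auto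
      also have "\<dots> = sw ?C (\<lambda>x y. \<phi>' y \<odot>\<^bsub>?C\<^esub> ?\<pi> (z \<otimes>\<^bsub>A\<^esub> ?S x)) x"
        using zx d(2) \<pi>c antipode_closed
        by (intro sw_cong) (simp_all del: nosimp add: C.smult_assoc2 C.smult_assoc2_right \<pi>m C.m_comm)
      finally show "G \<phi>' x \<otimes>\<^bsub>?C\<^esub> ?\<pi> z = sw ?C (\<lambda>x y. \<phi>' y \<odot>\<^bsub>?C\<^esub> ?\<pi> (z \<otimes>\<^bsub>A\<^esub> ?S x)) x" .
    qed
    also have "\<dots> = sw ?C (\<lambda>q y. sw ?C (\<lambda>z x. \<phi>' y \<odot>\<^bsub>?C\<^esub> ?\<pi> (z \<otimes>\<^bsub>A\<^esub> ?S x)) q) p"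
      using p d(2) \<pi>c antipode_closed
      by (intro sw_coassoc[symmetric] mC lin_smult_const lin_smult_fun d(1) \<pi>Sl \<pi>Sr) auto
    also have "\<dots> = sw ?C (\<lambda>q y. ?\<epsilon> q \<odot>\<^bsub>?C\<^esub> (\<phi>' y \<odot>\<^bsub>?C\<^esub> ?\<pi> \<one>\<^bsub>A\<^esub>)) p"
      using d(2) by (intro sw_cong p sw_antipode_right[OF mC] lin_smult_const mC \<pi>) auto
    also have "\<dots> = \<phi>' p \<odot>\<^bsub>?C\<^esub> ?\<pi> \<one>\<^bsub>A\<^esub>"
      using \<pi>c by (intro sw_counit_left mC p lin_smult_fun d(1)) auto
    finally show ?thesis .
  qed
  \<comment> \<open>The product of the matrices in the opposite order. The sum over \<open>b\<close>
    evaluates \<open>G\<close> at the second leg of \<open>w\<close>, where \<open>G\<pi>\<close>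
    cancels it against the first leg; only an entry of the operator itself is left.\<close>
  have step3: "tsum ?C (\<lambda>b \<phi>. G \<phi>' b \<otimes>\<^bsub>?C\<^esub> H \<phi> w) E = kap \<phi>' f w \<odot>\<^bsub>?C\<^esub> ?\<pi> \<one>\<^bsub>A\<^esub>"
    if w: "w \<in> carrier A" and \<phi>': "functional_mod \<phi>'" for w \<phi>'
  proof -
    note d' = functional_modD[OF \<phi>'] and g = G[OF \<phi>']
    have Ed: "\<phi> x \<in> carrier K" if "(b, \<phi>) \<in> set E" "x \<in> carrier A" for b \<phi> x
      using functional_modD(2)[OF ED(2)[OF that(1)] that(2)] .
    have "tsum ?C (\<lambda>b \<phi>. G \<phi>' b \<otimes>\<^bsub>?C\<^esub> H \<phi> w) E =
        tsum ?C (\<lambda>b \<phi>. sw ?C (\<lambda>z t. kap \<phi> f t \<odot>\<^bsub>?C\<^esub> (G \<phi>' b \<otimes>\<^bsub>?C\<^esub> ?\<pi> z)) w) E"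
    proof (rule tsum_cong)
      fix b \<phi> assume "(b, \<phi>) \<in> set E"
      note e = ED[OF this]
      have "G \<phi>' b \<otimes>\<^bsub>?C\<^esub> H \<phi> w = sw ?C (\<lambda>z t. G \<phi>' b \<otimes>\<^bsub>?C\<^esub> (kap \<phi> f t \<odot>\<^bsub>?C\<^esub> ?\<pi> z)) w"
        unfolding H_def using w g(2)[OF e(1)] kd(2)[OF e(2)] \<pi>c
        by (intro sw_push[OF lin_mult_left[OF aC lin_id] mC mC] AC.N.smult_closed) auto
      also have "\<dots> = sw ?C (\<lambda>z t. kap \<phi> f t \<odot>\<^bsub>?C\<^esub> (G \<phi>' b \<otimes>\<^bsub>?C\<^esub> ?\<pi> z)) w"
        using g(2)[OF e(1)] kd(2)[OF e(2)] \<pi>c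
        by (intro sw_cong w C.smult_assoc2_right) auto
      finally show "G \<phi>' b \<otimes>\<^bsub>?C\<^esub> H \<phi> w = sw ?C (\<lambda>z t. kap \<phi> f t \<odot>\<^bsub>?C\<^esub> (G \<phi>' b \<otimes>\<^bsub>?C\<^esub> ?\<pi> z)) w" .
    qed
    also have "\<dots> = sw ?C (\<lambda>z t. tsum ?C (\<lambda>b \<phi>. kap \<phi> f t \<odot>\<^bsub>?C\<^esub> (G \<phi>' b \<otimes>\<^bsub>?C\<^esub> ?\<pi> z)) E) w"
      using ED g(2) kd(2) \<pi>c by (intro sw_tsum_swap[symmetric] mC w AC.N.smult_closed C.m_closed) auto
    also have "\<dots> = sw ?C (\<lambda>z t. sw ?C (\<lambda>x y. f y \<odot>\<^bsub>?C\<^esub> (G \<phi>' x \<otimes>\<^bsub>?C\<^esub> ?\<pi> z)) t) w"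
    proof (rule sw_cong[OF w])
      fix z t assume zt: "z \<in> carrier A" "t \<in> carrier A"
      note pz = \<pi>c[OF zt(1)]
      have "tsum ?C (\<lambda>b \<phi>. kap \<phi> f t \<odot>\<^bsub>?C\<^esub> (G \<phi>' b \<otimes>\<^bsub>?C\<^esub> ?\<pi> z)) E =
          tsum ?C (\<lambda>b \<phi>. sw ?C (\<lambda>x y. (\<phi> x \<otimes>\<^bsub>K\<^esub> f y) \<odot>\<^bsub>?C\<^esub> (G \<phi>' b \<otimes>\<^bsub>?C\<^esub> ?\<pi> z)) t) E"
      proof (rule tsum_cong)
        fix b \<phi> assume b: "(b, \<phi>) \<in> set E"
        have "(\<lambda>k. k \<odot>\<^bsub>?C\<^esub> (G \<phi>' b \<otimes>\<^bsub>?C\<^esub> ?\<pi> z)) \<in> linear_maps K (scalars K) ?C"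
          using pz g(2)[OF ED(1)[OF b]] by (intro lin_smult_fun lin_id mC C.m_closed)
        from sw_push[OF this module_scalars mC zt(2)]
        show "kap \<phi> f t \<odot>\<^bsub>?C\<^esub> (G \<phi>' b \<otimes>\<^bsub>?C\<^esub> ?\<pi> z) = sw ?C (\<lambda>x y. (\<phi> x \<otimes>\<^bsub>K\<^esub> f y) \<odot>\<^bsub>?C\<^esub> (G \<phi>' b \<otimes>\<^bsub>?C\<^esub> ?\<pi> z)) t"
          unfolding kap_def using Ed[OF b] fd(2) by simp
      qed
      also have "\<dots> = sw ?C (\<lambda>x y. tsum ?C (\<lambda>b \<phi>. (\<phi> x \<otimes>\<^bsub>K\<^esub> f y) \<odot>\<^bsub>?C\<^esub> (G \<phi>' b \<otimes>\<^bsub>?C\<^esub> ?\<pi> z)) E) t"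
        using ED(1) Ed fd(2) g(2) pz zt
        by (intro sw_tsum_swap[symmetric] mC AC.N.smult_closed C.m_closed) auto
      also have "\<dots> = sw ?C (\<lambda>x y. f y \<odot>\<^bsub>?C\<^esub> (G \<phi>' x \<otimes>\<^bsub>?C\<^esub> ?\<pi> z)) t"
      proof (rule sw_cong[OF zt(2)])
        fix x y assume xy: "x \<in> carrier A" "y \<in> carrier A"
        have "f y \<odot>\<^bsub>?C\<^esub> (G \<phi>' x \<otimes>\<^bsub>?C\<^esub> ?\<pi> z) = tsum ?C (\<lambda>b \<phi>. \<phi> x \<odot>\<^bsub>?C\<^esub> (f y \<odot>\<^bsub>?C\<^esub> (G \<phi>' b \<otimes>\<^bsub>?C\<^esub> ?\<pi> z))) E"
        proof (rule E_expand[OF mC _ _ xy(1)])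
          show "(\<lambda>x. f y \<odot>\<^bsub>?C\<^esub> (G \<phi>' x \<otimes>\<^bsub>?C\<^esub> ?\<pi> z)) \<in> linear_maps K A ?C"
            using fd(2)[OF xy(2)] pz by (intro lin_smult_const lin_mult_right[OF aC g(1)] mC)
          show "f y \<odot>\<^bsub>?C\<^esub> (G \<phi>' x \<otimes>\<^bsub>?C\<^esub> ?\<pi> z) = \<zero>\<^bsub>?C\<^esub>" if "x \<in> I" for x
            using g(3)[OF that] fd(2)[OF xy(2)] pz by (simp del: nosimp)
        qed
        also have "\<dots> = tsum ?C (\<lambda>b \<phi>. (\<phi> x \<otimes>\<^bsub>K\<^esub> f y) \<odot>\<^bsub>?C\<^esub> (G \<phi>' b \<otimes>\<^bsub>?C\<^esub> ?\<pi> z)) E"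
          using ED(1) Ed fd(2) g(2) pz xy by (intro tsum_cong AC.N.smult_assoc1[symmetric] C.m_closed) auto
        finally show "tsum ?C (\<lambda>b \<phi>. (\<phi> x \<otimes>\<^bsub>K\<^esub> f y) \<odot>\<^bsub>?C\<^esub> (G \<phi>' b \<otimes>\<^bsub>?C\<^esub> ?\<pi> z)) E = f y \<odot>\<^bsub>?C\<^esub> (G \<phi>' x \<otimes>\<^bsub>?C\<^esub> ?\<pi> z)"
          by simp
      qed
      finally show "tsum ?C (\<lambda>b \<phi>. kap \<phi> f t \<odot>\<^bsub>?C\<^esub> (G \<phi>' b \<otimes>\<^bsub>?C\<^esub> ?\<pi> z)) E =
          sw ?C (\<lambda>x y. f y \<odot>\<^bsub>?C\<^esub> (G \<phi>' x \<otimes>\<^bsub>?C\<^esub> ?\<pi> z)) t" .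
    qed
    also have "\<dots> = sw ?C (\<lambda>q y. sw ?C (\<lambda>z x. f y \<odot>\<^bsub>?C\<^esub> (G \<phi>' x \<otimes>\<^bsub>?C\<^esub> ?\<pi> z)) q) w"
      using fd(2) g(2) \<pi>c w
      by (intro sw_coassoc[symmetric] mC lin_smult_const lin_smult_fun fd(1) C.m_closed
          lin_mult_left[OF aC \<pi>] lin_mult_right[OF aC g(1)]) auto
    also have "\<dots> = sw ?C (\<lambda>q y. (\<phi>' q \<otimes>\<^bsub>K\<^esub> f y) \<odot>\<^bsub>?C\<^esub> ?\<pi> \<one>\<^bsub>A\<^esub>) w"
    proof (rule sw_cong[OF w])
      fix q y assume qy: "q \<in> carrier A" "y \<in> carrier A"
      have "sw ?C (\<lambda>z x. f y \<odot>\<^bsub>?C\<^esub> (G \<phi>' x \<otimes>\<^bsub>?C\<^esub> ?\<pi> z)) q = f y \<odot>\<^bsub>?C\<^esub> sw ?C (\<lambda>z x. G \<phi>' x \<otimes>\<^bsub>?C\<^esub> ?\<pi> z) q"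
        using fd(2) g(2) \<pi>c qy
        by (intro sw_push[OF lin_smult_const[OF mC lin_id] mC mC, symmetric] C.m_closed) auto
      also have "\<dots> = (\<phi>' q \<otimes>\<^bsub>K\<^esub> f y) \<odot>\<^bsub>?C\<^esub> ?\<pi> \<one>\<^bsub>A\<^esub>"
        using G\<pi>[OF \<phi>' qy(1)] fd(2)[OF qy(2)] d'(2)[OF qy(1)] \<pi>c[OF A.one_closed]
        by (simp del: nosimp add: AC.N.smult_assoc1[symmetric] K.m_comm)
      finally show "sw ?C (\<lambda>z x. f y \<odot>\<^bsub>?C\<^esub> (G \<phi>' x \<otimes>\<^bsub>?C\<^esub> ?\<pi> z)) q = (\<phi>' q \<otimes>\<^bsub>K\<^esub> f y) \<odot>\<^bsub>?C\<^esub> ?\<pi> \<one>\<^bsub>A\<^esub>" .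
    qed
    also have "\<dots> = kap \<phi>' f w \<odot>\<^bsub>?C\<^esub> ?\<pi> \<one>\<^bsub>A\<^esub>"
    proof -
      have "(\<lambda>k. k \<odot>\<^bsub>?C\<^esub> ?\<pi> \<one>\<^bsub>A\<^esub>) \<in> linear_maps K (scalars K) ?C"
        by (intro lin_smult_fun lin_id mC \<pi>c A.one_closed)
      from sw_push[OF this module_scalars mC w, of "\<lambda>q y. \<phi>' q \<otimes>\<^bsub>K\<^esub> f y"]
      show ?thesis unfolding kap_def using d'(2) fd(2) by simp
    qed
    finally show ?thesis .
  qed
  have "sw ?C (\<lambda>x y. integral f y \<odot>\<^bsub>?C\<^esub> ?\<pi> x) c =
      sw ?C (\<lambda>x y. tsum ?C (\<lambda>b \<phi>. kap \<phi> f (y \<otimes>\<^bsub>A\<^esub> b) \<odot>\<^bsub>?C\<^esub> ?\<pi> x) E) c"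
    unfolding integral_def
  proof (rule sw_cong[OF c])
    fix x y assume xy: "x \<in> carrier A" "y \<in> carrier A"
    have "(\<lambda>k. k \<odot>\<^bsub>?C\<^esub> ?\<pi> x) \<in> linear_maps K (scalars K) ?C"
      using \<pi>c[OF xy(1)] by (intro lin_smult_fun lin_id mC)
    then show "tsum (scalars K) (\<lambda>b \<phi>. kap \<phi> f (y \<otimes>\<^bsub>A\<^esub> b)) E \<odot>\<^bsub>?C\<^esub> ?\<pi> x = tsum ?C (\<lambda>b \<phi>. kap \<phi> f (y \<otimes>\<^bsub>A\<^esub> b) \<odot>\<^bsub>?C\<^esub> ?\<pi> x) E"
      using ED kd(2) xy by (intro lin_tsum[OF _ module_scalars mC]) auto
  qed
  also have "\<dots> = tsum ?C (\<lambda>b \<phi>. sw ?C (\<lambda>x y. kap \<phi> f (y \<otimes>\<^bsub>A\<^esub> b) \<odot>\<^bsub>?C\<^esub> ?\<pi> x) c) E"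
    using ED kd(2) \<pi>c by (intro sw_tsum_swap mC c AC.N.smult_closed) auto
  also have "\<dots> = tsum ?C (\<lambda>b \<phi>. tsum ?C (\<lambda>b' \<phi>'. G \<phi>' b \<otimes>\<^bsub>?C\<^esub> H \<phi> (c \<otimes>\<^bsub>A\<^esub> b')) E) E"
    using ED by (intro tsum_cong) (simp del: nosimp add: step1 step2)
  \<comment> \<open>Cyclicity of the trace: exchanging the two summations reverses the order in
    which the matrices are multiplied.\<close>
  also have "\<dots> = tsum ?C (\<lambda>b' \<phi>'. tsum ?C (\<lambda>b \<phi>. G \<phi>' b \<otimes>\<^bsub>?C\<^esub> H \<phi> (c \<otimes>\<^bsub>A\<^esub> b')) E) E"
    using ED G(2) H(2) c by (intro AC.N.tsum_swap C.m_closed) auto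
  also have "\<dots> = tsum ?C (\<lambda>b' \<phi>'. kap \<phi>' f (c \<otimes>\<^bsub>A\<^esub> b') \<odot>\<^bsub>?C\<^esub> ?\<pi> \<one>\<^bsub>A\<^esub>) E"
    using ED c by (intro tsum_cong step3) auto
  also have "\<dots> = integral f c \<odot>\<^bsub>?C\<^esub> ?\<pi> \<one>\<^bsub>A\<^esub>"
    unfolding integral_def using ED kd(2) c \<pi>c
    by (intro lin_tsum[OF lin_smult_fun[OF mC lin_id] module_scalars mC, symmetric]) auto
  finally show ?thesis .
qed

text \<open>Integration along the right cosets of the \<open>H\<close>-action, a substitute for
  averaging. With \<open>T\<close> the integral, the right coaction of
  \<open>a\<^sub>1 T(a\<^sub>2)\<close> is
  \<open>a\<^sub>1 \<otimes> a\<^sub>2 T(a\<^sub>3)\<close>, and invariance of \<open>T\<close>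
  turns \<open>a\<^sub>2 T(a\<^sub>3)\<close> into \<open>T(a\<^sub>2) 1\<close> modulo
  \<open>I\<close>.\<close>

lemma integral_action_V:
  assumes f: "functional_mod f" and a: "a \<in> carrier A"
  shows "sw A (\<lambda>x y. integral f y \<odot>\<^bsub>A\<^esub> x) a \<in> V"
  unfolding V_iff
proof
  let ?T = "integral f"
  note Td = functional_modD[OF functional_mod_integral[OF f]]
  let ?\<tau> = "sw AC.T (\<lambda>x y. AC.pure x (Q.\<pi> y))"
  note s = sw_linear[OF bilinear_pure_\<pi> AC.module_tensor]
    and p = bilinear_left[OF AC.bilinear_pure Q.\<pi>_closed[OF A.one_closed]]
  have pc: "AC.pure x (Q.\<pi> y) \<in> carrier AC.T" if "x \<in> carrier A" "y \<in> carrier A" for x y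
    using bilinear_closed[OF bilinear_pure_\<pi> that] .
  show "sw A (\<lambda>x y. ?T y \<odot>\<^bsub>A\<^esub> x) a \<in> carrier A"
    using a Td(2) by (intro sw_closed module_A) auto
  have "?\<tau> (sw A (\<lambda>x y. ?T y \<odot>\<^bsub>A\<^esub> x) a) = sw AC.T (\<lambda>x z. ?\<tau> (?T z \<odot>\<^bsub>A\<^esub> x)) a"
    using a Td(2) by (intro sw_push[OF s module_A AC.module_tensor]) auto
  also have "\<dots> = sw AC.T (\<lambda>x z. sw AC.T (\<lambda>x y. ?T z \<odot>\<^bsub>AC.T\<^esub> AC.pure x (Q.\<pi> y)) x) a"
  proof (rule sw_cong[OF a])
    fix x z assume xz: "x \<in> carrier A" "z \<in> carrier A"
    have "?\<tau> (?T z \<odot>\<^bsub>A\<^esub> x) = ?T z \<odot>\<^bsub>AC.T\<^esub> ?\<tau> x" by (rule lin_smult[OF s Td(2)[OF xz(2)] xz(1)])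
    also have "\<dots> = sw AC.T (\<lambda>x y. ?T z \<odot>\<^bsub>AC.T\<^esub> AC.pure x (Q.\<pi> y)) x"
      using Td(2)[OF xz(2)] pc
      by (intro sw_push[OF lin_smult_const[OF AC.module_tensor lin_id] AC.module_tensor AC.module_tensor xz(1)]) auto
    finally show "?\<tau> (?T z \<odot>\<^bsub>A\<^esub> x) = sw AC.T (\<lambda>x y. ?T z \<odot>\<^bsub>AC.T\<^esub> AC.pure x (Q.\<pi> y)) x" .
  qed
  also have "\<dots> = sw AC.T (\<lambda>x y. sw AC.T (\<lambda>y z. ?T z \<odot>\<^bsub>AC.T\<^esub> AC.pure x (Q.\<pi> y)) y) a"
    using Td(2) pc
    by (intro sw_coassoc a AC.module_tensor lin_smult_fun lin_smult_const Td(1)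
        bilinear_left[OF bilinear_pure_\<pi>] bilinear_right[OF bilinear_pure_\<pi>]) auto
  also have "\<dots> = sw AC.T (\<lambda>x y. AC.pure (?T y \<odot>\<^bsub>A\<^esub> x) (Q.\<pi> \<one>\<^bsub>A\<^esub>)) a"
  proof (rule sw_cong[OF a])
    fix x y assume xy: "x \<in> carrier A" "y \<in> carrier A"
    note r = bilinear_right[OF AC.bilinear_pure xy(1)]
    have "sw AC.T (\<lambda>y z. ?T z \<odot>\<^bsub>AC.T\<^esub> AC.pure x (Q.\<pi> y)) y = sw AC.T (\<lambda>y z. AC.pure x (?T z \<odot>\<^bsub>Q.C\<^esub> Q.\<pi> y)) y"
      using Td(2) Q.\<pi>_closed by (intro sw_cong xy lin_smult[OF r, symmetric]) auto
    also have "\<dots> = AC.pure x (sw Q.C (\<lambda>y z. ?T z \<odot>\<^bsub>Q.C\<^esub> Q.\<pi> y) y)"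
      using Td(2) Q.\<pi>_closed
      by (intro sw_push[OF r Q.module_C AC.module_tensor xy(2), symmetric] AC.N.smult_closed) auto
    also have "\<dots> = AC.pure x (?T y \<odot>\<^bsub>Q.C\<^esub> Q.\<pi> \<one>\<^bsub>A\<^esub>)" by (simp only: integral_invariant[OF f xy(2)])
    also have "\<dots> = ?T y \<odot>\<^bsub>AC.T\<^esub> AC.pure x (Q.\<pi> \<one>\<^bsub>A\<^esub>)"
      by (rule lin_smult[OF r Td(2)[OF xy(2)] Q.\<pi>_closed[OF A.one_closed]])
    also have "\<dots> = AC.pure (?T y \<odot>\<^bsub>A\<^esub> x) (Q.\<pi> \<one>\<^bsub>A\<^esub>)"
      by (rule lin_smult[OF p Td(2)[OF xy(2)] xy(1), symmetric])
    finally show "sw AC.T (\<lambda>y z. ?T z \<odot>\<^bsub>AC.T\<^esub> AC.pure x (Q.\<pi> y)) y = AC.pure (?T y \<odot>\<^bsub>A\<^esub> x) (Q.\<pi> \<one>\<^bsub>A\<^esub>)" .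
  qed
  also have "\<dots> = AC.pure (sw A (\<lambda>x y. ?T y \<odot>\<^bsub>A\<^esub> x) a) (Q.\<pi> \<one>\<^bsub>A\<^esub>)"
    using Td(2) by (intro sw_push[OF p module_A AC.module_tensor a, symmetric]) auto
  finally show "?\<tau> (sw A (\<lambda>x y. ?T y \<odot>\<^bsub>A\<^esub> x) a) = AC.pure (sw A (\<lambda>x y. ?T y \<odot>\<^bsub>A\<^esub> x) a) (Q.\<pi> \<one>\<^bsub>A\<^esub>)" .
qed

text \<open>The left-hand side is the trace on the coordinate ring of \<open>H\<close> squared of
  \<open>x \<otimes> y \<mapsto> \<Delta>(c S(y) x)\<close>, hence also the trace of \<open>x \<mapsto> c S(x\<^sub>2) x\<^sub>1 = \<epsilon>(x) c\<close>.\<close>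

lemma integral_counit:
  assumes c: "c \<in> carrier A"
  shows "tsum (scalars K) (\<lambda>b \<phi>. integral \<phi> (c \<otimes>\<^bsub>A\<^esub> antipode A b)) E = counit A c"
proof -
  let ?Ks = "scalars K" and ?S = "antipode A"
  interpret KS: algebra K ?Ks by (rule algebra_Ks)
  note mK = module_scalars and S = antipode_closed
  have Ed: "\<phi> x \<in> carrier K" if "(b, \<phi>) \<in> set E" "x \<in> carrier A" for b \<phi> x
    using functional_modD(2)[OF ED(2)[OF that(1)] that(2)] .
  have kc: "kap \<phi>2 \<phi> z \<in> carrier K" if "(b, \<phi>) \<in> set E" "(b2, \<phi>2) \<in> set E" "z \<in> carrier A" for b \<phi> b2 \<phi>2 z
    using functional_modD(2)[OF functional_mod_kap[OF ED(2)[OF that(2)] ED(2)[OF that(1)]] that(3)] .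
  \<comment> \<open>The operator is the map \<open>x \<otimes> y \<mapsto> c S(y) x\<close> into
    \<open>A/I\<close> followed by the comultiplication. The pair \<open>(d, \<chi>)\<close> is
    inserted between the two factors, so each summand is an entry of one times an entry of the
    other.\<close>
  let ?t = "\<lambda>b \<phi> b2 \<phi>2 d \<chi>. \<chi> ((c \<otimes>\<^bsub>A\<^esub> ?S b) \<otimes>\<^bsub>A\<^esub> b2) \<otimes>\<^bsub>K\<^esub> kap \<phi>2 \<phi> d"
  have tc: "?t b \<phi> b2 \<phi>2 d \<chi> \<in> carrier ?Ks"
    if "(b, \<phi>) \<in> set E" "(b2, \<phi>2) \<in> set E" "(d, \<chi>) \<in> set E" for b \<phi> b2 \<phi>2 d \<chi>
    using Ed[OF that(3)] kc[OF that(1,2)] ED(1)[OF that(1)] ED(1)[OF that(2)] ED(1)[OF that(3)] c S by simp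
  have "tsum ?Ks (\<lambda>b \<phi>. integral \<phi> (c \<otimes>\<^bsub>A\<^esub> ?S b)) E =
      tsum ?Ks (\<lambda>b \<phi>. tsum ?Ks (\<lambda>b2 \<phi>2. tsum ?Ks (\<lambda>d \<chi>. ?t b \<phi> b2 \<phi>2 d \<chi>) E) E) E"
    unfolding integral_def
  proof (intro tsum_cong)
    fix b \<phi> b2 \<phi>2 assume b: "(b, \<phi>) \<in> set E" and b2: "(b2, \<phi>2) \<in> set E"
    note k = functional_modD[OF functional_mod_kap[OF ED(2)[OF b2] ED(2)[OF b]]]
    show "kap \<phi>2 \<phi> ((c \<otimes>\<^bsub>A\<^esub> ?S b) \<otimes>\<^bsub>A\<^esub> b2) = tsum ?Ks (\<lambda>d \<chi>. ?t b \<phi> b2 \<phi>2 d \<chi>) E"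
      using E_expand[OF mK k(1), of "(c \<otimes>\<^bsub>A\<^esub> ?S b) \<otimes>\<^bsub>A\<^esub> b2"] k(3) ED(1)[OF b] ED(1)[OF b2] c S by simp
  qed
  also have "\<dots> = tsum ?Ks (\<lambda>b \<phi>. tsum ?Ks (\<lambda>d \<chi>. tsum ?Ks (\<lambda>b2 \<phi>2. ?t b \<phi> b2 \<phi>2 d \<chi>) E) E) E"
    by (intro tsum_cong KS.tsum_swap tc)
  \<comment> \<open>With the sum over \<open>d\<close> outermost, the expression is the trace on
    \<open>A/I\<close> of the two factors composed in the opposite order.\<close>
  also have "\<dots> = tsum ?Ks (\<lambda>d \<chi>. tsum ?Ks (\<lambda>b \<phi>. tsum ?Ks (\<lambda>b2 \<phi>2. ?t b \<phi> b2 \<phi>2 d \<chi>) E) E) E"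
    by (intro KS.tsum_swap KS.tsum_closed tc)
  also have "\<dots> = tsum ?Ks (\<lambda>d \<chi>. \<chi> c \<odot>\<^bsub>?Ks\<^esub> counit A d) E"
  proof (rule tsum_cong)
    fix d \<chi> assume d\<chi>: "(d, \<chi>) \<in> set E"
    note dA = ED(1)[OF d\<chi>] and \<chi> = functional_modD[OF ED(2)[OF d\<chi>]]
    have \<chi>c: "\<chi> ((c \<otimes>\<^bsub>A\<^esub> ?S b) \<otimes>\<^bsub>A\<^esub> b2) \<in> carrier K" if "b \<in> carrier A" "b2 \<in> carrier A" for b b2
      using that c S by (intro \<chi>(2)) auto
    have "tsum ?Ks (\<lambda>b \<phi>. tsum ?Ks (\<lambda>b2 \<phi>2. ?t b \<phi> b2 \<phi>2 d \<chi>) E) E =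
        tsum ?Ks (\<lambda>b \<phi>. tsum ?Ks (\<lambda>b2 \<phi>2.
          sw ?Ks (\<lambda>x y. \<chi> ((c \<otimes>\<^bsub>A\<^esub> ?S b) \<otimes>\<^bsub>A\<^esub> b2) \<otimes>\<^bsub>K\<^esub> (\<phi>2 x \<otimes>\<^bsub>K\<^esub> \<phi> y)) d) E) E"
    proof (intro tsum_cong)
      fix b \<phi> b2 \<phi>2 assume b: "(b, \<phi>) \<in> set E" and b2: "(b2, \<phi>2) \<in> set E"
      have "(\<lambda>k. \<chi> ((c \<otimes>\<^bsub>A\<^esub> ?S b) \<otimes>\<^bsub>A\<^esub> b2) \<odot>\<^bsub>?Ks\<^esub> k) \<in> linear_maps K ?Ks ?Ks"
        using \<chi>c ED(1)[OF b] ED(1)[OF b2] by (intro lin_smult_const lin_id mK)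
      from sw_push[OF this mK mK dA, of "\<lambda>x y. \<phi>2 x \<otimes>\<^bsub>K\<^esub> \<phi> y"]
      show "?t b \<phi> b2 \<phi>2 d \<chi> = sw ?Ks (\<lambda>x y. \<chi> ((c \<otimes>\<^bsub>A\<^esub> ?S b) \<otimes>\<^bsub>A\<^esub> b2) \<otimes>\<^bsub>K\<^esub> (\<phi>2 x \<otimes>\<^bsub>K\<^esub> \<phi> y)) d"
        using Ed[OF b] Ed[OF b2] by (simp add: kap_def)
    qed
    also have "\<dots> = tsum ?Ks (\<lambda>b \<phi>. sw ?Ks (\<lambda>x y. tsum ?Ks (\<lambda>b2 \<phi>2.
          \<chi> ((c \<otimes>\<^bsub>A\<^esub> ?S b) \<otimes>\<^bsub>A\<^esub> b2) \<otimes>\<^bsub>K\<^esub> (\<phi>2 x \<otimes>\<^bsub>K\<^esub> \<phi> y)) E) d) E"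
      using Ed \<chi>c ED(1) by (intro tsum_cong sw_tsum_swap[symmetric] mK dA) auto
    also have "\<dots> = sw ?Ks (\<lambda>x y. tsum ?Ks (\<lambda>b \<phi>. tsum ?Ks (\<lambda>b2 \<phi>2.
          \<chi> ((c \<otimes>\<^bsub>A\<^esub> ?S b) \<otimes>\<^bsub>A\<^esub> b2) \<otimes>\<^bsub>K\<^esub> (\<phi>2 x \<otimes>\<^bsub>K\<^esub> \<phi> y)) E) E) d"
      using Ed \<chi>c ED(1) by (intro sw_tsum_swap[symmetric] mK dA KS.tsum_closed) auto
    \<comment> \<open>The double sum is the expansion of \<open>x\<close> and \<open>y\<close> along
      \<open>E\<close>, read backwards. It applies because \<open>I\<close> is an ideal stable under
      the antipode, so both partial functionals vanish on \<open>I\<close>.\<close>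
    also have "\<dots> = sw ?Ks (\<lambda>x y. \<chi> (c \<otimes>\<^bsub>A\<^esub> (x \<otimes>\<^bsub>A\<^esub> ?S y))) d"
    proof (rule sw_cong[OF dA])
      fix x y assume xy: "x \<in> carrier A" "y \<in> carrier A"
      have F: "(\<lambda>x. \<chi> (z \<otimes>\<^bsub>A\<^esub> x)) \<in> linear_maps K A ?Ks" if "z \<in> carrier A" for z
        using that by (intro lin_comp[OF lin_mult_left[OF algebra lin_id] \<chi>(1)])
      have F': "(\<lambda>y. \<chi> ((c \<otimes>\<^bsub>A\<^esub> ?S y) \<otimes>\<^bsub>A\<^esub> x)) \<in> linear_maps K A ?Ks"
        using xy c by (intro lin_comp[OF lin_mult_right[OF algebra lin_mult_left[OF algebra antipode]] \<chi>(1)])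
      have "\<chi> (c \<otimes>\<^bsub>A\<^esub> (x \<otimes>\<^bsub>A\<^esub> ?S y)) = \<chi> ((c \<otimes>\<^bsub>A\<^esub> ?S y) \<otimes>\<^bsub>A\<^esub> x)"
        using xy c S by (simp add: A.m_ac)
      also have "\<dots> = tsum ?Ks (\<lambda>b \<phi>. \<phi> y \<odot>\<^bsub>?Ks\<^esub> \<chi> ((c \<otimes>\<^bsub>A\<^esub> ?S b) \<otimes>\<^bsub>A\<^esub> x)) E"
      proof (rule E_expand[OF mK F' _ xy(2)])
        fix y assume "y \<in> I"
        then have "(c \<otimes>\<^bsub>A\<^esub> ?S y) \<otimes>\<^bsub>A\<^esub> x \<in> I"
          using hopf_idealD(3)[OF hopf_ideal] c xy Q.I.I_l_closed Q.I.I_r_closed by blast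
        then show "\<chi> ((c \<otimes>\<^bsub>A\<^esub> ?S y) \<otimes>\<^bsub>A\<^esub> x) = \<zero>\<^bsub>?Ks\<^esub>" using \<chi>(3) by simp
      qed
      also have "\<dots> = tsum ?Ks (\<lambda>b \<phi>. tsum ?Ks (\<lambda>b2 \<phi>2.
          \<chi> ((c \<otimes>\<^bsub>A\<^esub> ?S b) \<otimes>\<^bsub>A\<^esub> b2) \<otimes>\<^bsub>K\<^esub> (\<phi>2 x \<otimes>\<^bsub>K\<^esub> \<phi> y)) E) E"
      proof (rule tsum_cong)
        fix b \<phi> assume b: "(b, \<phi>) \<in> set E"
        note e = ED(1)[OF b]
        have "\<chi> ((c \<otimes>\<^bsub>A\<^esub> ?S b) \<otimes>\<^bsub>A\<^esub> x) = tsum ?Ks (\<lambda>b2 \<phi>2. \<phi>2 x \<odot>\<^bsub>?Ks\<^esub> \<chi> ((c \<otimes>\<^bsub>A\<^esub> ?S b) \<otimes>\<^bsub>A\<^esub> b2)) E"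
        proof (rule E_expand[OF mK F _ xy(1)])
          show "c \<otimes>\<^bsub>A\<^esub> ?S b \<in> carrier A" using c e S by simp
          fix x assume "x \<in> I"
          then have "(c \<otimes>\<^bsub>A\<^esub> ?S b) \<otimes>\<^bsub>A\<^esub> x \<in> I" using c e S by (intro Q.I.I_l_closed) auto
          then show "\<chi> ((c \<otimes>\<^bsub>A\<^esub> ?S b) \<otimes>\<^bsub>A\<^esub> x) = \<zero>\<^bsub>?Ks\<^esub>" using \<chi>(3) by simp
        qed
        then have "\<phi> y \<odot>\<^bsub>?Ks\<^esub> \<chi> ((c \<otimes>\<^bsub>A\<^esub> ?S b) \<otimes>\<^bsub>A\<^esub> x) =
            \<phi> y \<odot>\<^bsub>?Ks\<^esub> tsum ?Ks (\<lambda>b2 \<phi>2. \<phi>2 x \<odot>\<^bsub>?Ks\<^esub> \<chi> ((c \<otimes>\<^bsub>A\<^esub> ?S b) \<otimes>\<^bsub>A\<^esub> b2)) E"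
          by (rule arg_cong)
        also have "\<dots> = tsum ?Ks (\<lambda>b2 \<phi>2. \<phi> y \<odot>\<^bsub>?Ks\<^esub> (\<phi>2 x \<odot>\<^bsub>?Ks\<^esub> \<chi> ((c \<otimes>\<^bsub>A\<^esub> ?S b) \<otimes>\<^bsub>A\<^esub> b2))) E"
          using Ed xy \<chi>c[OF e] ED(1) b
          by (intro lin_tsum[OF lin_smult_const[OF mK lin_id] mK mK]) auto
        also have "\<dots> = tsum ?Ks (\<lambda>b2 \<phi>2. \<chi> ((c \<otimes>\<^bsub>A\<^esub> ?S b) \<otimes>\<^bsub>A\<^esub> b2) \<otimes>\<^bsub>K\<^esub> (\<phi>2 x \<otimes>\<^bsub>K\<^esub> \<phi> y)) E"
        proof (rule tsum_cong)
          fix b2 \<phi>2 assume b2: "(b2, \<phi>2) \<in> set E"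
          show "\<phi> y \<odot>\<^bsub>?Ks\<^esub> (\<phi>2 x \<odot>\<^bsub>?Ks\<^esub> \<chi> ((c \<otimes>\<^bsub>A\<^esub> ?S b) \<otimes>\<^bsub>A\<^esub> b2)) =
              \<chi> ((c \<otimes>\<^bsub>A\<^esub> ?S b) \<otimes>\<^bsub>A\<^esub> b2) \<otimes>\<^bsub>K\<^esub> (\<phi>2 x \<otimes>\<^bsub>K\<^esub> \<phi> y)"
            using Ed[OF b xy(2)] Ed[OF b2 xy(1)] \<chi>c[OF e ED(1)[OF b2]] by (simp add: K.m_ac)
        qed
        finally show "\<phi> y \<odot>\<^bsub>?Ks\<^esub> \<chi> ((c \<otimes>\<^bsub>A\<^esub> ?S b) \<otimes>\<^bsub>A\<^esub> x) =
            tsum ?Ks (\<lambda>b2 \<phi>2. \<chi> ((c \<otimes>\<^bsub>A\<^esub> ?S b) \<otimes>\<^bsub>A\<^esub> b2) \<otimes>\<^bsub>K\<^esub> (\<phi>2 x \<otimes>\<^bsub>K\<^esub> \<phi> y)) E" .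
      qed
      finally show "tsum ?Ks (\<lambda>b \<phi>. tsum ?Ks (\<lambda>b2 \<phi>2. \<chi> ((c \<otimes>\<^bsub>A\<^esub> ?S b) \<otimes>\<^bsub>A\<^esub> b2) \<otimes>\<^bsub>K\<^esub> (\<phi>2 x \<otimes>\<^bsub>K\<^esub> \<phi> y)) E) E =
          \<chi> (c \<otimes>\<^bsub>A\<^esub> (x \<otimes>\<^bsub>A\<^esub> ?S y))" by simp
    qed
    also have "\<dots> = counit A d \<odot>\<^bsub>?Ks\<^esub> \<chi> (c \<otimes>\<^bsub>A\<^esub> \<one>\<^bsub>A\<^esub>)"
      using c by (intro sw_antipode_right[OF mK dA, of "\<lambda>t. \<chi> (c \<otimes>\<^bsub>A\<^esub> t)"]
          lin_comp[OF lin_mult_left[OF algebra lin_id] \<chi>(1)])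
    also have "\<dots> = \<chi> c \<odot>\<^bsub>?Ks\<^esub> counit A d"
      using c \<chi>(2) dA counit_closed by (simp add: K.m_comm)
    finally show "tsum ?Ks (\<lambda>b \<phi>. tsum ?Ks (\<lambda>b2 \<phi>2. ?t b \<phi> b2 \<phi>2 d \<chi>) E) E = \<chi> c \<odot>\<^bsub>?Ks\<^esub> counit A d" .
  qed
  also have "\<dots> = counit A c"
    using functional_modD[OF functional_mod_counit] by (intro E_expand[OF mK _ _ c, symmetric]) auto
  finally show ?thesis .
qed

text \<open>This is the point where the faithful flatness of \<open>A\<close> over \<open>A\<^sup>H\<close> would usually be invoked. The
  two preceding lemmas express \<open>a\<close> as \<open>\<Sum> S(h\<^sub>1) t\<^sub>h(h\<^sub>2 a)\<close> with integral actions \<open>t\<^sub>h\<close> into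
  \<open>A\<^sup>H\<close>; for \<open>a \<in> I\<close> the counit vanishes on \<open>t\<^sub>h(h\<^sub>2 a)\<close>.\<close>

lemma acts_trivially_vanishes:
  assumes R: "algebra K R" and g: "g \<in> algebra_homs K A R" and T: "acts_trivially R g" and a: "a \<in> I"
  shows "g a = \<zero>\<^bsub>R\<^esub>"
proof -
  interpret R: algebra K R by fact
  let ?S = "antipode A" and ?\<epsilon> = "counit A"
  note mR = module_R[OF R] and aA = I_A[OF a] and S = antipode_closed
  have gl: "g \<in> linear_maps K A R" and gr: "g \<in> ring_hom A R" using g by (auto simp: algebra_homs_def)
  \<comment> \<open>The counit as test map: on coinvariants, a trivially acting point takes the same
    values as the unit of the group.\<close>
  have gV: "g v = ?\<epsilon> v \<odot>\<^bsub>R\<^esub> \<one>\<^bsub>R\<^esub>" if v: "v \<in> V" for v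
  proof -
    have "conv R g (\<lambda>a. ?\<epsilon> a \<odot>\<^bsub>R\<^esub> \<one>\<^bsub>R\<^esub>) v = ?\<epsilon> v \<odot>\<^bsub>R\<^esub> \<one>\<^bsub>R\<^esub>"
      using T v lin_smult_fun[OF mR counit_linear R.one_closed]
      unfolding acts_trivially_iff_conv[OF R gl] by blast
    moreover have "conv R g (\<lambda>a. ?\<epsilon> a \<odot>\<^bsub>R\<^esub> \<one>\<^bsub>R\<^esub>) v = sw R (\<lambda>x y. ?\<epsilon> y \<odot>\<^bsub>R\<^esub> g x) v"
      unfolding conv_def using V_A[OF v] counit_closed lin_closed[OF gl]
      by (intro sw_cong) (auto simp: R.smult_assoc2_right)
    ultimately show ?thesis using sw_counit_right[OF mR V_A[OF v] gl] by simp
  qed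
  define t where "t \<phi> = sw A (\<lambda>x y. integral \<phi> y \<odot>\<^bsub>A\<^esub> x)" for \<phi>
  have Bt: "bilinear K A A A (\<lambda>x y. integral \<phi> y \<odot>\<^bsub>A\<^esub> x)" if "functional_mod \<phi>" for \<phi>
    using functional_modD[OF functional_mod_integral[OF that]] by (intro lin_rules) auto
  have tV: "t \<phi> z \<in> V" if "functional_mod \<phi>" "z \<in> carrier A" for \<phi> z
    unfolding t_def by (rule integral_action_V[OF that])
  have \<epsilon>t: "?\<epsilon> (t \<phi> z) = integral \<phi> z" if \<phi>: "functional_mod \<phi>" and z: "z \<in> carrier A" for \<phi> z
  proof -
    note i = functional_modD[OF functional_mod_integral[OF \<phi>]]
    have "?\<epsilon> (t \<phi> z) = sw (scalars K) (\<lambda>x y. ?\<epsilon> (integral \<phi> y \<odot>\<^bsub>A\<^esub> x)) z"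
      unfolding t_def using i by (intro sw_push[OF counit_linear module_A module_scalars z]) auto
    also have "\<dots> = sw (scalars K) (\<lambda>x y. ?\<epsilon> x \<odot>\<^bsub>scalars K\<^esub> integral \<phi> y) z"
      using i by (intro sw_cong z) (simp add: lin_smult[OF counit_linear] counit_closed K.m_comm)
    also have "\<dots> = integral \<phi> z" by (rule sw_counit_left[OF module_scalars z i(1)])
    finally show ?thesis .
  qed
  \<comment> \<open>The coproduct of \<open>h\<^sub>2 a\<close> is a product of coproducts, so the
    left side is the sum of \<open>S(h\<^sub>1) h\<^sub>2 a\<^sub>1\<close> weighted by the integral
    at \<open>h\<^sub>3 a\<^sub>2\<close>, and the antipode cancels \<open>h\<^sub>1\<close> against
    \<open>h\<^sub>2\<close>.\<close>
  have key: "sw A (\<lambda>p q. ?S p \<otimes>\<^bsub>A\<^esub> t \<phi> (q \<otimes>\<^bsub>A\<^esub> a)) h = sw A (\<lambda>x y. integral \<phi> (h \<otimes>\<^bsub>A\<^esub> y) \<odot>\<^bsub>A\<^esub> x) a"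
    if \<phi>: "functional_mod \<phi>" and h: "h \<in> carrier A" for \<phi> h
  proof -
    note i = functional_modD[OF functional_mod_integral[OF \<phi>]]
    have "sw A (\<lambda>p q. ?S p \<otimes>\<^bsub>A\<^esub> t \<phi> (q \<otimes>\<^bsub>A\<^esub> a)) h =
        sw A (\<lambda>p q. sw A (\<lambda>u w. sw A (\<lambda>x y. integral \<phi> (w \<otimes>\<^bsub>A\<^esub> y) \<odot>\<^bsub>A\<^esub> ((?S p \<otimes>\<^bsub>A\<^esub> u) \<otimes>\<^bsub>A\<^esub> x)) a) q) h"
    proof (rule sw_cong[OF h])
      fix p q assume pq: "p \<in> carrier A" "q \<in> carrier A"
      note Sp = S[OF pq(1)]
      have "t \<phi> (q \<otimes>\<^bsub>A\<^esub> a) = sw A (\<lambda>u w. sw A (\<lambda>x y. integral \<phi> (w \<otimes>\<^bsub>A\<^esub> y) \<odot>\<^bsub>A\<^esub> (u \<otimes>\<^bsub>A\<^esub> x)) a) q"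
        unfolding t_def by (rule sw_mult[OF Bt[OF \<phi>] module_A pq(2) aA])
      then have "?S p \<otimes>\<^bsub>A\<^esub> t \<phi> (q \<otimes>\<^bsub>A\<^esub> a) =
          ?S p \<otimes>\<^bsub>A\<^esub> sw A (\<lambda>u w. sw A (\<lambda>x y. integral \<phi> (w \<otimes>\<^bsub>A\<^esub> y) \<odot>\<^bsub>A\<^esub> (u \<otimes>\<^bsub>A\<^esub> x)) a) q" by (rule arg_cong)
      also have "\<dots> = sw A (\<lambda>u w. ?S p \<otimes>\<^bsub>A\<^esub> sw A (\<lambda>x y. integral \<phi> (w \<otimes>\<^bsub>A\<^esub> y) \<odot>\<^bsub>A\<^esub> (u \<otimes>\<^bsub>A\<^esub> x)) a) q"
        using i(2) aA by (intro sw_push[OF lin_mult_left[OF algebra lin_id Sp] module_A module_A pq(2)] sw_closed module_A) auto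
      also have "\<dots> = sw A (\<lambda>u w. sw A (\<lambda>x y. ?S p \<otimes>\<^bsub>A\<^esub> (integral \<phi> (w \<otimes>\<^bsub>A\<^esub> y) \<odot>\<^bsub>A\<^esub> (u \<otimes>\<^bsub>A\<^esub> x))) a) q"
        using i(2) aA by (intro sw_cong pq sw_push[OF lin_mult_left[OF algebra lin_id Sp] module_A module_A]) auto
      also have "\<dots> = sw A (\<lambda>u w. sw A (\<lambda>x y. integral \<phi> (w \<otimes>\<^bsub>A\<^esub> y) \<odot>\<^bsub>A\<^esub> ((?S p \<otimes>\<^bsub>A\<^esub> u) \<otimes>\<^bsub>A\<^esub> x)) a) q"
        using i(2) aA Sp by (intro sw_cong pq) (simp_all add: A.smult_assoc2_right A.m_assoc)
      finally show "?S p \<otimes>\<^bsub>A\<^esub> t \<phi> (q \<otimes>\<^bsub>A\<^esub> a) =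
          sw A (\<lambda>u w. sw A (\<lambda>x y. integral \<phi> (w \<otimes>\<^bsub>A\<^esub> y) \<odot>\<^bsub>A\<^esub> ((?S p \<otimes>\<^bsub>A\<^esub> u) \<otimes>\<^bsub>A\<^esub> x)) a) q" .
    qed
    also have "\<dots> = sw A (\<lambda>r w. sw A (\<lambda>p u. sw A (\<lambda>x y. integral \<phi> (w \<otimes>\<^bsub>A\<^esub> y) \<odot>\<^bsub>A\<^esub> ((?S p \<otimes>\<^bsub>A\<^esub> u) \<otimes>\<^bsub>A\<^esub> x)) a) r) h"
      using i(2) h aA S
      by (intro sw_coassoc[symmetric] lin_rules lin_comp[OF _ i(1)]) auto
    also have "\<dots> = sw A (\<lambda>r w. ?\<epsilon> r \<odot>\<^bsub>A\<^esub> sw A (\<lambda>x y. integral \<phi> (w \<otimes>\<^bsub>A\<^esub> y) \<odot>\<^bsub>A\<^esub> (\<one>\<^bsub>A\<^esub> \<otimes>\<^bsub>A\<^esub> x)) a) h"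
    proof (rule sw_cong[OF h])
      fix r w assume rw: "r \<in> carrier A" "w \<in> carrier A"
      have "(\<lambda>v. sw A (\<lambda>x y. integral \<phi> (w \<otimes>\<^bsub>A\<^esub> y) \<odot>\<^bsub>A\<^esub> (v \<otimes>\<^bsub>A\<^esub> x)) a) \<in> linear_maps K A A"
        using i(2) rw aA by (intro lin_rules) auto
      from sw_antipode_left[OF module_A rw(1) this]
      show "sw A (\<lambda>p u. sw A (\<lambda>x y. integral \<phi> (w \<otimes>\<^bsub>A\<^esub> y) \<odot>\<^bsub>A\<^esub> ((?S p \<otimes>\<^bsub>A\<^esub> u) \<otimes>\<^bsub>A\<^esub> x)) a) r =
          ?\<epsilon> r \<odot>\<^bsub>A\<^esub> sw A (\<lambda>x y. integral \<phi> (w \<otimes>\<^bsub>A\<^esub> y) \<odot>\<^bsub>A\<^esub> (\<one>\<^bsub>A\<^esub> \<otimes>\<^bsub>A\<^esub> x)) a" .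
    qed
    also have "\<dots> = sw A (\<lambda>x y. integral \<phi> (h \<otimes>\<^bsub>A\<^esub> y) \<odot>\<^bsub>A\<^esub> (\<one>\<^bsub>A\<^esub> \<otimes>\<^bsub>A\<^esub> x)) a"
      using i(2) aA by (intro sw_counit_left module_A h lin_rules lin_comp[OF _ i(1)]) auto
    also have "\<dots> = sw A (\<lambda>x y. integral \<phi> (h \<otimes>\<^bsub>A\<^esub> y) \<odot>\<^bsub>A\<^esub> x) a"
      by (intro sw_cong aA) simp
    finally show ?thesis .
  qed
  \<comment> \<open>In \<open>a = \<Sum> a\<^sub>1 \<epsilon>(a\<^sub>2)\<close> the counit is
    replaced by the sum of integrals from \<open>integral_counit\<close> at
    \<open>c = a\<^sub>2\<close>; then \<open>key\<close> with \<open>h = S(b)\<close> rewrites each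
    term through \<open>V\<close>.\<close>
  have "a = sw A (\<lambda>x y. ?\<epsilon> y \<odot>\<^bsub>A\<^esub> x) a" by (rule sw_counit_right[OF module_A aA lin_id, symmetric])
  also have "\<dots> = sw A (\<lambda>x y. tsum A (\<lambda>b \<phi>. integral \<phi> (?S b \<otimes>\<^bsub>A\<^esub> y) \<odot>\<^bsub>A\<^esub> x) E) a"
  proof (rule sw_cong[OF aA])
    fix x y assume xy: "x \<in> carrier A" "y \<in> carrier A"
    have "?\<epsilon> y = tsum (scalars K) (\<lambda>b \<phi>. integral \<phi> (?S b \<otimes>\<^bsub>A\<^esub> y)) E"
      using integral_counit[OF xy(2)] xy(2) ED(1) S by (simp add: A.m_comm cong: tsum_cong)
    moreover have "(\<lambda>k. k \<odot>\<^bsub>A\<^esub> x) \<in> linear_maps K (scalars K) A"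
      using xy by (intro lin_smult_fun lin_id module_A)
    ultimately show "?\<epsilon> y \<odot>\<^bsub>A\<^esub> x = tsum A (\<lambda>b \<phi>. integral \<phi> (?S b \<otimes>\<^bsub>A\<^esub> y) \<odot>\<^bsub>A\<^esub> x) E"
      using lin_tsum[OF _ module_scalars module_A, of "\<lambda>k. k \<odot>\<^bsub>A\<^esub> x" E "\<lambda>b \<phi>. integral \<phi> (?S b \<otimes>\<^bsub>A\<^esub> y)"]
        ED functional_modD(2)[OF functional_mod_integral] xy S by simp
  qed
  also have "\<dots> = tsum A (\<lambda>b \<phi>. sw A (\<lambda>x y. integral \<phi> (?S b \<otimes>\<^bsub>A\<^esub> y) \<odot>\<^bsub>A\<^esub> x) a) E"
    using ED functional_modD(2)[OF functional_mod_integral] S by (intro sw_tsum_swap module_A aA) auto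
  also have "\<dots> = tsum A (\<lambda>b \<phi>. sw A (\<lambda>p q. ?S p \<otimes>\<^bsub>A\<^esub> t \<phi> (q \<otimes>\<^bsub>A\<^esub> a)) (?S b)) E"
    using ED S by (intro tsum_cong key[symmetric]) auto
  finally have "g a = g (tsum A (\<lambda>b \<phi>. sw A (\<lambda>p q. ?S p \<otimes>\<^bsub>A\<^esub> t \<phi> (q \<otimes>\<^bsub>A\<^esub> a)) (?S b)) E)"
    by (rule arg_cong)
  also have "\<dots> = tsum R (\<lambda>b \<phi>. g (sw A (\<lambda>p q. ?S p \<otimes>\<^bsub>A\<^esub> t \<phi> (q \<otimes>\<^bsub>A\<^esub> a)) (?S b))) E"
    using ED S tV V_A aA by (intro lin_tsum[OF gl module_A mR] sw_closed module_A A.m_closed) auto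
  also have "\<dots> = tsum R (\<lambda>b \<phi>. \<zero>\<^bsub>R\<^esub>) E"
  proof (rule tsum_cong)
    fix b \<phi> assume "(b, \<phi>) \<in> set E"
    note e = ED[OF this] and Sb = S[OF ED(1)[OF this]]
    have "g (sw A (\<lambda>p q. ?S p \<otimes>\<^bsub>A\<^esub> t \<phi> (q \<otimes>\<^bsub>A\<^esub> a)) (?S b)) = sw R (\<lambda>p q. g (?S p \<otimes>\<^bsub>A\<^esub> t \<phi> (q \<otimes>\<^bsub>A\<^esub> a))) (?S b)"
      using S tV[OF e(2)] V_A aA by (intro sw_push[OF gl module_A mR Sb] A.m_closed) auto
    also have "\<dots> = sw R (\<lambda>p q. \<zero>\<^bsub>R\<^esub>) (?S b)"
    proof (rule sw_cong[OF Sb])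
      fix p q assume pq: "p \<in> carrier A" "q \<in> carrier A"
      then have qa: "q \<otimes>\<^bsub>A\<^esub> a \<in> I" "q \<otimes>\<^bsub>A\<^esub> a \<in> carrier A" using a aA by (auto intro: Q.I.I_l_closed)
      have "g (t \<phi> (q \<otimes>\<^bsub>A\<^esub> a)) = \<zero>\<^bsub>R\<^esub>"
        using gV[OF tV[OF e(2) qa(2)]] \<epsilon>t[OF e(2) qa(2)]
          functional_modD(3)[OF functional_mod_integral[OF e(2)] qa(1)] by simp
      then show "g (?S p \<otimes>\<^bsub>A\<^esub> t \<phi> (q \<otimes>\<^bsub>A\<^esub> a)) = \<zero>\<^bsub>R\<^esub>"
        using ring_hom_mult[OF gr S[OF pq(1)] V_A[OF tV[OF e(2) qa(2)]]]
          lin_closed[OF gl S[OF pq(1)]] by simp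
    qed
    also have "\<dots> = \<zero>\<^bsub>R\<^esub>" by (simp add: sw_def tensor_lift_tsum R.tsum_zero)
    finally show "g (sw A (\<lambda>p q. ?S p \<otimes>\<^bsub>A\<^esub> t \<phi> (q \<otimes>\<^bsub>A\<^esub> a)) (?S b)) = \<zero>\<^bsub>R\<^esub>" .
  qed
  also have "\<dots> = \<zero>\<^bsub>R\<^esub>" by (rule R.tsum_zero)
  finally show ?thesis .
qed

lemma core_contained:
  "contained_in K (core K A I :: ('k, 'a, 'r) subfunctor) (closed_subscheme K A I)"
  unfolding contained_in_def
proof (intro allI impI subsetI)
  fix R :: "('k, 'r) module" and g
  assume R: "algebra K R" and "g \<in> core K A I R"
  then have g: "g \<in> carrier (points K A R)" "\<forall>a\<in>J. g a = \<zero>\<^bsub>R\<^esub>"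
    using core_eq_closed_subscheme[OF R] by (auto simp: closed_subscheme_def)
  then have "acts_trivially R g" using vanishes_J_iff[OF R points_homs] by blast
  then show "g \<in> closed_subscheme K A I R"
    using acts_trivially_vanishes[OF R points_homs[OF g(1)]] g(1) by (simp add: closed_subscheme_def)
qed

end

section \<open>Maximality of the core\<close>

text \<open>Copies an algebra along an injection of its carrier into another type, so that
  subfunctors over \<open>'r\<close> can be evaluated at \<open>R \<otimes> A\<close>.\<close>

definition transport :: "('t \<Rightarrow> 'r) \<Rightarrow> ('k, 't) module \<Rightarrow> ('k, 'r) module"
  where "transport j T = (let i = inv_into (carrier T) j in
    \<lparr>carrier = j ` carrier T, monoid.mult = (\<lambda>x y. j (i x \<otimes>\<^bsub>T\<^esub> i y)), one = j \<one>\<^bsub>T\<^esub>,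
     ring.zero = j \<zero>\<^bsub>T\<^esub>, add = (\<lambda>x y. j (i x \<oplus>\<^bsub>T\<^esub> i y)), smult = (\<lambda>r x. j (r \<odot>\<^bsub>T\<^esub> i x))\<rparr>)"

lemma
  assumes T: "algebra K T" and j: "inj_on j (carrier T)"
  shows algebra_transport: "algebra K (transport j T)"
    and transport_hom: "j \<in> algebra_homs K T (transport j T)"
proof -
  interpret T: algebra K T by fact
  let ?R = "transport j T"
  have carr: "carrier ?R = j ` carrier T" by (simp add: transport_def Let_def)
  have ops: "\<And>x y. x \<in> carrier T \<Longrightarrow> y \<in> carrier T \<Longrightarrow> j x \<otimes>\<^bsub>?R\<^esub> j y = j (x \<otimes>\<^bsub>T\<^esub> y)"
    "\<And>x y. x \<in> carrier T \<Longrightarrow> y \<in> carrier T \<Longrightarrow> j x \<oplus>\<^bsub>?R\<^esub> j y = j (x \<oplus>\<^bsub>T\<^esub> y)"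
    "\<And>r x. x \<in> carrier T \<Longrightarrow> r \<odot>\<^bsub>?R\<^esub> j x = j (r \<odot>\<^bsub>T\<^esub> x)"
    "\<zero>\<^bsub>?R\<^esub> = j \<zero>\<^bsub>T\<^esub>" "\<one>\<^bsub>?R\<^esub> = j \<one>\<^bsub>T\<^esub>"
    using j by (simp_all add: transport_def Let_def)
  have inv: "\<exists>y\<in>carrier T. j (x \<oplus>\<^bsub>T\<^esub> y) = j \<zero>\<^bsub>T\<^esub>" if "x \<in> carrier T" for x
    using that by (intro bexI[of _ "\<ominus>\<^bsub>T\<^esub> x"]) (simp_all add: T.M.r_neg)
  have ag: "abelian_group ?R"
    by (rule abelian_groupI) (auto simp: carr ops T.M.a_ac inv)
  have cm: "comm_monoid ?R"
    by (rule comm_monoidI) (auto simp: carr ops T.m_ac)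
  have "cring ?R"
    by (rule cringI[OF ag cm]) (auto simp: carr ops T.l_distr)
  then show "algebra K ?R"
    by (intro algebraI T.R_cring)
      (auto simp: carr ops T.smult_l_distr T.smult_r_distr T.smult_assoc1 T.smult_assoc2)
  show "j \<in> algebra_homs K T ?R"
    by (auto simp: algebra_homs_def linear_maps_def ring_hom_def carr ops)
qed

text \<open>An infinite set is equipollent to its square, which absorbs one entry of the list at a
  time. A fixed length fits the use below, where the lists are coordinate vectors along
  \<open>D\<close>.\<close>

lemma infinite_inj_fixed_length_lists:
  assumes "infinite (UNIV :: 'r set)"
  shows "\<exists>f :: 'r list \<Rightarrow> 'r. inj_on f {xs. length xs = n}"
proof (induction n)
  case 0
  show ?case by (intro exI[of _ "\<lambda>_. undefined"]) (simp add: inj_on_def)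
next
  case (Suc n)
  then obtain f :: "'r list \<Rightarrow> 'r" where f: "inj_on f {xs. length xs = n}" by blast
  obtain p :: "'r \<times> 'r \<Rightarrow> 'r" where p: "inj p"
    using card_of_Times_same_infinite[OF assms] card_of_ordIso[of "UNIV \<times> UNIV" "UNIV :: 'r set"]
    by (auto simp: bij_betw_def)
  have "inj_on (\<lambda>xs. p (hd xs, f (tl xs))) {xs. length xs = Suc n}"
  proof (rule inj_onI)
    fix xs ys assume *: "xs \<in> {xs. length xs = Suc n}" "ys \<in> {xs. length xs = Suc n}"
      "p (hd xs, f (tl xs)) = p (hd ys, f (tl ys))"
    then have "hd xs = hd ys" "f (tl xs) = f (tl ys)" using injD[OF p] by blast+
    then show "xs = ys" using * inj_onD[OF f, of "tl xs" "tl ys"]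
      by (cases xs; cases ys) auto
  qed
  then show ?case by blast
qed

context subgroup_of_finite_group_scheme
begin

text \<open>A tensor is determined by its contractions with the functionals of \<open>D\<close>, a
  list of fixed length over the type \<open>'r\<close>; such lists are then coded by single
  elements.\<close>

lemma tensor_inj:
  assumes "infinite (UNIV :: 'r set)" and R: "algebra K (R :: ('k, 'r) module)"
  obtains j :: "('r \<times> 'a) list set \<Rightarrow> 'r" where "inj_on j (carrier (tensor K R A))"
proof -
  interpret RA: two_modules K R A by (intro two_modulesI module_R[OF R] module_A)
  let ?F = "\<lambda>U. map (\<lambda>(b, \<phi>). tensor_lift R (\<lambda>r a. \<phi> a \<odot>\<^bsub>R\<^esub> r) U) D"
  have "inj_on ?F (carrier RA.T)"
  proof (rule inj_onI)
    fix U W assume UW: "U \<in> carrier RA.T" "W \<in> carrier RA.T" "?F U = ?F W"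
    show "U = W"
      using UW(3) by (intro RA.tensor_eqI[OF D UW(1,2)]) auto
  qed
  moreover obtain f :: "'r list \<Rightarrow> 'r" where "inj_on f {xs. length xs = length D}"
    using infinite_inj_fixed_length_lists[OF assms(1)] by blast
  then have "inj_on f (?F ` carrier RA.T)" by (rule inj_on_subset) auto
  ultimately have "inj_on (f \<circ> ?F) (carrier RA.T)" by (rule comp_inj_on)
  then show thesis by (rule that)
qed

text \<open>Conjugating a point of \<open>N(R)\<close> by the generic point \<open>x\<close> of \<open>G\<close> over \<open>R \<otimes> A\<close> gives
  \<open>n x = x y\<close> with \<open>y \<in> N(R \<otimes> A) \<subseteq> H(R \<otimes> A)\<close>, so \<open>v(n x) = v(x)\<close> for every \<open>v \<in> A\<^sup>H\<close>.\<close>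

lemma normal_acts_trivially:
  fixes N :: "('k, 'a, 'r) subfunctor"
  assumes inf: "infinite (UNIV :: 'r set)" and N: "normal_subgroup_scheme K A N"
    and NI: "contained_in K N (closed_subscheme K A I)" and R: "algebra K R" and n: "n \<in> N R"
  shows "acts_trivially R n"
proof -
  obtain L where L: "hopf_ideal K A L" "\<And>R :: ('k, 'r) module. algebra K R \<Longrightarrow> N R = closed_subscheme K A L R"
    using N unfolding normal_subgroup_scheme_def subgroup_scheme_def by blast
  interpret R: algebra K R by fact
  interpret RA: two_algebras K R A by (intro two_algebras.intro R algebra)
  note mR = module_R[OF R] and mT = RA.module_tensor
  obtain j :: "('r \<times> 'a) list set \<Rightarrow> 'r" where j: "inj_on j (carrier RA.T)"
    using tensor_inj[OF inf R] by blast
  define T' where "T' = transport j RA.T"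
  have T': "algebra K T'" unfolding T'_def by (rule algebra_transport[OF RA.algebra_tensor j])
  interpret T': algebra K T' by (rule T')
  note mT' = module_R[OF T']
  have jh: "j \<in> algebra_homs K RA.T T'" unfolding T'_def by (rule transport_hom[OF RA.algebra_tensor j])
  then have jl: "j \<in> linear_maps K RA.T T'" and jr: "j \<in> ring_hom RA.T T'" by (auto simp: algebra_homs_def)
  have npt: "n \<in> carrier (points K A R)" "\<And>a. a \<in> L \<Longrightarrow> n a = \<zero>\<^bsub>R\<^esub>"
    using n L(2)[OF R] by (auto simp: closed_subscheme_def)
  note nd = pointsD[OF npt(1)]
  note p1 = RA.pure_one_left RA.pure_one_right
  have p1l: "(\<lambda>a. RA.pure \<one>\<^bsub>R\<^esub> a) \<in> linear_maps K A RA.T" "(\<lambda>r. RA.pure r \<one>\<^bsub>A\<^esub>) \<in> linear_maps K R RA.T"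
    using p1 by (auto simp: algebra_homs_def)
  have pm: "a \<in> carrier A \<Longrightarrow> b \<in> carrier A \<Longrightarrow> RA.pure \<one>\<^bsub>R\<^esub> (a \<otimes>\<^bsub>A\<^esub> b) = RA.pure \<one>\<^bsub>R\<^esub> a \<otimes>\<^bsub>RA.T\<^esub> RA.pure \<one>\<^bsub>R\<^esub> b"
    "r \<in> carrier R \<Longrightarrow> s \<in> carrier R \<Longrightarrow> RA.pure (r \<otimes>\<^bsub>R\<^esub> s) \<one>\<^bsub>A\<^esub> = RA.pure r \<one>\<^bsub>A\<^esub> \<otimes>\<^bsub>RA.T\<^esub> RA.pure s \<one>\<^bsub>A\<^esub>" for a b r s
    by (simp_all add: RA.pure_mult)
  \<comment> \<open>The generic point of \<open>G\<close>, given by the coprojection of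
    \<open>A\<close> into \<open>R \<otimes> A\<close>; \<open>n'\<close> is \<open>n\<close> base
    changed along the other coprojection. The injection \<open>j\<close> only moves the values into
    \<open>'r\<close>.\<close>
  define x' where "x' = (\<lambda>a\<in>carrier A. j (RA.pure \<one>\<^bsub>R\<^esub> a))"
  define n' where "n' = (\<lambda>a\<in>carrier A. j (RA.pure (n a) \<one>\<^bsub>A\<^esub>))"
  have x': "x' \<in> carrier (points K A T')"
    unfolding x'_def
    by (rule pointsI[OF lin_comp[OF p1l(1) jl]])
      (simp_all add: pm ring_hom_mult[OF jr] RA.pure_closed RA.one_tensor[symmetric] ring_hom_one[OF jr])
  have n': "n' \<in> carrier (points K A T')"
    unfolding n'_def
    by (rule pointsI[OF lin_comp[OF lin_comp[OF nd(1) p1l(2)] jl]])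
      (simp_all add: nd pm ring_hom_mult[OF jr] RA.pure_closed RA.one_tensor[symmetric] ring_hom_one[OF jr])
  \<comment> \<open>\<open>N\<close> is cut out by one ideal \<open>L\<close> for all test algebras,
    so the base change of \<open>n\<close> still kills \<open>L\<close>.\<close>
  have "n' a = \<zero>\<^bsub>T'\<^esub>" if "a \<in> L" for a
    using hopf_idealD(4)[OF L(1) that] npt(2)[OF that] lin_zero[OF p1l(2) mR mT] lin_zero[OF jl mT mT']
    by (simp add: n'_def)
  then have "n' \<in> N T'" using n' L(2)[OF T'] by (simp add: closed_subscheme_def)
  define y where "y = inv\<^bsub>points K A T'\<^esub> x' \<otimes>\<^bsub>points K A T'\<^esub> n' \<otimes>\<^bsub>points K A T'\<^esub> x'"
  note grp = group_points[OF T']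
  have "N T' \<lhd> points K A T'" using N T' unfolding normal_subgroup_scheme_def by blast
  then have "y \<in> N T'" unfolding y_def by (rule normal.inv_op_closed1[OF _ x' \<open>n' \<in> N T'\<close>])
  then have "y \<in> closed_subscheme K A I T'" using NI T' unfolding contained_in_def by blast
  then have y: "y \<in> carrier (points K A T')" "\<And>a. a \<in> I \<Longrightarrow> y a = \<zero>\<^bsub>T'\<^esub>" by (auto simp: closed_subscheme_def)
  have xy: "x' \<otimes>\<^bsub>points K A T'\<^esub> y = n' \<otimes>\<^bsub>points K A T'\<^esub> x'"
    using group.inv_solve_left[OF grp] group.inv_closed[OF grp x']
    unfolding y_def
    by (metis group.is_monoid grp group.inv_solve_left monoid.m_assoc monoid.m_closed n' x')
  note yd = pointsD[OF y(1)] and xd = pointsD[OF x'] and nd' = pointsD[OF n']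
  \<comment> \<open>The equation \<open>v(n x) = v(x)\<close> as an identity of tensors. Since
    \<open>y\<close> kills \<open>I\<close>, coinvariance gives \<open>v(x y) = v(x)\<close>; then
    \<open>x y = n x\<close> is inserted, and injectivity of \<open>j\<close> brings the result back
    to \<open>R \<otimes> A\<close>.\<close>
  have eq: "sw RA.T (\<lambda>a b. RA.pure (n a) b) v = RA.pure \<one>\<^bsub>R\<^esub> v" if v: "v \<in> V" for v
  proof -
    have vA: "v \<in> carrier A" by (rule V_A[OF v])
    have pc: "RA.pure (n a) b \<in> carrier RA.T" if "a \<in> carrier A" "b \<in> carrier A" for a b
      using that nd(2) by (intro RA.pure_closed) auto
    have sc: "sw RA.T (\<lambda>a b. RA.pure (n a) b) v \<in> carrier RA.T"
      by (intro sw_closed mT vA pc)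
    have "j (RA.pure \<one>\<^bsub>R\<^esub> v) = x' v" using vA by (simp add: x'_def)
    also have "\<dots> = x' v \<otimes>\<^bsub>T'\<^esub> y \<one>\<^bsub>A\<^esub>" using xd(2)[OF vA] yd(4) by simp
    also have "\<dots> = sw T' (\<lambda>a b. x' a \<otimes>\<^bsub>T'\<^esub> y b) v"
      by (rule sw_V[OF mT' bilinear_points[OF T' xd(1) yd(1)] _ v, symmetric]) (simp add: y(2) xd(2))
    also have "\<dots> = (x' \<otimes>\<^bsub>points K A T'\<^esub> y) v" using vA by (simp add: points_mult)
    also have "\<dots> = sw T' (\<lambda>a b. n' a \<otimes>\<^bsub>T'\<^esub> x' b) v" unfolding xy using vA by (simp add: points_mult)
    also have "\<dots> = sw T' (\<lambda>a b. j (RA.pure (n a) b)) v"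
    proof (rule sw_cong[OF vA])
      fix a b assume ab: "a \<in> carrier A" "b \<in> carrier A"
      then show "n' a \<otimes>\<^bsub>T'\<^esub> x' b = j (RA.pure (n a) b)"
        using nd(2)[OF ab(1)]
        by (simp add: n'_def x'_def ring_hom_mult[OF jr, symmetric] RA.pure_closed RA.pure_mult)
    qed
    also have "\<dots> = j (sw RA.T (\<lambda>a b. RA.pure (n a) b) v)"
      by (rule sw_push[OF jl mT mT' vA pc, symmetric])
    finally show ?thesis
      using inj_onD[OF j _ sc, of "RA.pure \<one>\<^bsub>R\<^esub> v"] vA by (simp add: RA.pure_closed)
  qed
  show ?thesis
    unfolding acts_trivially_def
  proof (intro ballI)
    fix v \<psi> assume v: "v \<in> V" and \<psi>: "\<psi> \<in> linear_maps K A (scalars K)"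
    have \<psi>c: "a \<in> carrier A \<Longrightarrow> \<psi> a \<in> carrier K" for a using lin_closed[OF \<psi>] by simp
    have vA: "v \<in> carrier A" by (rule V_A[OF v])
    \<comment> \<open>Contracting the second leg of \<open>eq\<close> with \<psi> undoes the passage
      to the generic point and leaves the matrix coefficient of \<open>n\<close> over
      \<open>R\<close>.\<close>
    have B: "bilinear K R A R (\<lambda>r a. \<psi> a \<odot>\<^bsub>R\<^esub> r)"
      using \<psi>c by (intro bilinearI lin_smult_fun lin_smult_const lin_id mR \<psi>) auto
    have "sw R (\<lambda>a b. \<psi> b \<odot>\<^bsub>R\<^esub> n a) v = sw R (\<lambda>a b. tensor_lift R (\<lambda>r a. \<psi> a \<odot>\<^bsub>R\<^esub> r) (RA.pure (n a) b)) v"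
      using nd(2) by (intro sw_cong vA) (simp add: RA.lift_pure[OF B mR])
    also have "\<dots> = tensor_lift R (\<lambda>r a. \<psi> a \<odot>\<^bsub>R\<^esub> r) (sw RA.T (\<lambda>a b. RA.pure (n a) b) v)"
      using nd(2) by (intro sw_push[OF RA.lift_linear[OF B mR] mT mR vA, symmetric] RA.pure_closed) auto
    also have "\<dots> = tensor_lift R (\<lambda>r a. \<psi> a \<odot>\<^bsub>R\<^esub> r) (RA.pure \<one>\<^bsub>R\<^esub> v)" by (simp only: eq[OF v])
    also have "\<dots> = \<psi> v \<odot>\<^bsub>R\<^esub> \<one>\<^bsub>R\<^esub>" using vA by (simp add: RA.lift_pure[OF B mR])
    finally show "sw R (\<lambda>a b. \<psi> b \<odot>\<^bsub>R\<^esub> n a) v = \<psi> v \<odot>\<^bsub>R\<^esub> \<one>\<^bsub>R\<^esub>" .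
  qed
qed

text \<open>Because \<open>mu\<close> inverts, membership in the core concerns the inverse of
  \<open>n\<close>. It lies in \<open>N R\<close> as well, so the preceding lemma applies to
  it.\<close>

lemma normal_contained_in_core:
  fixes N :: "('k, 'a, 'r) subfunctor"
  assumes inf: "infinite (UNIV :: 'r set)" and N: "normal_subgroup_scheme K A N"
    and NI: "contained_in K N (closed_subscheme K A I)"
  shows "contained_in K N (core K A I)"
  unfolding contained_in_def
proof (intro allI impI subsetI)
  fix R :: "('k, 'r) module" and n
  assume R: "algebra K R" and n: "n \<in> N R"
  have "N R \<lhd> points K A R" using N R unfolding normal_subgroup_scheme_def by blast
  then have sub: "subgroup (N R) (points K A R)" by (rule normal_imp_subgroup)
  have "inv\<^bsub>points K A R\<^esub> n \<in> N R" by (rule subgroup.m_inv_closed[OF sub n])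
  then show "n \<in> core K A I R"
    using normal_acts_trivially[OF inf N NI R] subgroup.mem_carrier[OF sub n] core_iff[OF R] by blast
qed

end

theorem proposition3p14:
  fixes K :: "'k ring" and A :: "('k, 'a) hopf_algebra" and I :: "'a set"
  assumes "finite_group_scheme K A"
    and "hopf_ideal K A I"
    and "large_universe A TYPE('r)"
  shows "normal_subgroup_scheme K A (core K A I :: ('k, 'a, 'r) subfunctor) \<and>
    contained_in K (core K A I :: ('k, 'a, 'r) subfunctor) (closed_subscheme K A I) \<and>
    (\<forall>N :: ('k, 'a, 'r) subfunctor.
      normal_subgroup_scheme K A N \<and> contained_in K N (closed_subscheme K A I)
        \<longrightarrow> contained_in K N (core K A I))"
proof -
  interpret subgroup_of_finite_group_scheme K A I
    by (intro subgroup_of_finite_group_scheme.intro subgroup_of_finite_group_scheme_axioms.intro assms)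
  have "infinite (UNIV :: 'r set)" using assms(3) by (simp add: large_universe_def)
  then show ?thesis
    using core_normal_subgroup_scheme core_contained normal_contained_in_core by blast
qed

end
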